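(* Let $X$ be a smooth toric Fano variety with $\dim(X)=n\geq 6$ and $m(X)\geq 3$. If $X$ has a centrally symmetric primitive relation of order $n-1$, $$x_0+x_1+\cdots+x_{n-2}=0,$$ then the Picard rank satisfies $\rho(X)\leq 3$. Moreover, $m(X)=n-2$ and the relation $x_0+x_1+\cdots+x_{n-2}=0$ is the only centrally symmetric primitive relation of $X$.
   Context: All varieties are over $\mathbb{C}$. A toric variety $X$ of dimension $n$ corresponds to a fan $\Sigma_X$ in $N_{\mathbb{Q}}=N\otimes_{\mathbb{Z}}\mathbb{Q}$, where $N$ is a free abelian group of rank $n$. $G(\Sigma_X)\subset N$ denotes the set of primitive generators of the rays of $\Sigma_X$, and $\langle v_1,\dots,v_l\rangle$ is the cone generated by $v_1,\dots,v_l$. Let $X$ be smooth and proper (so $\Sigma_X$ is regular and complete). A nonempty set $P=\{v_1,\dots,v_r\}\subseteq G(\Sigma_X)$ is a primitive collection if $\langle v_1,\dots,v_r\rangle\notin\Sigma_X$ but every proper subset of $P$ generates a cone of $\Sigma_X$. Its order is $r=|P|$. It is centrally symmetric if $v_1+\cdots+v_r=0$; this equality is then called a centrally symmetric primitive relation (of order $r$) of $X$. For $X$ projective, the minimal $\mathbb{P}$-dimension is $m(X)=\min\{m\in\mathbb{Z}_{>0} : \Sigma_X \text{ has a centrally symmetric primitive collection of order } m+1\}$; it is known that such collections exist. *)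

theory Defs
  imports "HOL-Analysis.Analysis"
begin

text \<open>
  A toric variety of dimension \<open>n = CARD('n)\<close> is represented by its fan. The lattice \<open>N\<close> is
  \<open>\<int>\<^sup>n\<close> inside \<open>real ^ 'n\<close>; the dual lattice \<open>M\<close> is identified with it through the standard inner
  product. Cones are rational polyhedral cones in \<open>N \<otimes> \<real>\<close>; these correspond bijectively
  (faces, intersections, generators) to polyhedral cones in \<open>N \<otimes> \<rat>\<close>.
\<close>

definition int_lattice :: "(real ^ 'n) set" where
  "int_lattice = {x. \<forall>i. x $ i \<in> \<int>}"

definition lattice_basis :: "(real ^ 'n) set \<Rightarrow> bool" where
  "lattice_basis B \<longleftrightarrow>
     finite B \<and> independent B \<and>
     int_lattice = {\<Sum>b\<in>B. of_int (c b) *\<^sub>R b | c :: real ^ 'n \<Rightarrow> int. True}"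

definition primitive_vector :: "real ^ 'n \<Rightarrow> bool" where
  "primitive_vector v \<longleftrightarrow>
     v \<in> int_lattice \<and> v \<noteq> 0 \<and>
     (\<forall>w\<in>int_lattice. \<forall>k::nat. v = of_nat k *\<^sub>R w \<longrightarrow> k = 1)"

definition strongly_convex_rational_cone :: "(real ^ 'n) set \<Rightarrow> bool" where
  "strongly_convex_rational_cone \<sigma> \<longleftrightarrow>
     (\<exists>S. finite S \<and> S \<subseteq> int_lattice \<and> \<sigma> = convex_cone hull S) \<and>
     \<sigma> \<inter> uminus ` \<sigma> = {0}"

text \<open>
  The library relation \<open>face_of\<close> admits the empty set as a face, which is not a cone. The nonempty
  faces of a polyhedral cone in the sense of \<open>face_of\<close> are exactly its faces as a cone.
\<close>

definition is_fan :: "(real ^ 'n) set set \<Rightarrow> bool" where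
  "is_fan \<Sigma> \<longleftrightarrow>
     finite \<Sigma> \<and> \<Sigma> \<noteq> {} \<and>
     (\<forall>\<sigma>\<in>\<Sigma>. strongly_convex_rational_cone \<sigma>) \<and>
     (\<forall>\<sigma>\<in>\<Sigma>. \<forall>\<tau>. \<tau> face_of \<sigma> \<and> \<tau> \<noteq> {} \<longrightarrow> \<tau> \<in> \<Sigma>) \<and>
     (\<forall>\<sigma>\<in>\<Sigma>. \<forall>\<tau>\<in>\<Sigma>. \<sigma> \<inter> \<tau> face_of \<sigma> \<and> \<sigma> \<inter> \<tau> face_of \<tau>)"

definition regular_fan :: "(real ^ 'n) set set \<Rightarrow> bool" where
  "regular_fan \<Sigma> \<longleftrightarrow>
     (\<forall>\<sigma>\<in>\<Sigma>. \<exists>B S. lattice_basis B \<and> S \<subseteq> B \<and> \<sigma> = convex_cone hull S)"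

definition complete_fan :: "(real ^ 'n) set set \<Rightarrow> bool" where
  "complete_fan \<Sigma> \<longleftrightarrow> \<Union>\<Sigma> = UNIV"

definition ray_generators :: "(real ^ 'n) set set \<Rightarrow> (real ^ 'n) set" where
  "ray_generators \<Sigma> = {v. primitive_vector v \<and> convex_cone hull {v} \<in> \<Sigma>}"

text \<open>
  A torus-invariant divisor \<open>\<Sum>\<^sub>v D v \<cdot> D\<^sub>v\<close>, with \<open>D\<^sub>v\<close> the prime divisor of the ray through \<open>v\<close>, is
  given by its coefficients \<open>D v\<close>; the values of \<open>D\<close> outside the ray generators play no role.
  It is Cartier iff it has an integral support function, normalised by \<open>\<phi> v = - D v\<close>.
\<close>

definition support_function ::
  "(real ^ 'n) set set \<Rightarrow> (real ^ 'n \<Rightarrow> int) \<Rightarrow> (real ^ 'n \<Rightarrow> real) \<Rightarrow> bool" where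
  "support_function \<Sigma> D \<phi> \<longleftrightarrow>
     (\<forall>\<sigma>\<in>\<Sigma>. \<exists>m\<in>int_lattice. \<forall>x\<in>\<sigma>. \<phi> x = m \<bullet> x) \<and>
     (\<forall>v\<in>ray_generators \<Sigma>. \<phi> v = - of_int (D v))"

definition cartier_divisor :: "(real ^ 'n) set set \<Rightarrow> (real ^ 'n \<Rightarrow> int) \<Rightarrow> bool" where
  "cartier_divisor \<Sigma> D \<longleftrightarrow> (\<exists>\<phi>. support_function \<Sigma> D \<phi>)"

text \<open>The divisor of the character with exponent \<open>m\<close> has coefficient \<open>m \<bullet> v\<close> along \<open>D\<^sub>v\<close>.\<close>

definition principal_divisor :: "(real ^ 'n) set set \<Rightarrow> (real ^ 'n \<Rightarrow> int) \<Rightarrow> bool" where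
  "principal_divisor \<Sigma> D \<longleftrightarrow>
     (\<exists>m\<in>int_lattice. \<forall>v\<in>ray_generators \<Sigma>. of_int (D v) = m \<bullet> v)"

text \<open>
  The Picard group of a toric variety with complete fan is the group of torus-invariant Cartier
  divisors modulo the divisors of characters. The Picard rank is the rank of this abelian group:
  the maximal number of classes that are linearly independent over \<open>\<int>\<close>.
\<close>

definition picard_rank :: "(real ^ 'n) set set \<Rightarrow> nat" where
  "picard_rank \<Sigma> =
     Max {k. \<exists>D :: nat \<Rightarrow> real ^ 'n \<Rightarrow> int.
            (\<forall>i<k. cartier_divisor \<Sigma> (D i)) \<and>
            (\<forall>c :: nat \<Rightarrow> int. principal_divisor \<Sigma> (\<lambda>v. \<Sum>i<k. c i * D i v)
               \<longrightarrow> (\<forall>i<k. c i = 0))}"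

text \<open>
  On a complete toric variety a divisor is ample iff its support function is strictly convex in the
  toric sense, which with the sign normalisation above means: \<open>\<phi>\<close> is concave in the
  analyst's sense, and for every maximal cone \<open>\<sigma>\<close> the linear function that agrees with \<open>\<phi>\<close> on
  \<open>\<sigma>\<close> agrees with it only there.
\<close>

definition ample_divisor :: "(real ^ 'n) set set \<Rightarrow> (real ^ 'n \<Rightarrow> int) \<Rightarrow> bool" where
  "ample_divisor \<Sigma> D \<longleftrightarrow>
     (\<exists>\<phi>. support_function \<Sigma> D \<phi> \<and> concave_on UNIV \<phi> \<and>
          (\<forall>\<sigma>\<in>\<Sigma>. dim \<sigma> = CARD('n) \<longrightarrow>
             (\<exists>m\<in>int_lattice. \<forall>x. \<phi> x = m \<bullet> x \<longleftrightarrow> x \<in> \<sigma>)))"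

text \<open>The anticanonical divisor is the sum of all torus-invariant prime divisors.\<close>

definition anticanonical_divisor :: "real ^ 'n \<Rightarrow> int" where
  "anticanonical_divisor = (\<lambda>v. 1)"

definition smooth_toric_fano :: "(real ^ 'n) set set \<Rightarrow> bool" where
  "smooth_toric_fano \<Sigma> \<longleftrightarrow>
     is_fan \<Sigma> \<and> regular_fan \<Sigma> \<and> complete_fan \<Sigma> \<and> ample_divisor \<Sigma> anticanonical_divisor"

definition primitive_collection :: "(real ^ 'n) set set \<Rightarrow> (real ^ 'n) set \<Rightarrow> bool" where
  "primitive_collection \<Sigma> P \<longleftrightarrow>
     P \<noteq> {} \<and> P \<subseteq> ray_generators \<Sigma> \<and> convex_cone hull P \<notin> \<Sigma> \<and>
     (\<forall>Q. Q \<subset> P \<longrightarrow> convex_cone hull Q \<in> \<Sigma>)"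

definition centrally_symmetric_primitive_collection ::
  "(real ^ 'n) set set \<Rightarrow> (real ^ 'n) set \<Rightarrow> bool" where
  "centrally_symmetric_primitive_collection \<Sigma> P \<longleftrightarrow> primitive_collection \<Sigma> P \<and> \<Sum>P = 0"

text \<open>
  The minimum exists for projective \<open>X\<close>, since such an \<open>X\<close> has a centrally symmetric primitive
  collection.
\<close>

definition minimal_P_dimension :: "(real ^ 'n) set set \<Rightarrow> nat" where
  "minimal_P_dimension \<Sigma> =
     (LEAST m. m > 0 \<and>
        (\<exists>P. centrally_symmetric_primitive_collection \<Sigma> P \<and> card P = m + 1))"

end

theory Submission
  imports Defs "HOL-Library.Multiset"
begin

text \<open>
  Write \<open>n\<close> for the dimension, \<open>P\<close> for the given collection, \<open>V\<close> for the lattice it spans and \<open>Y\<close>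
  for the remaining ray generators; the Picard rank is at most \<open>card P + card Y - n\<close>, so \<open>card Y \<le> 4\<close>
  has to be shown. The Fano condition gives every maximal cone a linear height that is \<open>1\<close> on its
  generators and nonpositive on all others. Hence a sum of \<open>k\<close> ray generators that do not span a cone
  is a sum of fewer than \<open>k\<close> ray generators, and a vanishing sum of ray generators of minimal length
  is a centrally symmetric primitive collection. Since \<open>N / V\<close> has rank two, a linear relation
  modulo \<open>V\<close> shows that \<open>P\<close> is the only such collection, so that vanishing sums have at least \<open>n - 1\<close> summands.

  For \<open>m \<in> P\<close> the star of the cone over \<open>P - {m}\<close> projects to a smooth complete fan in the plane.
  If \<open>y + y' \<in> V\<close> for some \<open>y\<close>, \<open>y'\<close> in \<open>Y\<close>, then \<open>y + y' \<in> P\<close> and exactly one of \<open>y\<close>, \<open>y'\<close> lies in each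
  maximal cone of the star, for all but one \<open>m\<close>. So these stars are quadrangles, and heights force
  all of them to be the same. Otherwise every star is a triangle whose vertices add up to one
  or two elements of \<open>P\<close>; as \<open>P\<close> has at least five elements, few stars can differ from the others, and
  the possible deviations are excluded, except for the blow-up that adds a fourth element to \<open>Y\<close>.
\<close>

text \<open>The obstacle is that there are d - 1 stars, one for each omitted \<open>m\<close>, and
  that an element of \<open>Y\<close> need not be adjacent to any cone over \<open>P - {m}\<close>;
  projecting one star to the plane N / V therefore cannot bound \<open>Y\<close>. The bridge is an
  averaging: if a maximal cone is chosen in each star, the heights of a fixed element of
  \<open>V\<close> add up to 0 over all \<open>m\<close> (\<open>sum_hgt_V\<close>). Inequalities
  valid in every star can be summed, and the unknown part in \<open>V\<close> drops out. For an edge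
  common to all stars this shows that no further generator projects into the cone that it spans;
  hence the aim of showing that the stars coincide.

  The hypotheses enter through small numbers. m(X) \<ge> 3 means that no sum of at most three ray
  generators vanishes, so short relations never collapse while they are rewritten. n \<ge> 6 gives
  \<open>P\<close> at least five elements, so some \<open>m\<close> avoids any four given ones. Most
  geometric arguments reduce to one fact: an expression of a lattice point as a sum over a face is
  its unique shortest expression.\<close>

lemma int_dependent:
  fixes D :: "'i \<Rightarrow> 's \<Rightarrow> int"
  assumes "finite S" "finite I" "card S < card I"
  shows "\<exists>c. (\<exists>i\<in>I. c i \<noteq> 0) \<and> (\<forall>s\<in>S. (\<Sum>i\<in>I. c i * D i s) = 0)"
  using assms
proof (induction S arbitrary: I D)
  case empty
  then have "I \<noteq> {}" by auto
  then show ?case by (intro exI[of _ "\<lambda>_. 1"]) auto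
next
  case (insert s S)
  show ?case
  proof (cases "\<forall>i\<in>I. D i s = 0")
    case True
    obtain c where c: "\<exists>i\<in>I. c i \<noteq> 0" "\<forall>s\<in>S. (\<Sum>i\<in>I. c i * D i s) = 0"
      using insert.IH[of I D] insert.prems insert.hyps by auto
    then show ?thesis using True by (intro exI[of _ c]) auto
  next
    case False
    then obtain j where j: "j \<in> I" "D j s \<noteq> 0" by auto
    define I' where "I' = I - {j}"
    have I': "finite I'" "j \<notin> I'" "I = insert j I'" using j insert.prems by (auto simp: I'_def)
    have "card S < card I'" using insert.prems insert.hyps I' by simp
    then obtain c where c: "\<exists>i\<in>I'. c i \<noteq> 0" "\<forall>t\<in>S. (\<Sum>i\<in>I'. c i * (D j s * D i t - D i s * D j t)) = 0"
      using insert.IH[of I' "\<lambda>i t. D j s * D i t - D i s * D j t"] I' by auto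
    \<comment> \<open>Back substitution without division: the smaller solution is multiplied by the
      pivot \<open>D j s\<close>, and the equation for \<open>s\<close> then determines the
      coefficient at \<open>j\<close>.\<close>
    define c' where "c' i = (if i = j then - (\<Sum>i\<in>I'. c i * D i s) else c i * D j s)" for i
    have eq: "(\<Sum>i\<in>I. c' i * D i t) = (\<Sum>i\<in>I'. c i * (D j s * D i t - D i s * D j t))" for t
    proof -
      have "(\<Sum>i\<in>I. c' i * D i t) = c' j * D j t + (\<Sum>i\<in>I'. c' i * D i t)" using I' by simp
      also have "(\<Sum>i\<in>I'. c' i * D i t) = (\<Sum>i\<in>I'. c i * D j s * D i t)"
        using I' by (intro sum.cong) (auto simp: c'_def)
      also have "c' j * D j t = - (\<Sum>i\<in>I'. c i * D i s * D j t)"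
        by (simp add: c'_def sum_distrib_right)
      finally show ?thesis by (simp add: sum_subtractf algebra_simps)
    qed
    have "(\<Sum>i\<in>I. c' i * D i t) = 0" if "t \<in> insert s S" for t
      using that c(2) unfolding eq by (auto simp: algebra_simps)
    moreover have "\<exists>i\<in>I. c' i \<noteq> 0" using c(1) j I' by (auto simp: c'_def)
    ultimately show ?thesis by blast
  qed
qed

section \<open>Smooth Fano fans as complexes of ray generators\<close>

text \<open>\<open>N\<close> is the lattice, \<open>Mx\<close> consists of the generator sets of the maximal cones, and \<open>d\<close> is the
  dimension. A set of ray generators is a face iff it spans a cone of the fan.\<close>

locale smooth_fano_fan =
  fixes N :: "'a::real_vector set" and Mx :: "'a set set" and d :: nat
  assumes N_0: "0 \<in> N"
    and N_diff: "x \<in> N \<Longrightarrow> y \<in> N \<Longrightarrow> x - y \<in> N"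
    and finite_Mx: "finite Mx"
    and finite_max: "B \<in> Mx \<Longrightarrow> finite B"
    and card_max: "B \<in> Mx \<Longrightarrow> card B = d"
    and max_subset_N: "B \<in> Mx \<Longrightarrow> B \<subseteq> N"
    and independent_max: "B \<in> Mx \<Longrightarrow> independent B"
    and span_max: "B \<in> Mx \<Longrightarrow> span B = UNIV"
    and coord_Ints: "B \<in> Mx \<Longrightarrow> x \<in> N \<Longrightarrow> representation B x b \<in> \<int>"
    and cover: "x \<in> N \<Longrightarrow> \<exists>B\<in>Mx. \<forall>b. representation B x b \<ge> 0"
    and fano: "B \<in> Mx \<Longrightarrow> v \<in> \<Union>Mx \<Longrightarrow> v \<notin> B \<Longrightarrow> (\<Sum>b\<in>B. representation B v b) \<le> 0"
begin

definition G :: "'a set" where "G = \<Union>Mx"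

definition face :: "'a set \<Rightarrow> bool" where "face C \<longleftrightarrow> (\<exists>B\<in>Mx. C \<subseteq> B)"

text \<open>For a Fano fan this is minus the linear piece of the anticanonical support function on
  the cone over \<open>B\<close>.\<close>

definition hgt :: "'a set \<Rightarrow> 'a \<Rightarrow> real" where "hgt B x = (\<Sum>b\<in>B. representation B x b)"

lemma N_minus: "x \<in> N \<Longrightarrow> - x \<in> N"
  using N_diff[OF N_0, of x] by simp

lemma N_add: "x \<in> N \<Longrightarrow> y \<in> N \<Longrightarrow> x + y \<in> N"
  using N_diff[of x "- y"] N_minus[of y] by simp

lemma N_sum: "(\<And>i. i \<in> I \<Longrightarrow> f i \<in> N) \<Longrightarrow> sum f I \<in> N"
  by (induction I rule: infinite_finite_induct) (auto simp: N_0 N_add)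

lemma N_sum_mset: "set_mset M \<subseteq> N \<Longrightarrow> sum_mset M \<in> N"
  by (induction M) (auto simp: N_0 N_add)

lemma N_nat: "x \<in> N \<Longrightarrow> real k *\<^sub>R x \<in> N"
  by (induction k) (auto simp: N_0 N_add scaleR_left_distrib)

lemma G_subset_N: "G \<subseteq> N"
  using max_subset_N by (auto simp: G_def)

lemma finite_G: "finite G"
  using finite_Mx finite_max by (auto simp: G_def)

lemma face_subset_G: "face C \<Longrightarrow> C \<subseteq> G"
  by (auto simp: face_def G_def)

lemma face_mono: "face C \<Longrightarrow> D \<subseteq> C \<Longrightarrow> face D"
  by (auto simp: face_def)

lemma finite_face: "face C \<Longrightarrow> finite C"
  using finite_G face_subset_G finite_subset by blast

context
  fixes B assumes B: "B \<in> Mx"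
begin

lemma linear_coord: "linear (\<lambda>x. representation B x b)"
  using independent_max[OF B] span_max[OF B]
  by (intro linearI) (simp_all add: representation_add representation_scale)

lemmas coord_simps =
  linear_add[OF linear_coord] linear_diff[OF linear_coord] linear_neg[OF linear_coord]
  linear_scale[OF linear_coord] linear_sum[OF linear_coord] linear_0[OF linear_coord]

lemma coord_basis: "b \<in> B \<Longrightarrow> representation B b c = (if c = b then 1 else 0)"
  using representation_basis[OF independent_max[OF B]] by simp

lemma sum_coord: "(\<Sum>b\<in>B. representation B x b *\<^sub>R b) = x"
  using sum_representation_eq[OF independent_max[OF B] _ finite_max[OF B]] span_max[OF B]
  by simp

lemma linear_hgt: "linear (hgt B)"
  unfolding hgt_def by (intro linear_compose_sum ballI linear_coord)

lemmas hgt_simps =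
  linear_add[OF linear_hgt] linear_diff[OF linear_hgt] linear_neg[OF linear_hgt]
  linear_scale[OF linear_hgt] linear_sum[OF linear_hgt] linear_0[OF linear_hgt]

lemma hgt_base: "b \<in> B \<Longrightarrow> hgt B b = 1"
  using finite_max[OF B] by (simp add: hgt_def coord_basis)

lemma hgt_nonpos: "v \<in> G \<Longrightarrow> v \<notin> B \<Longrightarrow> hgt B v \<le> 0"
  using fano[OF B] by (simp add: hgt_def G_def)

lemma hgt_le_1: "v \<in> G \<Longrightarrow> hgt B v \<le> 1"
  using hgt_base[of v] hgt_nonpos[of v] by (cases "v \<in> B") auto

lemma hgt_le_size: "set_mset M \<subseteq> G \<Longrightarrow> hgt B (sum_mset M) \<le> size M"
  by (induction M) (auto simp: hgt_simps intro: add_mono hgt_le_1)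

lemma hgt_eq_size: "set_mset M \<subseteq> B \<Longrightarrow> hgt B (sum_mset M) = size M"
  by (induction M) (auto simp: hgt_simps hgt_base)

lemma hgt_eq_sizeD: "set_mset M \<subseteq> G \<Longrightarrow> hgt B (sum_mset M) = size M \<Longrightarrow> set_mset M \<subseteq> B"
proof (induction M)
  case (add x M)
  have "hgt B x \<le> 1" "hgt B (sum_mset M) \<le> size M"
    using add.prems by (auto intro!: hgt_le_1 hgt_le_size)
  moreover have "hgt B x + hgt B (sum_mset M) = 1 + size M"
    using add.prems by (simp add: hgt_simps)
  ultimately have "hgt B x = 1" "hgt B (sum_mset M) = size M" by linarith+
  then show ?case using add hgt_nonpos[of x] by fastforce
qed simp

lemma coord_count: "set_mset M \<subseteq> B \<Longrightarrow> representation B (sum_mset M) b = count M b"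
  by (induction M) (auto simp: coord_simps coord_basis)

lemma mset_eq_of_sum: "set_mset M \<subseteq> B \<Longrightarrow> set_mset M' \<subseteq> B \<Longrightarrow> sum_mset M = sum_mset M' \<Longrightarrow> M = M'"
  by (metis coord_count multiset_eqI of_nat_eq_iff)

end

text \<open>Take the height of a maximal cone containing \<open>M\<close>: it equals the length on
  \<open>M\<close> and is at most the length on \<open>M'\<close>. Equality forces \<open>M'\<close>
  into the same basis, where expressions are unique.\<close>

lemma face_shortest:
  assumes "face (set_mset M)" "set_mset M' \<subseteq> G" "sum_mset M' = sum_mset M"
  shows "size M < size M' \<or> M' = M"
proof -
  obtain B where B: "B \<in> Mx" "set_mset M \<subseteq> B" using assms(1) by (auto simp: face_def)
  have "real (size M) \<le> size M'"
    using hgt_le_size[OF B(1) assms(2)] hgt_eq_size[OF B] assms(3) by simp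
  moreover have "M' = M" if "size M = size M'"
    using hgt_eq_sizeD[OF B(1) assms(2)] hgt_eq_size[OF B] assms(3) that mset_eq_of_sum[OF B(1)] B(2)
    by simp
  ultimately show ?thesis by linarith
qed

lemma face_unique:
  assumes "face (set_mset M)" "face (set_mset M')" "sum_mset M' = sum_mset M"
  shows "M' = M"
  using face_shortest[of M M'] face_shortest[of M' M] assms face_subset_G by fastforce

lemma nat_combination_mset:
  fixes c :: "'b::real_vector \<Rightarrow> real"
  assumes "finite B" "\<forall>b\<in>B. c b \<in> \<int> \<and> c b \<ge> 0"
  shows "\<exists>M. set_mset M \<subseteq> B \<and> sum_mset M = (\<Sum>b\<in>B. c b *\<^sub>R b) \<and> (\<forall>b\<in>B. real (count M b) = c b)"
  using assms
proof (induction B)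
  case (insert x F)
  then obtain M where M: "set_mset M \<subseteq> F" "sum_mset M = (\<Sum>b\<in>F. c b *\<^sub>R b)" "\<forall>b\<in>F. real (count M b) = c b"
    by auto
  obtain k where k: "c x = real k" using insert.prems by (metis Ints_cases insertI1 of_int_0_le_iff of_int_of_nat_eq zero_le_imp_eq_int)
  have "sum_mset (replicate_mset k x) = real k *\<^sub>R x" by (induction k) (simp_all add: scaleR_left_distrib)
  then have "sum_mset (M + replicate_mset k x) = (\<Sum>b\<in>insert x F. c b *\<^sub>R b)"
    using M insert.hyps k by (simp add: add.commute)
  moreover have "\<forall>b\<in>insert x F. real (count (M + replicate_mset k x) b) = c b"
    using M insert.hyps k by (auto simp: count_eq_zero_iff)
  ultimately show ?case using M by (intro exI[of _ "M + replicate_mset k x"]) auto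
qed simp

lemma lattice_point_mset:
  assumes "x \<in> N"
  obtains M where "face (set_mset M)" "sum_mset M = x"
proof -
  obtain B where B: "B \<in> Mx" "\<forall>b. representation B x b \<ge> 0" using cover[OF assms] by auto
  have "\<forall>b\<in>B. representation B x b \<in> \<int> \<and> representation B x b \<ge> 0" using B coord_Ints[OF B(1) assms] by auto
  from nat_combination_mset[OF finite_max[OF B(1)] this] obtain M where
    "set_mset M \<subseteq> B" "sum_mset M = x" using sum_coord[OF B(1)] by auto
  then show ?thesis using that B by (auto simp: face_def)
qed

lemma nonface_shorten:
  assumes "set_mset M \<subseteq> G" "\<not> face (set_mset M)"
  obtains M' where "face (set_mset M')" "sum_mset M' = sum_mset M" "size M' < size M"
proof -
  have "sum_mset M \<in> N" using assms G_subset_N N_sum_mset by blast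
  then obtain M' where M': "face (set_mset M')" "sum_mset M' = sum_mset M" by (rule lattice_point_mset)
  then have "size M' < size M" using face_shortest[of M' M] assms by auto
  then show ?thesis using that M' by blast
qed

text \<open>For large \<open>k\<close> the point \<open>x + k \<Sum>F\<close> lies in the open star of the cone over \<open>F\<close>.\<close>

lemma star_cover:
  assumes "face F" "x \<in> N"
  obtains B where "B \<in> Mx" "F \<subseteq> B" "\<And>b. b \<notin> F \<Longrightarrow> representation B x b \<ge> 0"
proof -
  define y where "y k = x + real k *\<^sub>R \<Sum>F" for k :: nat
  have SF: "\<Sum>F \<in> N" using assms(1) face_subset_G G_subset_N by (intro N_sum) auto
  have "\<forall>k. \<exists>B\<in>Mx. \<forall>b. representation B (y k) b \<ge> 0"
    using assms(2) SF by (auto simp: y_def intro!: cover N_add N_nat)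
  then obtain f where f: "\<And>k. f k \<in> Mx" "\<And>k b. representation (f k) (y k) b \<ge> 0" by metis
  have "finite (range f)" using f(1) finite_Mx finite_subset by (metis image_subsetI)
  \<comment> \<open>There are finitely many maximal cones, so one of them contains
    \<open>y k\<close> for arbitrarily large \<open>k\<close>. A negative coordinate of
    \<open>\<Sum>F\<close> would eventually outweigh that of \<open>x\<close>.\<close>
  then obtain k0 where inf: "infinite {k. f k = f k0}"
    using pigeonhole_infinite[of UNIV f] by (auto simp: infinite_UNIV_nat)
  define B where "B = f k0"
  have B: "B \<in> Mx" using f(1) by (simp add: B_def)
  have nn: "representation B (\<Sum>F) b \<ge> 0" for b
  proof (rule ccontr)
    assume neg: "\<not> ?thesis"
    obtain n :: nat where n: "representation B x b < real n * - representation B (\<Sum>F) b"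
      using neg ex_less_of_nat_mult[of "- representation B (\<Sum>F) b"] by fastforce
    obtain k where k: "k > n" "f k = f k0" using inf by (metis (mono_tags, lifting) infinite_nat_iff_unbounded mem_Collect_eq)
    have "0 \<le> representation B x b + real k * representation B (\<Sum>F) b"
      using f(2)[of k b] B k(2) by (simp add: y_def B_def coord_simps)
    moreover have "real k * representation B (\<Sum>F) b \<le> real n * representation B (\<Sum>F) b"
      using k(1) neg by (intro mult_right_mono_neg) auto
    ultimately show False using n by linarith
  qed
  have "\<forall>b\<in>B. representation B (\<Sum>F) b \<in> \<int> \<and> representation B (\<Sum>F) b \<ge> 0"
    using nn coord_Ints[OF B SF] by auto
  from nat_combination_mset[OF finite_max[OF B] this] obtain M where
    M: "set_mset M \<subseteq> B" "sum_mset M = \<Sum>F" using sum_coord[OF B] by auto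
  \<comment> \<open>Both \<open>M\<close> and \<open>F\<close> express \<open>\<Sum>F\<close> on a
    face; uniqueness puts \<open>F\<close> into \<open>B\<close>.\<close>
  have "sum_mset (mset_set F) = \<Sum>F" by (simp add: sum_unfold_sum_mset)
  then have "M = mset_set F"
    using face_unique[of "mset_set F" M] M B assms(1) finite_face by (auto simp: face_def)
  then have FB: "F \<subseteq> B" using M finite_face[OF assms(1)] by simp
  have "representation B x b \<ge> 0" if "b \<notin> F" for b
  proof -
    have "representation B (\<Sum>F) b = (\<Sum>a\<in>F. representation B a b)"
      using B by (simp add: coord_simps)
    also have "\<dots> = 0" using FB that B by (intro sum.neutral) (auto simp: coord_basis)
    finally have "representation B (\<Sum>F) b = 0" .
    then show ?thesis using f(2)[of k0 b] B by (simp add: y_def B_def coord_simps)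
  qed
  then show ?thesis using that B FB by blast
qed

definition prim :: "'a set \<Rightarrow> bool" where
  "prim Q \<longleftrightarrow> Q \<subseteq> G \<and> \<not> face Q \<and> (\<forall>R. R \<subset> Q \<longrightarrow> face R)"

lemma nonface_prim:
  assumes "C \<subseteq> G" "\<not> face C"
  obtains Q where "Q \<subseteq> C" "prim Q"
proof -
  have "finite C" using assms finite_G finite_subset by blast
  then have "\<exists>Q\<subseteq>C. prim Q" using assms
  proof (induction C rule: finite_psubset_induct)
    case (psubset A)
    show ?case
    proof (cases "prim A")
      case False
      then obtain R where "R \<subset> A" "\<not> face R" using psubset.prems by (auto simp: prim_def)
      moreover have "R \<subseteq> G" using \<open>R \<subset> A\<close> psubset.prems by auto
      ultimately obtain Q where "Q \<subseteq> R" "prim Q" using psubset.IH[of R] by auto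
      then show ?thesis using \<open>R \<subset> A\<close> by blast
    qed auto
  qed
  then show ?thesis using that by blast
qed

lemma sum_mset_set: "sum_mset (mset_set Q) = \<Sum>Q" for Q :: "'a set"
  by (simp add: sum_unfold_sum_mset)

section \<open>Vanishing sums of ray generators\<close>

definition zero_sum :: "'a multiset \<Rightarrow> bool" where
  "zero_sum M \<longleftrightarrow> M \<noteq> {#} \<and> set_mset M \<subseteq> G \<and> sum_mset M = 0"

lemma zero_sum_nonface: "zero_sum M \<Longrightarrow> \<not> face (set_mset M)"
  using face_shortest[of M "{#}"] by (auto simp: zero_sum_def)

text \<open>The support of \<open>M\<close> contains a primitive \<open>Q\<close>. Replacing
  \<open>Q\<close> by a shorter expression of its sum would give a shorter vanishing sum, unless
  nothing at all remains; then \<open>M\<close> was \<open>Q\<close>.\<close>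

lemma minimal_zero_sum:
  assumes M: "zero_sum M" and min: "\<And>M'. zero_sum M' \<Longrightarrow> size M \<le> size M'"
  obtains Q where "prim Q" "\<Sum>Q = 0" "M = mset_set Q"
proof -
  obtain Q where Q: "Q \<subseteq> set_mset M" "prim Q"
    using nonface_prim zero_sum_nonface[OF M] M by (metis zero_sum_def)
  have fin: "finite Q" using Q finite_subset by auto
  have "mset_set Q \<subseteq># M"
    using Q fin by (auto simp: subseteq_mset_def count_mset_set')
  then obtain R where R: "M = mset_set Q + R" by (auto simp: mset_subset_eq_exists_conv)
  have "set_mset (mset_set Q) \<subseteq> G" "\<not> face (set_mset (mset_set Q))" using Q fin by (auto simp: prim_def)
  then obtain M' where M': "face (set_mset M')" "sum_mset M' = \<Sum>Q" "size M' < size (mset_set Q)"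
    using nonface_shorten[of "mset_set Q"] by (metis sum_mset_set)
  have "M' + R = {#}"
  proof (rule ccontr)
    assume "M' + R \<noteq> {#}"
    then have "zero_sum (M' + R)" using M M' R face_subset_G by (auto simp: zero_sum_def sum_mset_set)
    then show False using min[of "M' + R"] M' R by auto
  qed
  then show ?thesis using that Q M' R by auto
qed

text \<open>The clause on equality is what later identifies every vanishing sum of length d - 1 with
  \<open>P\<close>, multiplicities included.\<close>

lemma zero_sum_cases:
  assumes "zero_sum M"
  obtains Q where "prim Q" "\<Sum>Q = 0" "finite Q" "card Q \<le> size M" "card Q = size M \<longrightarrow> M = mset_set Q"
proof -
  define M0 where "M0 = arg_min size zero_sum"
  have M0: "zero_sum M0" "\<And>M'. zero_sum M' \<Longrightarrow> size M0 \<le> size M'"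
    using arg_min_nat_lemma[of zero_sum M size] assms by (auto simp: M0_def)
  obtain Q where Q: "prim Q" "\<Sum>Q = 0" "M0 = mset_set Q" using minimal_zero_sum[OF M0] by blast
  have fin: "finite Q" using Q finite_G finite_subset by (auto simp: prim_def)
  show ?thesis
  proof (cases "card Q = size M")
    case True
    then have "\<And>M'. zero_sum M' \<Longrightarrow> size M \<le> size M'" using M0(2) Q by auto
    then obtain Q' where "prim Q'" "\<Sum>Q' = 0" "M = mset_set Q'" using minimal_zero_sum[OF assms] by blast
    then show ?thesis using that[of Q'] True by (metis finite_G finite_subset order_refl prim_def size_mset_set)
  next
    case False
    then show ?thesis using that[of Q] Q fin M0(2)[OF assms] by auto
  qed
qed

end

section \<open>The star of a centrally symmetric primitive collection\<close>

text \<open>\<open>card_central\<close> is the form in which m(X) \<ge> 3 enters. It is only a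
  starting point: uniqueness of \<open>P\<close> will improve the bound 4 to d - 1.\<close>

locale fano_central = smooth_fano_fan +
  fixes P
  assumes prim_P: "prim P" and sum_P: "\<Sum>P = 0" and card_P: "card P = d - 1" and d_ge: "d \<ge> 6"
    and card_central: "\<And>Q. prim Q \<Longrightarrow> \<Sum>Q = 0 \<Longrightarrow> card Q \<ge> 4"
begin

definition Y where "Y = G - P"

definition V where "V = {\<Sum>p\<in>P. real_of_int (c p) *\<^sub>R p | c. True}"

lemma P_G: "P \<subseteq> G" and nonface_P: "\<not> face P" and face_P: "R \<subset> P \<Longrightarrow> face R"
  using prim_P by (auto simp: prim_def)

lemma finite_P: "finite P"
  using P_G finite_G finite_subset by blast

lemma Y_G: "Y \<subseteq> G" and Y_P: "y \<in> Y \<Longrightarrow> y \<notin> P" and P_N: "P \<subseteq> N" and Y_N: "Y \<subseteq> N"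
  using P_G G_subset_N by (auto simp: Y_def)

lemma face_P_diff: "m \<in> P \<Longrightarrow> face (P - {m})"
  by (intro face_P) auto

lemma zero_sum_size_ge_4: "zero_sum M \<Longrightarrow> size M \<ge> 4"
  by (metis card_central zero_sum_cases le_trans)

lemma V_I: "x = (\<Sum>p\<in>P. real_of_int (c p) *\<^sub>R p) \<Longrightarrow> x \<in> V"
  by (auto simp: V_def)

lemma V_0: "0 \<in> V" by (rule V_I[of _ "\<lambda>_. 0"]) simp

lemma V_diff: assumes "x \<in> V" "y \<in> V" shows "x - y \<in> V"
proof -
  obtain c d where "x = (\<Sum>p\<in>P. real_of_int (c p) *\<^sub>R p)" "y = (\<Sum>p\<in>P. real_of_int (d p) *\<^sub>R p)"
    using assms by (auto simp: V_def)
  then show ?thesis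
    by (intro V_I[of _ "\<lambda>p. c p - d p"]) (simp add: scaleR_left_diff_distrib sum_subtractf)
qed

lemma V_minus: "x \<in> V \<Longrightarrow> - x \<in> V" using V_diff[OF V_0] by simp

lemma V_add: "x \<in> V \<Longrightarrow> y \<in> V \<Longrightarrow> x + y \<in> V" using V_diff[of x "- y"] V_minus by simp

lemma V_nat: "x \<in> V \<Longrightarrow> real k *\<^sub>R x \<in> V"
  by (induction k) (auto simp: V_0 V_add scaleR_left_distrib)

lemma V_int: "x \<in> V \<Longrightarrow> real_of_int k *\<^sub>R x \<in> V"
  by (cases k rule: int_cases2) (auto simp: V_nat V_minus)

lemma P_V: assumes "p \<in> P" shows "p \<in> V"
proof (rule V_I[of _ "\<lambda>q. if q = p then 1 else 0"])
  have "(\<Sum>q\<in>P. real_of_int (if q = p then 1 else 0) *\<^sub>R q) = (\<Sum>q\<in>P. if q = p then q else 0)"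
    by (intro sum.cong) auto
  then show "p = (\<Sum>q\<in>P. real_of_int (if q = p then 1 else 0) *\<^sub>R q)"
    using finite_P assms by simp
qed

lemma V_sum_mset: "set_mset M \<subseteq> P \<Longrightarrow> sum_mset M \<in> V"
  by (induction M) (auto simp: V_0 V_add P_V)

text \<open>As \<open>\<Sum>P = 0\<close>, the smallest coefficient can be subtracted from all. The
  result is nonnegative and omits an element of \<open>P\<close>, so it is supported on a
  face.\<close>

lemma V_normal:
  assumes "x \<in> V"
  obtains K where "set_mset K \<subset> P" "face (set_mset K)" "sum_mset K = x"
proof -
  obtain c where c: "x = (\<Sum>p\<in>P. real_of_int (c p) *\<^sub>R p)" using assms by (auto simp: V_def)
  have "P \<noteq> {}" using card_P d_ge by auto
  then obtain m where m: "m \<in> P" "\<And>p. p \<in> P \<Longrightarrow> c m \<le> c p"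
    using finite_P by (metis arg_min_if_finite(1) arg_min_if_finite(2) not_le)
  have "(\<Sum>p\<in>P. real_of_int (c p - c m) *\<^sub>R p) = x - real_of_int (c m) *\<^sub>R \<Sum>P"
    by (simp add: c scaleR_left_diff_distrib sum_subtractf scaleR_sum_right)
  then have eq: "(\<Sum>p\<in>P. real_of_int (c p - c m) *\<^sub>R p) = x" by (simp add: sum_P)
  have "\<forall>p\<in>P. real_of_int (c p - c m) \<in> \<int> \<and> real_of_int (c p - c m) \<ge> 0"
    using m by auto
  then obtain K where K: "set_mset K \<subseteq> P" "sum_mset K = x" "\<forall>b\<in>P. real (count K b) = real_of_int (c b - c m)"
    using nat_combination_mset[of P "\<lambda>p. real_of_int (c p - c m)"] finite_P eq by auto
  then have "count K m = 0" using m by auto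
  then have "set_mset K \<subset> P" using m K by (auto simp: count_eq_zero_iff)
  then show ?thesis using that K face_P by blast
qed

text \<open>The normal form inside \<open>P\<close> is a face expression too, and these are unique.
  This is the standard way to show that a set involving \<open>Y\<close> is not a face.\<close>

lemma face_in_V:
  assumes "face (set_mset M)" "sum_mset M \<in> V"
  shows "set_mset M \<subset> P"
proof -
  obtain K where "set_mset K \<subset> P" "face (set_mset K)" "sum_mset K = sum_mset M"
    using V_normal[OF assms(2)] by blast
  then show ?thesis using face_unique[of M K] assms by auto
qed

lemma face_Y: "y \<in> Y \<Longrightarrow> face {y}"
  by (auto simp: Y_def G_def face_def)

lemma Y_not_V:
  assumes "y \<in> Y" "k \<noteq> 0" shows "real_of_int k *\<^sub>R y \<notin> V"
proof
  assume *: "real_of_int k *\<^sub>R y \<in> V"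
  have "sum_mset (replicate_mset (nat \<bar>k\<bar>) y) = real_of_int \<bar>k\<bar> *\<^sub>R y"
  proof -
    have "sum_mset (replicate_mset n y) = real n *\<^sub>R y" for n
      by (induction n) (simp_all add: scaleR_left_distrib)
    then show ?thesis by simp
  qed
  also have "\<dots> \<in> V" using * V_minus[OF *] by (auto simp: abs_if)
  finally have "set_mset (replicate_mset (nat \<bar>k\<bar>) y) \<subset> P"
    using face_Y[OF assms(1)] assms(2) by (intro face_in_V) auto
  then show False using assms Y_P by auto
qed

lemma Y_not_V1: "y \<in> Y \<Longrightarrow> y \<notin> V"
  using Y_not_V[of y 1] by simp

context
  fixes m B assumes m: "m \<in> P" and B: "B \<in> Mx" "P - {m} \<subseteq> B"
begin

lemma omitted_eq: "m = - \<Sum>(P - {m})"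
  using sum_P m finite_P by (metis add_eq_0_iff2 sum.remove)

lemma omitted_notin: "m \<notin> B"
  using nonface_P B m by (auto simp: face_def)

lemma hgt_omitted: "hgt B m = 2 - real d"
proof -
  have "hgt B m = - (\<Sum>p\<in>P - {m}. hgt B p)"
    by (subst omitted_eq) (simp add: hgt_simps[OF B(1)])
  also have "(\<Sum>p\<in>P - {m}. hgt B p) = (\<Sum>p\<in>P - {m}. 1)"
    using B by (intro sum.cong) (auto intro: hgt_base)
  finally show ?thesis using m finite_P card_P d_ge by simp
qed

lemma hgt_P: "p \<in> P \<Longrightarrow> hgt B p = (if p = m then 2 - real d else 1)"
  using hgt_omitted hgt_base[OF B(1)] B(2) by auto

text \<open>The value depends on \<open>m\<close> but not on \<open>B\<close>: all maximal cones of
  one star have the same heights on \<open>V\<close>. The coefficient d - 1 is 1 minus the height 2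
  - d of the omitted element, which is minus a sum of d - 2 elements of height 1.\<close>

lemma hgt_combination: "hgt B (\<Sum>p\<in>P. c p *\<^sub>R p) = (\<Sum>p\<in>P. c p) - (real d - 1) * c m"
proof -
  have "hgt B (\<Sum>p\<in>P. c p *\<^sub>R p) = (\<Sum>p\<in>P. c p - (if p = m then (real d - 1) * c p else 0))"
    unfolding hgt_simps[OF B(1)] by (intro sum.cong) (auto simp: hgt_P algebra_simps)
  then show ?thesis using m finite_P by (simp add: sum_subtractf)
qed

lemma hgt_mset_P: "set_mset K \<subseteq> P \<Longrightarrow> hgt B (sum_mset K) = real (size K) - (real d - 1) * count K m"
  by (induction K) (auto simp: hgt_simps[OF B(1)] hgt_P algebra_simps)

lemma coord_V:
  assumes "x \<in> V" "b \<notin> P" shows "representation B x b = 0"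
proof -
  have 1: "representation B p b = 0" if "p \<in> P" "p \<noteq> m" for p
    using that B assms by (auto simp: coord_basis[OF B(1)])
  have "representation B m b = - (\<Sum>p\<in>P - {m}. representation B p b)"
    by (subst omitted_eq) (simp add: coord_simps[OF B(1)])
  then have 2: "representation B m b = 0" using 1 by simp
  obtain c where "x = (\<Sum>p\<in>P. real_of_int (c p) *\<^sub>R p)" using assms by (auto simp: V_def)
  moreover have "representation B p b = 0" if "p \<in> P" for p using 1[of p] 2 that by auto
  ultimately show ?thesis by (simp add: coord_simps[OF B(1)])
qed

end

text \<open>In the sum over \<open>m\<close> the total of the coefficients occurs d - 1 times, and
  each coefficient is subtracted with factor d - 1. This eliminates unknown elements of
  \<open>V\<close> from inequalities that hold in all stars.\<close>

lemma sum_hgt_V: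
  assumes "x \<in> V" "\<And>m. m \<in> P \<Longrightarrow> B m \<in> Mx \<and> P - {m} \<subseteq> B m"
  shows "(\<Sum>m\<in>P. hgt (B m) x) = 0"
proof -
  obtain c where c: "x = (\<Sum>p\<in>P. real_of_int (c p) *\<^sub>R p)" using assms by (auto simp: V_def)
  have "(\<Sum>m\<in>P. hgt (B m) x) = (\<Sum>m\<in>P. (\<Sum>p\<in>P. real_of_int (c p)) - (real d - 1) * c m)"
    using assms(2) unfolding c by (intro sum.cong refl hgt_combination) auto
  also have "\<dots> = 0" using card_P d_ge by (simp add: sum_subtractf sum_distrib_left[symmetric])
  finally show ?thesis .
qed

abbreviation st where "st m a b \<equiv> insert a (insert b (P - {m}))"

text \<open>The edges of the link of \<open>P - {m}\<close>, a plane fan modulo \<open>V\<close>.\<close>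

definition E where "E m a b \<longleftrightarrow> a \<in> Y \<and> b \<in> Y \<and> a \<noteq> b \<and> st m a b \<in> Mx"

lemma E_sym: "E m a b \<Longrightarrow> E m b a"
  by (auto simp: E_def insert_commute)

lemma E_D: "E m a b \<Longrightarrow> a \<in> Y" "E m a b \<Longrightarrow> b \<in> Y" "E m a b \<Longrightarrow> a \<noteq> b" "E m a b \<Longrightarrow> st m a b \<in> Mx"
  by (auto simp: E_def)

lemma E_face: "E m a b \<Longrightarrow> C \<subseteq> st m a b \<Longrightarrow> face C"
  by (auto simp: E_def face_def)

lemma Mx_E:
  assumes "m \<in> P" "B \<in> Mx" "P - {m} \<subseteq> B"
  obtains a b where "E m a b" "B = st m a b"
proof -
  have "card (B - (P - {m})) = 2"
    using assms card_max[OF assms(2)] finite_P card_P d_ge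
    by (subst card_Diff_subset) auto
  then obtain a b where ab: "B - (P - {m}) = {a, b}" "a \<noteq> b" by (auto simp: card_2_iff)
  have "m \<notin> B" using omitted_notin assms by auto
  then have "a \<notin> P" "b \<notin> P" using ab by blast+
  moreover have "a \<in> G" "b \<in> G" using ab assms by (auto simp: G_def)
  moreover have "B = st m a b" using ab assms by auto
  ultimately show ?thesis using that[of a b] ab assms by (auto simp: E_def Y_def)
qed

text \<open>Integrality of the coordinates makes every edge a basis of N / V.\<close>

lemma E_decompose:
  assumes "m \<in> P" "E m a b" "x \<in> N"
  obtains p q \<xi> where "x = real_of_int p *\<^sub>R a + real_of_int q *\<^sub>R b + \<xi>" "\<xi> \<in> V"
    "representation (st m a b) x a = p" "representation (st m a b) x b = q"
proof -
  let ?B = "st m a b"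
  note B = E_D(4)[OF assms(2)]
  have "\<forall>c. \<exists>k. representation ?B x c = real_of_int k"
    using coord_Ints[OF B assms(3)] by (metis Ints_cases)
  then obtain k where k: "\<And>c. representation ?B x c = real_of_int (k c)" by metis
  have ab: "a \<notin> insert b (P - {m})" "b \<notin> P - {m}" using E_D[OF assms(2)] Y_P by auto
  have "x = (\<Sum>c\<in>?B. real_of_int (k c) *\<^sub>R c)" using sum_coord[OF B, of x] by (simp add: k)
  also have "\<dots> = real_of_int (k a) *\<^sub>R a + (real_of_int (k b) *\<^sub>R b + (\<Sum>c\<in>P - {m}. real_of_int (k c) *\<^sub>R c))"
    using ab finite_P by simp
  also have "(\<Sum>c\<in>P - {m}. real_of_int (k c) *\<^sub>R c) = (\<Sum>c\<in>P. real_of_int (if c = m then 0 else k c) *\<^sub>R c)"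
    using finite_P by (intro sum.mono_neutral_cong_left) auto
  finally have "x = real_of_int (k a) *\<^sub>R a + real_of_int (k b) *\<^sub>R b +
      (\<Sum>c\<in>P. real_of_int (if c = m then 0 else k c) *\<^sub>R c)" by (simp only: add.assoc)
  from that[OF this V_I[OF refl] k k] show ?thesis .
qed

lemma coord_E:
  assumes "m \<in> P" "E m a b" "\<xi> \<in> V"
  shows "representation (st m a b) (s *\<^sub>R a + t *\<^sub>R b + \<xi>) a = s"
    "representation (st m a b) (s *\<^sub>R a + t *\<^sub>R b + \<xi>) b = t"
proof -
  note B = E_D(4)[OF assms(2)]
  have "representation (st m a b) \<xi> a = 0" "representation (st m a b) \<xi> b = 0"
    using coord_V[OF assms(1) B _ assms(3)] E_D[OF assms(2)] Y_P by auto
  then show "representation (st m a b) (s *\<^sub>R a + t *\<^sub>R b + \<xi>) a = s"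
    "representation (st m a b) (s *\<^sub>R a + t *\<^sub>R b + \<xi>) b = t"
    using E_D(3)[OF assms(2)] by (auto simp: coord_simps[OF B] coord_basis[OF B])
qed

lemma E_cover:
  assumes "m \<in> P" "x \<in> N"
  obtains a b p q \<xi> where "E m a b" "x = real_of_int p *\<^sub>R a + real_of_int q *\<^sub>R b + \<xi>" "\<xi> \<in> V" "p \<ge> 0" "q \<ge> 0"
proof -
  obtain B where B: "B \<in> Mx" "P - {m} \<subseteq> B" "\<And>b. b \<notin> P - {m} \<Longrightarrow> representation B x b \<ge> 0"
    using star_cover[OF face_P_diff[OF assms(1)] assms(2)] by blast
  obtain a b where ab: "E m a b" "B = st m a b" using Mx_E[OF assms(1) B(1,2)] by blast
  obtain p q \<xi> where pq: "x = real_of_int p *\<^sub>R a + real_of_int q *\<^sub>R b + \<xi>" "\<xi> \<in> V"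
    "representation B x a = p" "representation B x b = q"
    using E_decompose[OF assms(1) ab(1) assms(2)] unfolding ab(2) by blast
  have "representation B x a \<ge> 0" "representation B x b \<ge> 0" using E_D[OF ab(1)] Y_P by (auto intro!: B(3))
  then show ?thesis using that ab pq by auto
qed

lemma face_E:
  assumes "m \<in> P" "face (insert y (P - {m}))" "y \<in> Y"
  obtains z where "E m y z"
proof -
  obtain B where B: "B \<in> Mx" "insert y (P - {m}) \<subseteq> B" using assms by (auto simp: face_def)
  obtain a b where ab: "E m a b" "B = st m a b" using Mx_E[OF assms(1) B(1)] B by auto
  then have "y \<in> {a, b}" using B assms Y_P by auto
  then show ?thesis using that ab E_sym by auto
qed

text \<open>The two maximal cones belong to the same star and agree on \<open>\<xi>\<close>. In the
  one containing \<open>y\<close> its height is 1 and at most \<open>s + t\<close> plus the height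
  of \<open>\<xi>\<close>, which is its height in the other cone. That is nonpositive unless
  \<open>y\<close> is one of \<open>a\<close>, \<open>b\<close>.\<close>

lemma E_ray:
  assumes "m \<in> P" "E m a b" "E m y z" "y = real_of_int s *\<^sub>R a + real_of_int t *\<^sub>R b + \<xi>" "\<xi> \<in> V" "s \<ge> 0" "t \<ge> 0"
  shows "y \<in> {a, b}"
proof (rule ccontr)
  assume *: "y \<notin> {a, b}"
  note B = E_D(4)[OF assms(2)] and B' = E_D(4)[OF assms(3)]
  note Y = E_D(1,2)[OF assms(2)] E_D(1,2)[OF assms(3)]
  obtain c where c: "\<xi> = (\<Sum>p\<in>P. real_of_int (c p) *\<^sub>R p)" using assms by (auto simp: V_def)
  have eq: "hgt (st m a b) \<xi> = hgt (st m y z) \<xi>"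
    unfolding c by (subst (1 2) hgt_combination[OF assms(1)]) (use B B' in auto)
  have "1 = s * hgt (st m y z) a + t * hgt (st m y z) b + hgt (st m y z) \<xi>"
  proof -
    have "hgt (st m y z) y = s * hgt (st m y z) a + t * hgt (st m y z) b + hgt (st m y z) \<xi>"
      by (subst assms(4)) (simp add: hgt_simps[OF B'])
    then show ?thesis using hgt_base[OF B', of y] by simp
  qed
  also have "\<dots> \<le> s * 1 + t * 1 + hgt (st m y z) \<xi>"
    using mult_left_mono[of "hgt (st m y z) a" 1 "real_of_int s"]
      mult_left_mono[of "hgt (st m y z) b" 1 "real_of_int t"] hgt_le_1[OF B'] Y Y_G assms(6,7)
    by (auto simp: subset_iff)
  also have "\<dots> = hgt (st m a b) y"
    by (subst assms(4)) (simp add: hgt_simps[OF B] hgt_base[OF B] eq)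
  also have "\<dots> \<le> 0" using * Y Y_G Y_P by (intro hgt_nonpos[OF B]) auto
  finally show False by simp
qed

lemma E_exists: "m \<in> P \<Longrightarrow> \<exists>a b. E m a b"
  using E_cover[OF _ N_0] by metis

text \<open>The neighbouring cone across the wall of \<open>b\<close> is found by covering
  \<open>- a\<close> near the face over \<open>b\<close> and \<open>P - {m}\<close>. Since both
  edges are bases of N / V, the coefficient of \<open>c\<close> is a unit.\<close>

lemma E_wall:
  assumes "m \<in> P" "E m a b"
  obtains c k where "E m b c" "c \<noteq> a" "a + c + real_of_int k *\<^sub>R b \<in> V"
proof -
  note B = E_D(4)[OF assms(2)]
  have ab: "a \<in> Y" "b \<in> Y" "a \<in> N" "b \<in> N" using E_D[OF assms(2)] Y_N by auto
  have f: "face (insert b (P - {m}))" using E_face[OF assms(2)] by auto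
  obtain B' where B': "B' \<in> Mx" "insert b (P - {m}) \<subseteq> B'"
    and nn: "\<And>c. c \<notin> insert b (P - {m}) \<Longrightarrow> representation B' (- a) c \<ge> 0"
    using star_cover[OF f N_minus[OF ab(3)]] by blast
  obtain c where c: "E m b c" "B' = st m b c"
  proof -
    obtain a' b' where *: "E m a' b'" "B' = st m a' b'" using Mx_E[OF assms(1) B'(1)] B'(2) by auto
    then have "b \<in> {a', b'}" using B' ab Y_P by auto
    then show ?thesis using that * E_sym by (auto simp: insert_commute)
  qed
  note cY = E_D[OF c(1)]
  obtain p q \<xi> where pq: "- a = real_of_int p *\<^sub>R b + real_of_int q *\<^sub>R c + \<xi>" "\<xi> \<in> V"
     "representation B' (- a) c = q"
    using E_decompose[OF assms(1) c(1) N_minus[OF ab(3)]] c(2) by metis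
  have "q \<ge> 0" using nn[of c] pq(3) cY Y_P by auto
  obtain p' q' \<xi>' where pq': "c = real_of_int p' *\<^sub>R a + real_of_int q' *\<^sub>R b + \<xi>'" "\<xi>' \<in> V"
    using E_decompose[OF assms] cY Y_N by (metis subsetD)
  have "- 1 = representation (st m a b) (- a) a"
    using B by (simp add: coord_simps[OF B] coord_basis[OF B])
  also have "\<dots> = representation (st m a b) (real_of_int (q * p') *\<^sub>R a + real_of_int (p + q * q') *\<^sub>R b + (\<xi> + real_of_int q *\<^sub>R \<xi>')) a"
    unfolding pq(1) by (subst pq'(1)) (simp add: algebra_simps)
  also have "\<dots> = q * p'" using pq pq' by (subst coord_E[OF assms]) (auto intro: V_add V_int)
  \<comment> \<open>Only the coefficient of \<open>a\<close> has been compared; with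
    \<open>q\<close> nonnegative it leaves \<open>q = 1\<close>.\<close>
  finally have "q * p' = - 1" by (metis of_int_1 of_int_eq_iff of_int_minus)
  then have "q dvd 1" by (metis dvd_minus_iff dvd_triv_left)
  then have "q = 1" using \<open>q \<ge> 0\<close> by simp
  then have "a = - (real_of_int p *\<^sub>R b + c + \<xi>)" using pq(1) by (metis minus_minus scaleR_one of_int_1)
  then have "a + c + real_of_int p *\<^sub>R b = - \<xi>" by simp
  then have V: "a + c + real_of_int p *\<^sub>R b \<in> V" using pq V_minus by auto
  have "c \<noteq> a"
  proof
    assume "c = a"
    then have "real_of_int 2 *\<^sub>R a + real_of_int p *\<^sub>R b + 0 \<in> V" using V by (simp add: scaleR_2)
    then have "representation (st m a b) (real_of_int 2 *\<^sub>R a + real_of_int p *\<^sub>R b + 0) a = 0"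
      using ab Y_P B by (intro coord_V[OF assms(1)]) auto
    then show False using coord_E(1)[OF assms V_0] by simp
  qed
  then show ?thesis using that c V by blast
qed

section \<open>Uniqueness of the central collection and short relations modulo
  \<open>V\<close>\<close>

text \<open>If \<open>Q\<close> meets \<open>P\<close>, cancelling the common part gives two
  distinct faces with equal sum. If not, \<open>Q\<close> satisfies a linear relation modulo
  \<open>V\<close> with nonconstant coefficients; made nonnegative, it becomes a nonempty face sum
  in \<open>V\<close>, which would have to lie in \<open>P\<close>.\<close>

lemma central_unique:
  assumes Q: "prim Q" "\<Sum>Q = 0"
  shows "Q = P"
proof (rule ccontr)
  assume ne: "Q \<noteq> P"
  have QP: "\<not> Q \<subseteq> P" "\<not> P \<subseteq> Q" using Q(1) prim_P ne unfolding prim_def by blast+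
  have QG: "Q \<subseteq> G" and fQ: "\<And>R. R \<subset> Q \<Longrightarrow> face R" and finQ: "finite Q"
    using Q(1) finite_G finite_subset by (auto simp: prim_def)
  show False
  proof (cases "Q \<inter> P = {}")
    case False
    have "\<Sum>(Q - P) + \<Sum>(Q \<inter> P) = 0" "\<Sum>(P - Q) + \<Sum>(Q \<inter> P) = 0"
      using Q(2) sum_P finQ finite_P
      by (metis Int_commute add.commute sum.Int_Diff)+
    then have "\<Sum>(Q - P) = \<Sum>(P - Q)" by (metis add_right_cancel)
    moreover have "Q - P \<subset> Q" "P - Q \<subset> P" using False by auto
    then have "face (Q - P)" "face (P - Q)" using fQ face_P by blast+
    ultimately have "mset_set (Q - P) = mset_set (P - Q)"
      using finQ finite_P by (intro face_unique) (auto simp: sum_mset_set)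
    then have "Q - P = P - Q" using finQ finite_P by (metis finite_Diff finite_set_mset_mset_set)
    then show False using QP by auto
  next
    case True
    have "card P > 0" using card_P d_ge by simp
    then obtain m where m: "m \<in> P" by fastforce
    obtain a b where ab: "E m a b" using E_exists[OF m] by auto
    have "\<forall>y\<in>Q. \<exists>p q \<xi>. y = real_of_int p *\<^sub>R a + real_of_int q *\<^sub>R b + \<xi> \<and> \<xi> \<in> V"
      using E_decompose[OF m ab] QG G_subset_N by (metis subsetD)
    then obtain p q \<xi> where pq: "\<And>y. y \<in> Q \<Longrightarrow> y = real_of_int (p y) *\<^sub>R a + real_of_int (q y) *\<^sub>R b + \<xi> y \<and> \<xi> y \<in> V"
      by metis
    have "Q \<noteq> {}" using QP by auto
    then obtain y0 where y0: "y0 \<in> Q" by auto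
    \<comment> \<open>Three elements are dependent in the rank two lattice N / V. Giving
      \<open>y0\<close> the coefficient 0 keeps the relation from being a multiple of
      \<open>\<Sum>Q = 0\<close>.\<close>
    have "card (Q - {y0}) > 2" using card_central[OF Q] y0 finQ by simp
    then obtain c where c: "\<exists>i\<in>Q - {y0}. c i \<noteq> 0"
      "\<And>s. (\<Sum>i\<in>Q - {y0}. c i * (if s then p i else q i)) = 0"
      using int_dependent[of "UNIV :: bool set" "Q - {y0}" "\<lambda>i s. if s then p i else q i"] finQ by auto
    define c' where "c' i = (if i = y0 then 0 else c i)" for i
    have c': "(\<Sum>i\<in>Q. c' i * (if s then p i else q i)) = 0" for s
    proof -
      have "(\<Sum>i\<in>Q. c' i * (if s then p i else q i)) = (\<Sum>i\<in>Q - {y0}. c i * (if s then p i else q i))"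
        using finQ by (intro sum.mono_neutral_cong_right) (auto simp: c'_def)
      then show ?thesis using c by simp
    qed
    have "(\<Sum>y\<in>Q. real_of_int (c' y) *\<^sub>R y) =
       (\<Sum>y\<in>Q. real_of_int (c' y * p y) *\<^sub>R a + real_of_int (c' y * q y) *\<^sub>R b + real_of_int (c' y) *\<^sub>R \<xi> y)"
    proof (intro sum.cong refl)
      fix y assume "y \<in> Q"
      then have "real_of_int (c' y) *\<^sub>R y = real_of_int (c' y) *\<^sub>R (real_of_int (p y) *\<^sub>R a + real_of_int (q y) *\<^sub>R b + \<xi> y)"
        using pq by metis
      then show "real_of_int (c' y) *\<^sub>R y = real_of_int (c' y * p y) *\<^sub>R a + real_of_int (c' y * q y) *\<^sub>R b + real_of_int (c' y) *\<^sub>R \<xi> y"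
        by (simp add: scaleR_right_distrib)
    qed
    also have "\<dots> = real_of_int (\<Sum>y\<in>Q. c' y * p y) *\<^sub>R a + real_of_int (\<Sum>y\<in>Q. c' y * q y) *\<^sub>R b + (\<Sum>y\<in>Q. real_of_int (c' y) *\<^sub>R \<xi> y)"
      by (simp add: sum.distrib scaleR_sum_left)
    also have "\<dots> = (\<Sum>y\<in>Q. real_of_int (c' y) *\<^sub>R \<xi> y)"
      using c'[of True] c'[of False] by simp
    also have "\<dots> \<in> V"
      using finQ pq by (induction Q rule: finite_induct) (auto intro!: V_0 V_add V_int)
    finally have inV: "(\<Sum>y\<in>Q. real_of_int (c' y) *\<^sub>R y) \<in> V" .
    \<comment> \<open>Adding multiples of \<open>\<Sum>Q = 0\<close> moves the least coefficient to
      0, so that \<open>z\<close> disappears and a proper subset of \<open>Q\<close>, hence a face,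
      remains.\<close>
    obtain z where z: "z \<in> Q" "\<And>y. y \<in> Q \<Longrightarrow> c' z \<le> c' y"
      using finQ \<open>Q \<noteq> {}\<close> by (metis arg_min_if_finite(1) arg_min_if_finite(2) not_le)
    have "(\<Sum>y\<in>Q. real_of_int (c' y - c' z) *\<^sub>R y) = (\<Sum>y\<in>Q. real_of_int (c' y) *\<^sub>R y) - real_of_int (c' z) *\<^sub>R \<Sum>Q"
      by (simp add: scaleR_left_diff_distrib sum_subtractf scaleR_sum_right)
    then have eq: "(\<Sum>y\<in>Q. real_of_int (c' y - c' z) *\<^sub>R y) \<in> V" using inV Q by simp
    have "\<forall>y\<in>Q. real_of_int (c' y - c' z) \<in> \<int> \<and> real_of_int (c' y - c' z) \<ge> 0"
      using z by auto
    then obtain M where M: "set_mset M \<subseteq> Q" "sum_mset M = (\<Sum>y\<in>Q. real_of_int (c' y - c' z) *\<^sub>R y)"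
       "\<forall>y\<in>Q. real (count M y) = real_of_int (c' y - c' z)"
      using nat_combination_mset[of Q "\<lambda>y. real_of_int (c' y - c' z)"] finQ by auto
    have "z \<notin># M" using M z by (metis count_eq_zero_iff diff_self of_int_0 of_nat_eq_0_iff)
    then have "face (set_mset M)" using M z by (intro fQ) auto
    then have "set_mset M \<subset> P" using eq unfolding M(2)[symmetric] by (rule face_in_V)
    then have "set_mset M \<subseteq> P" by auto
    then have "M = {#}" using M True by (metis disjoint_iff set_mset_eq_empty_iff subset_eq subset_empty Int_greatest)
    then have "\<forall>y\<in>Q. c' y = c' z" using M by auto
    then have "\<forall>y\<in>Q. c' y = c' y0" using y0 by metis
    then show False using c(1) by (metis DiffE c'_def insertI1)
  qed
qed

lemma zero_sum_size:
  assumes "zero_sum M"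
  shows "size M \<ge> d - 1" "size M \<le> d - 1 \<Longrightarrow> M = mset_set P"
  using zero_sum_cases[OF assms] central_unique card_P by (metis, metis le_antisym)

text \<open>The copies of \<open>g\<close> are absorbed one at a time. \<open>M\<close> with
  \<open>g\<close> is not a face, since otherwise the whole sum would be a face sum in
  \<open>V\<close> containing \<open>g\<close>; so three summands shorten to two. They never vanish
  because vanishing sums have at least four terms.\<close>

lemma short_in_V:
  assumes "set_mset M \<subseteq> G" "M \<noteq> {#}" "size M \<le> 2" "g \<in> Y" "sum_mset M + real k *\<^sub>R g \<in> V"
  obtains K where "set_mset K \<subset> P" "K \<noteq> {#}" "size K \<le> 2" "sum_mset K = sum_mset M + real k *\<^sub>R g"
proof -
  have "\<exists>K. set_mset K \<subset> P \<and> K \<noteq> {#} \<and> size K \<le> 2 \<and> sum_mset K = sum_mset M + real k *\<^sub>R g"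
    using assms
  proof (induction k arbitrary: M)
    case 0
    obtain K where K: "set_mset K \<subset> P" "face (set_mset K)" "sum_mset K = sum_mset M"
      using V_normal[of "sum_mset M"] 0 by auto
    have "size K \<le> size M" using face_shortest[of K M] K 0 by auto
    moreover have "K \<noteq> {#}"
    proof
      assume "K = {#}"
      then have "zero_sum M" using K 0 by (auto simp: zero_sum_def)
      then show False using zero_sum_size_ge_4 0 by fastforce
    qed
    ultimately show ?case using K 0 by (intro exI[of _ K]) auto
  next
    case (Suc k)
    let ?M = "add_mset g M"
    have nf: "\<not> face (set_mset ?M)"
    proof
      assume f: "face (set_mset ?M)"
      let ?L = "M + replicate_mset (Suc k) g"
      have "sum_mset (replicate_mset n g) = real n *\<^sub>R g" for n
        by (induction n) (simp_all add: scaleR_left_distrib)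
      then have "sum_mset ?L = sum_mset M + real (Suc k) *\<^sub>R g" by (simp only: sum_mset.union)
      then have "sum_mset ?L \<in> V" using Suc.prems(5) by (simp only:)
      moreover have "face (set_mset ?L)" using f by simp
      ultimately have "set_mset ?L \<subset> P" by (intro face_in_V)
      then show False using Suc.prems Y_P by auto
    qed
    have "set_mset ?M \<subseteq> G" using Suc.prems Y_G by auto
    then obtain M' where M': "face (set_mset M')" "sum_mset M' = sum_mset ?M" "size M' < size ?M"
      using nonface_shorten nf by blast
    have "M' \<noteq> {#}"
    proof
      assume "M' = {#}"
      then have "zero_sum ?M" using M' \<open>set_mset ?M \<subseteq> G\<close> by (auto simp: zero_sum_def)
      then show False using zero_sum_size_ge_4 Suc.prems by fastforce
    qed
    moreover have eq: "sum_mset M' + real k *\<^sub>R g = sum_mset M + real (Suc k) *\<^sub>R g"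
      using M' by (simp add: algebra_simps)
    ultimately obtain K where "set_mset K \<subset> P \<and> K \<noteq> {#} \<and> size K \<le> 2 \<and> sum_mset K = sum_mset M' + real k *\<^sub>R g"
      using Suc.IH[OF face_subset_G[OF M'(1)] _ _ Suc.prems(4)] M'(3) Suc.prems(3,5) by fastforce
    then show ?case using eq by metis
  qed
  then show ?thesis using that by blast
qed

section \<open>Two ray generators that are opposite modulo the central collection\<close>

text \<open>A generator outside the edge has nonpositive height in every star. Summed over
  \<open>m\<close> the heights of \<open>\<xi>\<close> cancel, and \<open>p + q \<le> 0\<close>
  remains, which would put \<open>y\<close> into \<open>V\<close>.\<close>

lemma no_ray_in_cone:
  assumes "\<And>m. m \<in> P \<Longrightarrow> E m a b" "y \<in> Y"
    "y = real_of_int p *\<^sub>R a + real_of_int q *\<^sub>R b + \<xi>" "\<xi> \<in> V" "p \<ge> 0" "q \<ge> 0"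
  shows "y \<in> {a, b}"
proof (rule ccontr)
  assume *: "y \<notin> {a, b}"
  have "hgt (st m a b) \<xi> + real_of_int (p + q) \<le> 0" if "m \<in> P" for m
  proof -
    note B = E_D(4)[OF assms(1)[OF that]]
    have "hgt (st m a b) y = p + q + hgt (st m a b) \<xi>"
      by (subst assms(3)) (simp add: hgt_simps[OF B] hgt_base[OF B])
    moreover have "hgt (st m a b) y \<le> 0" using * assms(2) Y_G Y_P by (intro hgt_nonpos[OF B]) auto
    ultimately show ?thesis by simp
  qed
  then have "(\<Sum>m\<in>P. hgt (st m a b) \<xi> + real_of_int (p + q)) \<le> 0" by (intro sum_nonpos) auto
  moreover have "(\<Sum>m\<in>P. hgt (st m a b) \<xi>) = 0"
    using assms(1) by (intro sum_hgt_V[OF assms(4)]) (auto dest: E_D(4))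
  ultimately have "real (card P) * real_of_int (p + q) \<le> 0" by (simp add: sum.distrib)
  then have "p + q \<le> 0" using card_P d_ge by (simp add: mult_le_0_iff)
  then have "p = 0" "q = 0" using assms by auto
  then show False using assms Y_not_V1 by auto
qed

lemma opposite_sum:
  assumes "y \<in> Y" "y' \<in> Y" "y + y' \<in> V"
  shows "y + y' \<in> P"
proof -
  let ?M = "{#y, y'#}"
  have G: "set_mset ?M \<subseteq> G" using assms Y_G by auto
  have "\<not> face (set_mset ?M)"
    using face_in_V[of ?M] assms Y_P by auto
  then obtain M' where M': "face (set_mset M')" "sum_mset M' = y + y'" "size M' < 2"
    using nonface_shorten[OF G] by (metis add_mset_commute size_add_mset size_single sum_mset.add_mset sum_mset.empty add_0_right Suc_1 One_nat_def)
  have "M' \<noteq> {#}"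
  proof
    assume "M' = {#}"
    then have "zero_sum ?M" using M' G by (auto simp: zero_sum_def)
    then show False using zero_sum_size_ge_4 by fastforce
  qed
  then have "size M' = 1" using M' by (metis One_nat_def less_2_cases size_eq_0_iff_empty)
  then obtain x where "M' = {#x#}" using size_1_singleton_mset by blast
  moreover have "set_mset M' \<subset> P" using M' assms by (intro face_in_V) auto
  ultimately show ?thesis using M' by auto
qed

lemma card_two_mset: "size K = 2 \<Longrightarrow> \<exists>s t. K = {#s, t#}"
proof -
  assume "size K = 2"
  then obtain s L where "K = add_mset s L" "size L = 1"
    using size_eq_Suc_imp_eq_union[of K 1] by auto
  then show ?thesis using size_1_singleton_mset[of L] by auto
qed

lemma card_set_mset_le: "card (set_mset K) \<le> size K"
  by (induction K) (auto simp: card_insert_if)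

lemma pick_P:
  assumes "finite S" "card S < d - 1"
  obtains m where "m \<in> P" "m \<notin> S"
  using assms card_P by (metis card_mono leD subsetI)

lemma pick_P3:
  obtains m where "m \<in> P" "m \<notin> {a, b, c}"
proof -
  have "card {a, b, c} \<le> 3" by (simp add: card_insert_if)
  then have "card {a, b, c} < d - 1" using d_ge by linarith
  then show ?thesis using that pick_P[of "{a, b, c}"] by blast
qed

definition opp where "opp v v' j \<longleftrightarrow> v \<in> Y \<and> v' \<in> Y \<and> j \<in> P \<and> v + v' = j"

lemma opp_sym: "opp v v' j \<Longrightarrow> opp v' v j"
  by (auto simp: opp_def add.commute)

lemma opp_hgt:
  assumes "opp v v' j" "m \<in> P" "m \<noteq> j" "B \<in> Mx" "P - {m} \<subseteq> B"
  shows "hgt B v + hgt B v' = 1"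
  using assms hgt_base[of B j] by (auto simp: opp_def hgt_simps[OF assms(4), symmetric])

lemma opp_hgt_other:
  assumes "opp v v' j" "m \<in> P" "m \<noteq> j" "E m v u"
  shows "hgt (st m v u) v' = 0" "hgt (st m v u) v = 1"
  using opp_hgt[OF assms(1-3) E_D(4)[OF assms(4)]] hgt_base[OF E_D(4)[OF assms(4)], of v] by auto

text \<open>For \<open>m \<noteq> j\<close> the element \<open>j\<close> has height 1, and so has
  the sum \<open>v + v'\<close>. A generator has height 1 if it lies in the cone and at most 0
  otherwise, so neither none nor both of them can lie there.\<close>

lemma opp_edge:
  assumes o: "opp v v' j" and m: "m \<in> P" "m \<noteq> j" and e: "E m a b"
  shows "a \<in> {v, v'} \<longleftrightarrow> b \<notin> {v, v'}"
proof -
  note B = E_D(4)[OF e]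
  have h: "hgt (st m a b) v + hgt (st m a b) v' = 1" using opp_hgt[OF o m B] by auto
  have vY: "v \<in> Y" "v' \<in> Y" using o by (auto simp: opp_def)
  have "\<not> (a \<notin> {v, v'} \<and> b \<notin> {v, v'})"
  proof
    assume "a \<notin> {v, v'} \<and> b \<notin> {v, v'}"
    then have "hgt (st m a b) v \<le> 0" "hgt (st m a b) v' \<le> 0"
      using vY Y_G Y_P by (auto intro!: hgt_nonpos[OF B])
    then show False using h by auto
  qed
  moreover have "\<not> (a \<in> {v, v'} \<and> b \<in> {v, v'})"
  proof
    assume "a \<in> {v, v'} \<and> b \<in> {v, v'}"
    then have "v \<in> st m a b" "v' \<in> st m a b" using E_D(3)[OF e] by auto
    then show False using h by (simp add: hgt_base[OF B])
  qed
  ultimately show ?thesis by blast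
qed

definition quad where
  "quad v v' m u w \<longleftrightarrow> E m v u \<and> E m v' u \<and> E m v w \<and> E m v' w \<and> u \<noteq> w"

lemma quad_sym: "quad v v' m u w \<Longrightarrow> quad v v' m w u" "quad v v' m u w \<Longrightarrow> quad v' v m u w"
  by (auto simp: quad_def)

lemma opp_flip:
  assumes o: "opp v v' j" and m: "m \<in> P" "m \<noteq> j" and e: "E m v u"
  shows "E m v' u"
proof -
  obtain c where c: "E m u c" "c \<noteq> v" using E_wall[OF m(1) e] by metis
  have "u \<notin> {v, v'}" using opp_edge[OF o m e] by auto
  then have "c = v'" using opp_edge[OF o m c(1)] c(2) by auto
  then show ?thesis using c E_sym by auto
qed

lemma opp_quad:
  assumes o: "opp v v' j" and m: "m \<in> P" "m \<noteq> j" and e: "E m v u"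
  obtains w k where "quad v v' m u w" "u + w + real_of_int k *\<^sub>R v \<in> V"
proof -
  obtain w k where w: "E m v w" "w \<noteq> u" "u + w + real_of_int k *\<^sub>R v \<in> V"
    using E_wall[OF m(1) E_sym[OF e]] by metis
  then have "quad v v' m u w" using opp_flip[OF o m] e by (auto simp: quad_def)
  then show ?thesis using that w by auto
qed

lemma opp_start:
  assumes o: "opp v v' j" and m: "m \<in> P" "m \<noteq> j"
  obtains u where "E m v u"
proof -
  obtain a b where e: "E m a b" using E_exists[OF m(1)] by auto
  then have "\<exists>u. E m v u \<or> E m v' u" using opp_edge[OF o m e] E_sym by blast
  then show ?thesis using that opp_flip[OF opp_sym[OF o] m] by auto
qed

text \<open>Only nonnegative coefficients can be shortened by \<open>short_in_V\<close>. A negative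
  multiple of \<open>v\<close> is traded for a positive one of \<open>v'\<close>, as they are
  opposite modulo \<open>V\<close>.\<close>

lemma opp_V_relation:
  assumes o: "opp v v' j" and r: "u + w + real_of_int k *\<^sub>R v \<in> V"
  obtains z z' t where "opp z z' j" "{z, z'} = {v, v'}" "u + w + real t *\<^sub>R z \<in> V"
proof (cases "k \<ge> 0")
  case True
  then have "real (nat k) = real_of_int k" by simp
  then show ?thesis using that[of v v' "nat k"] o r by (metis)
next
  case False
  have "v + v' \<in> V" using o P_V by (auto simp: opp_def)
  then have "u + w + real_of_int k *\<^sub>R v + real_of_int (- k) *\<^sub>R (v + v') \<in> V"
    by (rule V_add[OF r V_int])
  then have "u + w + real (nat (- k)) *\<^sub>R v' \<in> V" using False by (simp add: algebra_simps)
  then show ?thesis using that[of v' v "nat (- k)"] opp_sym[OF o] by auto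
qed

text \<open>The left side shortens to a sum \<open>K\<close> of one or two elements of
  \<open>P\<close>. In a cone containing \<open>v'\<close> the height of \<open>v\<close> is 0, so
  \<open>u\<close> and \<open>w\<close> together have height \<open>size K\<close> whenever
  \<open>m\<close> is outside \<open>K\<close>; this controls which of them lie in the cone.\<close>

lemma opp_relation:
  assumes o: "opp v v' j" and l: "l \<in> P" "l \<noteq> j" and q: "quad v v' l u w"
    and r: "u + w + real t *\<^sub>R v \<in> V"
  obtains i where "i \<in> P" "u + w + real t *\<^sub>R v = i"
    "\<And>m e. m \<in> P - {i, j} \<Longrightarrow> E m v' e \<Longrightarrow> e \<in> {u, w}"
proof -
  note quad = q[unfolded quad_def]
  have uw: "u \<in> Y" "w \<in> Y" "v \<in> Y" "v' \<in> Y" "u \<noteq> w" using quad E_D by blast+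
  have uv: "u \<notin> {v, v'}" "w \<notin> {v, v'}" using opp_edge[OF o l] quad by blast+
  obtain K where K: "set_mset K \<subset> P" "K \<noteq> {#}" "size K \<le> 2" "sum_mset K = u + w + real t *\<^sub>R v"
    using short_in_V[of "{#u, w#}" v t] uw Y_G r by auto
  have key: "hgt (st m v' e) u + hgt (st m v' e) w = size K" if m: "m \<in> P" "m \<notin># K" "m \<noteq> j" "E m v' e" for m e
  proof -
    note B = E_D(4)[OF m(4)]
    have "hgt (st m v' e) (sum_mset K) = size K"
      using hgt_mset_P[OF m(1) B, of K] K(1) m by (auto simp: not_in_iff)
    moreover have "hgt (st m v' e) v = 0" using opp_hgt_other(1)[OF opp_sym[OF o] m(1,3,4)] .
    ultimately show ?thesis unfolding K(4) by (simp add: hgt_simps[OF B])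
  qed
  \<comment> \<open>With two summands both \<open>u\<close> and \<open>w\<close> would have to be
    the one vertex next to \<open>v'\<close>.\<close>
  have "size K = 1"
  proof (rule ccontr)
    assume "size K \<noteq> 1"
    then have s2: "size K = 2" using K by (metis One_nat_def Suc_1 le_Suc_eq le_zero_eq size_eq_0_iff_empty)
    then obtain s t where "K = {#s, t#}" using card_two_mset by blast
    then obtain m where m: "m \<in> P" "m \<notin># K" "m \<noteq> j"
      using pick_P3[of j s t] by auto
    obtain e where e: "E m v' e" using opp_start[OF opp_sym[OF o] m(1,3)] by auto
    note B = E_D(4)[OF e]
    have "hgt (st m v' e) u + hgt (st m v' e) w = 2" using key[OF m e] s2 by simp
    moreover have "hgt (st m v' e) u \<le> 1" "hgt (st m v' e) w \<le> 1" using uw Y_G hgt_le_1[OF B] by auto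
    ultimately have "hgt (st m v' e) u > 0" "hgt (st m v' e) w > 0" by auto
    then have "u \<in> st m v' e" "w \<in> st m v' e" using uw Y_G hgt_nonpos[OF B] by (meson not_le subsetD)+
    then show False using uv uw Y_P by auto
  qed
  then obtain i where i: "K = {#i#}" using size_1_singleton_mset by blast
  have "e \<in> {u, w}" if m: "m \<in> P - {i, j}" and e: "E m v' e" for m e
  proof (rule ccontr)
    assume *: "e \<notin> {u, w}"
    note B = E_D(4)[OF e]
    have "hgt (st m v' e) u \<le> 0" "hgt (st m v' e) w \<le> 0"
      using * uw uv Y_G Y_P by (auto intro!: hgt_nonpos[OF B])
    moreover have "hgt (st m v' e) u + hgt (st m v' e) w = 1" using key[OF _ _ _ e] m i by simp
    ultimately show False by linarith
  qed
  moreover have "i \<in> P" "u + w + real t *\<^sub>R v = i" using K(1,4) i by auto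
  ultimately show ?thesis using that by blast
qed

lemma opp_relation_any_sign:
  assumes o: "opp v v' j" and l: "l \<in> P" "l \<noteq> j" and q: "quad v v' l u w"
    and r: "u + w + real_of_int k *\<^sub>R v \<in> V"
  obtains z z' t i where "opp z z' j" "{z, z'} = {v, v'}" "i \<in> P" "u + w + real t *\<^sub>R z = i"
    "\<And>m e. m \<in> P - {i, j} \<Longrightarrow> E m v e \<Longrightarrow> e \<in> {u, w}"
proof -
  obtain z z' t where z: "opp z z' j" "{z, z'} = {v, v'}" "u + w + real t *\<^sub>R z \<in> V"
    using opp_V_relation[OF o r] by metis
  have "quad z z' l u w" using q z(2) quad_sym by (metis doubleton_eq_iff)
  then obtain i where i: "i \<in> P" "u + w + real t *\<^sub>R z = i"
    "\<And>m e. m \<in> P - {i, j} \<Longrightarrow> E m z' e \<Longrightarrow> e \<in> {u, w}"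
    using opp_relation[OF z(1) l _ z(3)] by metis
  have "e \<in> {u, w}" if "m \<in> P - {i, j}" "E m v e" for m e
  proof (cases "v = z'")
    case False
    then have "v' = z'" using z(2) by (auto simp: doubleton_eq_iff)
    then show ?thesis using i(3)[OF that(1)] opp_flip[OF o _ _ that(2)] that(1) by auto
  qed (use i that in auto)
  then show ?thesis using that[OF z(1,2) i(1,2)] by blast
qed

lemma opp_common_quad:
  assumes o: "opp v v' j"
  obtains u w z z' t i where "\<And>m. m \<in> P - {j} \<Longrightarrow> quad v v' m u w"
    "opp z z' j" "{z, z'} = {v, v'}" "i \<in> P" "u + w + real t *\<^sub>R z = i"
    "\<And>m e. m \<in> P - {i, j} \<Longrightarrow> E m v e \<Longrightarrow> e \<in> {u, w}"
proof -
  obtain l where l: "l \<in> P" "l \<noteq> j" by (rule pick_P3[of j j j]) auto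
  obtain u w k where q: "quad v v' l u w" and r: "u + w + real_of_int k *\<^sub>R v \<in> V"
    using opp_start[OF o l] opp_quad[OF o l] by metis
  obtain z z' t i where i: "opp z z' j" "{z, z'} = {v, v'}" "i \<in> P" "u + w + real t *\<^sub>R z = i"
    "\<And>m e. m \<in> P - {i, j} \<Longrightarrow> E m v e \<Longrightarrow> e \<in> {u, w}" by (rule opp_relation_any_sign[OF o l q r]) blast
  have quadE: "\<exists>u' w' k'. quad v v' m u' w' \<and> u' + w' + real_of_int k' *\<^sub>R v \<in> V" if "m \<in> P" "m \<noteq> j" for m
    using opp_start[OF o that] opp_quad[OF o that] by metis
  have same: "quad v v' m u w \<and> {u', w'} = {u, w}" if m: "m \<in> P - {i, j}" and q': "quad v v' m u' w'" for m u' w'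
  proof -
    have "u' \<in> {u, w}" "w' \<in> {u, w}" "u' \<noteq> w'" using i(5)[OF m] q' by (auto simp: quad_def)
    then show ?thesis using q' quad_sym(1)[OF q'] by auto
  qed
  have "quad v v' m u w" if m: "m \<in> P - {j}" for m
  proof (cases "m = i")
    case False
    then show ?thesis using same[of m] quadE[of m] m by auto
  next
    case True
    obtain u' w' k' where q': "quad v v' m u' w'" and r': "u' + w' + real_of_int k' *\<^sub>R v \<in> V"
      using quadE[of m] m by auto
    have mm: "m \<in> P" "m \<noteq> j" using m by auto
    obtain i' where i': "i' \<in> P" "\<And>m e. m \<in> P - {i', j} \<Longrightarrow> E m v e \<Longrightarrow> e \<in> {u', w'}"
      by (rule opp_relation_any_sign[OF o mm q' r']) blast
    \<comment> \<open>The relation found in star \<open>l\<close> says nothing about star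
      \<open>i\<close>. Star \<open>i\<close> has its own relation, with exception
      \<open>i'\<close>; a third star outside both exceptions links the two.\<close>
    obtain n where n: "n \<in> P" "n \<notin> {i, i', j}" by (rule pick_P3)
    obtain u'' w'' where q'': "quad v v' n u'' w''" using quadE[of n] n by auto
    have "{u'', w''} = {u, w}" using same[OF _ q''] n by auto
    moreover have "u'' \<in> {u', w'}" "w'' \<in> {u', w'}" "u'' \<noteq> w''" using i'(2)[of n] n q'' by (auto simp: quad_def)
    ultimately have "{u', w'} = {u, w}" by auto
    then show ?thesis using q' quad_sym(1)[OF q'] by (auto simp: doubleton_eq_iff)
  qed
  then show ?thesis using that i by metis
qed

text \<open>Otherwise \<open>- v' = v + \<Sum>(P - {j})\<close> would be a sum of fewer than \<open>d - 1\<close> ray generators, and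
  together with \<open>v'\<close> they would form a vanishing sum that is too short.\<close>

lemma opp_face:
  assumes o: "opp v v' j"
  shows "face (insert v (P - {j}))"
proof (rule ccontr)
  assume nf: "\<not> ?thesis"
  have v: "v \<in> Y" "v' \<in> Y" "j \<in> P" "v + v' = j" using o by (auto simp: opp_def)
  let ?M = "add_mset v (mset_set (P - {j}))"
  have set: "set_mset ?M = insert v (P - {j})" using finite_P by simp
  have "set_mset ?M \<subseteq> G" using v Y_G P_G unfolding set by auto
  then obtain M' where M': "face (set_mset M')" "sum_mset M' = sum_mset ?M" "size M' < size ?M"
    using nonface_shorten nf unfolding set[symmetric] by metis
  have "sum_mset ?M = v + \<Sum>(P - {j})" by (simp add: sum_mset_set)
  also have "\<dots> = v - j" using sum_P v finite_P by (simp add: sum_diff1)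
  also have "\<dots> = - v'" unfolding v(4)[symmetric] by simp
  finally have "sum_mset (add_mset v' M') = 0" using M' by simp
  then have "zero_sum (add_mset v' M')" using M' face_subset_G v Y_G by (auto simp: zero_sum_def)
  moreover have "size (add_mset v' M') \<le> d - 1" using M' v finite_P card_P d_ge by simp
  ultimately have "add_mset v' M' = mset_set P" by (rule zero_sum_size(2))
  then have "v' \<in> P" by (metis elem_mset_set finite_P union_single_eq_member)
  then show False using v Y_P by auto
qed

text \<open>Cancelling the multiple of \<open>v\<close> in \<open>y + w\<close> yields a relation
  with at most two summands in \<open>P\<close>. If it omitted some \<open>m\<close> outside
  \<open>{i, j}\<close>, heights in that star would be contradictory; but at least three such
  \<open>m\<close> exist.\<close>

lemma opp_height_one:
  assumes o: "opp v v' j" and q: "\<And>m. m \<in> P - {j} \<Longrightarrow> quad v v' m u w"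
    and r: "i \<in> P" "u + w + real t *\<^sub>R v' = i"
    and y: "y \<in> Y" "y = real_of_int k *\<^sub>R v + u + \<xi>" "\<xi> \<in> V"
  shows "y \<in> {u, w}"
proof (rule ccontr)
  assume *: "y \<notin> {u, w}"
  have v: "v \<in> Y" "v' \<in> Y" "j \<in> P" "v + v' = j" using o by (auto simp: opp_def)
  obtain l where l: "l \<in> P" "l \<noteq> j" by (rule pick_P3[of j j j]) auto
  then have ql: "E l v u" "E l v w" using q[of l] by (auto simp: quad_def)
  have uw: "u \<in> Y" "w \<in> Y" using E_D(2) ql by auto
  have cy: "representation (st l v u) y u = 1"
    using coord_E(2)[OF l(1) ql(1) y(3), of "real_of_int k" 1] y(2) by simp
  have "y \<noteq> v" using cy E_D(3)[OF ql(1)] by (auto simp: coord_basis[OF E_D(4)[OF ql(1)]])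
  moreover have "y \<noteq> v'"
  proof
    assume "y = v'"
    then have "y = real_of_int (- 1) *\<^sub>R v + real_of_int 0 *\<^sub>R u + j" using v by auto
    then have "representation (st l v u) y u = 0" using coord_E(2)[OF l(1) ql(1) P_V[OF v(3)]] by (metis of_int_0)
    then show False using cy by simp
  qed
  ultimately have yn: "y \<notin> {v, v', u, w}" using * by auto
  \<comment> \<open>Modulo \<open>V\<close>, \<open>v'\<close> is \<open>- v\<close> and
    \<open>y + w\<close> is \<open>k + t\<close> times \<open>v\<close>; \<open>s\<close> copies of
    \<open>g\<close> cancel this.\<close>
  define g :: 'a where "g = (if k + int t \<ge> 0 then v' else v)"
  define s where "s = nat \<bar>k + int t\<bar>"
  have w_eq: "w = i - u - real t *\<^sub>R v'" using r by (simp add: algebra_simps)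
  have v'_eq: "v' = j - v" using v(4) by (simp add: algebra_simps)
  have iV: "i \<in> V" and jV: "j \<in> V" using P_V r(1) v(3) by blast+
  have "y + w + real s *\<^sub>R g \<in> V"
  proof (cases "k + int t \<ge> 0")
    case True
    then have s: "real s = real_of_int k + real t" by (simp add: s_def)
    have "y + w + real s *\<^sub>R g = \<xi> + i + real_of_int k *\<^sub>R j"
      unfolding s y(2) using True by (subst w_eq) (simp add: g_def v'_eq algebra_simps)
    then show ?thesis using V_add[OF V_add[OF y(3) iV] V_int[OF jV]] by simp
  next
    case False
    then have s: "real s = - real_of_int k - real t" by (simp add: s_def)
    have "y + w + real s *\<^sub>R g = \<xi> + i - real t *\<^sub>R j"
      unfolding s y(2) using False by (subst w_eq) (simp add: g_def v'_eq algebra_simps)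
    then show ?thesis using V_diff[OF V_add[OF y(3) iV] V_nat[OF jV]] by simp
  qed
  moreover have "set_mset {#y, w#} \<subseteq> G" "g \<in> Y" using y uw v Y_G by (auto simp: g_def)
  ultimately obtain K where K: "set_mset K \<subset> P" "K \<noteq> {#}" "size K \<le> 2" "sum_mset K = y + w + real s *\<^sub>R g"
    using short_in_V[of "{#y, w#}" g s] by auto
  have "m \<in># K" if m: "m \<in> P - {i, j}" for m
  proof (rule ccontr)
    assume nm: "m \<notin># K"
    have mP: "m \<in> P" "m \<noteq> j" "m \<noteq> i" using m by auto
    have qm: "E m v u" "E m v' u" using q[of m] m by (auto simp: quad_def)
    have *: "hgt B y + hgt B w + real s * hgt B g > 0" if "B \<in> Mx" "P - {m} \<subseteq> B" for B
    proof -
      have "hgt B (sum_mset K) = size K" using hgt_mset_P[OF mP(1) that, of K] K nm by (auto simp: not_in_iff)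
      then have "hgt B (sum_mset K) > 0" using K(2) by (simp add: nonempty_has_size)
      then show ?thesis unfolding K(4) by (simp add: hgt_simps[OF that(1)])
    qed
    have hw: "hgt B w = 1 - hgt B u - t * hgt B v'" if "B \<in> Mx" "P - {m} \<subseteq> B" for B
      using that mP r hgt_base[of B i] by (subst w_eq) (auto simp: hgt_simps[OF that(1)])
    have hy: "hgt B y \<le> 0" if "B = st m v u \<or> B = st m v' u" "B \<in> Mx" for B
      using that yn y Y_G Y_P by (intro hgt_nonpos) auto
    note B1 = E_D(4)[OF qm(1)] and B2 = E_D(4)[OF qm(2)]
    have h1: "hgt (st m v u) v' = 0" "hgt (st m v u) v = 1" "hgt (st m v u) u = 1"
      using opp_hgt_other[OF o mP(1,2) qm(1)] hgt_base[OF B1, of u] by auto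
    have h2: "hgt (st m v' u) v = 0" "hgt (st m v' u) v' = 1" "hgt (st m v' u) u = 1"
      using opp_hgt_other[OF opp_sym[OF o] mP(1,2) qm(2)] hgt_base[OF B2, of u] by auto
    \<comment> \<open>The cone is chosen by the sign of \<open>k\<close>: beside \<open>v\<close>
      for \<open>k \<ge> 0\<close>, where \<open>g = v'\<close> has height 0; beside
      \<open>v'\<close> otherwise, where \<open>w\<close> has height \<open>- t\<close> and the
      copies of \<open>g\<close> contribute at most \<open>t\<close>.\<close>
    show False
    proof (cases "k \<ge> 0")
      case True
      then have "g = v'" by (simp add: g_def)
      then show False using *[OF B1] hw[OF B1] hy[OF _ B1] h1 by fastforce
    next
      case False
      have "hgt (st m v' u) w = - real t" using hw[OF B2] h2 by auto
      moreover have "real s * hgt (st m v' u) g \<le> real t"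
        using False h2 by (auto simp: g_def s_def)
      moreover have "hgt (st m v' u) y \<le> 0" using hy[OF _ B2] by auto
      ultimately show False using *[OF B2] by auto
    qed
  qed
  then have "P - {i, j} \<subseteq> set_mset K" by auto
  then have "card (P - {i, j}) \<le> card (set_mset K)" by (intro card_mono) auto
  also have "\<dots> \<le> size K" by (rule card_set_mset_le) 
  finally have "card (P - {i, j}) \<le> 2" using K by simp
  moreover have "card (P - {i, j}) \<ge> d - 1 - 2"
    using diff_card_le_card_Diff[of "{i, j}" P] card_P by (simp add: card_insert_if split: if_splits)
  ultimately show False using d_ge by auto
qed

text \<open>In the exceptional star \<open>j\<close> the height argument of \<open>opp_edge\<close>
  fails. Instead, \<open>v, y\<close> and \<open>v, u\<close> are both bases of N / V, so
  \<open>y\<close> is \<open>u\<close> or \<open>- u\<close> up to a multiple of \<open>v\<close>.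
  The relation turns \<open>- u\<close> into \<open>w\<close>, and \<open>opp_height_one\<close>
  applies in both cases.\<close>

lemma opp_star_j:
  assumes o: "opp v v' j" and q: "\<And>m. m \<in> P - {j} \<Longrightarrow> quad v v' m u w"
    and z: "opp z z' j" "{z, z'} = {v, v'}" and r: "i \<in> P" "u + w + real t *\<^sub>R z = i" and e: "E j v y"
  shows "y \<in> {u, w}"
proof -
  have v: "v \<in> Y" "v' \<in> Y" "j \<in> P" "v + v' = j" using o by (auto simp: opp_def)
  have yY: "y \<in> Y" "y \<in> N" using E_D[OF e] Y_N by auto
  obtain l where l: "l \<in> P" "l \<noteq> j" by (rule pick_P3[of j j j]) auto
  then have ql: "E l v u" "E l v w" using q[of l] by (auto simp: quad_def)
  have uw: "u \<in> Y" "w \<in> Y" "u \<in> N" using E_D(2) ql Y_N by auto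
  obtain p q' \<xi> where y: "y = real_of_int p *\<^sub>R v + real_of_int q' *\<^sub>R u + \<xi>" "\<xi> \<in> V"
    using E_decompose[OF l(1) ql(1) yY(2)] by metis
  obtain a b \<xi>' where u: "u = real_of_int a *\<^sub>R v + real_of_int b *\<^sub>R y + \<xi>'" "\<xi>' \<in> V"
    using E_decompose[OF v(3) e uw(3)] by metis
  have "u = real_of_int (a + b * p) *\<^sub>R v + real_of_int (b * q') *\<^sub>R u + (real_of_int b *\<^sub>R \<xi> + \<xi>')"
    by (subst u(1), subst y(1)) (simp add: algebra_simps)
  then have "representation (st l v u) u u = real_of_int (b * q')"
    using coord_E(2)[OF l(1) ql(1) V_add[OF V_int[OF y(2)] u(2)], of "real_of_int (a + b * p)" "real_of_int (b * q')" b]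
    by simp
  then have "real_of_int (b * q') = 1" using coord_basis[OF E_D(4)[OF ql(1)], of u u] by simp
  then have "b * q' = 1" by (metis of_int_eq_1_iff)
  then have q': "q' = 1 \<or> q' = - 1" by (auto simp: zmult_eq_1_iff)
  have eq_w: "w = i - u - real t *\<^sub>R z" using r(2) by (simp add: algebra_simps)
  have qs: "quad z' z m u w" "quad z' z m w u" if "m \<in> P - {j}" for m
    using q[OF that] z(2) by (auto simp: doubleton_eq_iff quad_def)
  \<comment> \<open>\<open>z\<close> is the one of \<open>v\<close>, \<open>v'\<close> with
    nonnegative coefficient in the relation. Multiples of \<open>v\<close> are rewritten in the
    other one, \<open>z'\<close>, as \<open>opp_height_one\<close> expects.\<close>
  have conv: "\<exists>k \<eta>. \<eta> \<in> V \<and> real_of_int n *\<^sub>R v = real_of_int k *\<^sub>R z' + \<eta>" for n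
  proof (cases "v = z'")
    case True then show ?thesis using V_0 by (intro exI[of _ n] exI[of _ 0]) auto
  next
    case False
    then have "v' = z'" using z(2) by (auto simp: doubleton_eq_iff)
    then have "v = j - z'" using v by (simp add: algebra_simps)
    then show ?thesis using P_V[OF v(3)]
      by (intro exI[of _ "- n"] exI[of _ "real_of_int n *\<^sub>R j"]) (auto simp: algebra_simps intro: V_int)
  qed
  have zz: "z = j - z'" using z(1) by (auto simp: opp_def algebra_simps)
  show ?thesis
  proof (cases "q' = 1")
    case True
    obtain k \<eta> where "\<eta> \<in> V" "real_of_int p *\<^sub>R v = real_of_int k *\<^sub>R z' + \<eta>" using conv by blast
    then have "y = real_of_int k *\<^sub>R z' + u + (\<eta> + \<xi>)" "\<eta> + \<xi> \<in> V"
      using y True by (auto simp: algebra_simps intro: V_add)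
    then show ?thesis using opp_height_one[OF opp_sym[OF z(1)] qs(1) r yY(1)] by blast
  next
    case False
    then have "q' = - 1" using q' by auto
    obtain k \<eta> where k: "\<eta> \<in> V" "real_of_int p *\<^sub>R v = real_of_int k *\<^sub>R z' + \<eta>" using conv by blast
    have u_eq: "u = i - w - real t *\<^sub>R (j - z')" using eq_w unfolding zz by simp
    have "y = real_of_int k *\<^sub>R z' + \<eta> - u + \<xi>" using y(1) \<open>q' = - 1\<close> k(2) by simp
    then have "y = real_of_int (k - int t) *\<^sub>R z' + w + (\<eta> + \<xi> - i + real t *\<^sub>R j)"
      unfolding u_eq by (simp add: algebra_simps)
    moreover have "i \<in> V" "j \<in> V" using P_V r(1) v(3) by blast+
    then have "\<eta> + \<xi> - i + real t *\<^sub>R j \<in> V"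
      using k(1) y(2) by (intro V_add V_diff V_nat)
    moreover have "w + u + real t *\<^sub>R z = i" using r by (simp add: add.commute)
    ultimately have "y \<in> {w, u}" using opp_height_one[OF opp_sym[OF z(1)] qs(2) r(1) _ yY(1)] by blast
    then show ?thesis by auto
  qed
qed

lemma card_Y_opposite:
  assumes o: "opp v v' j"
  shows "card Y \<le> 4"
proof -
  obtain u w z z' t i where q: "\<And>m. m \<in> P - {j} \<Longrightarrow> quad v v' m u w"
    and z: "opp z z' j" "{z, z'} = {v, v'}" and r: "i \<in> P" "u + w + real t *\<^sub>R z = i"
    and edges: "\<And>m e. m \<in> P - {i, j} \<Longrightarrow> E m v e \<Longrightarrow> e \<in> {u, w}"
    by (rule opp_common_quad[OF o]) blast
  have jP: "j \<in> P" and vY: "v \<in> Y" "v' \<in> Y" using o by (auto simp: opp_def)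
  \<comment> \<open>\<open>opp_face\<close> guarantees that \<open>x\<close> occurs in star
    \<open>j\<close> at all; crossing the wall of \<open>x\<close> gives it two distinct neighbours
    there, and only \<open>u\<close> and \<open>w\<close> are possible.\<close>
  have both: "E j x u \<and> E j x w" if ox: "opp x x' j" "{x, x'} = {v, v'}" for x x'
  proof -
    have qx: "quad x x' m u w" if "m \<in> P - {j}" for m
      using q[OF that] ox(2) by (auto simp: doubleton_eq_iff quad_def)
    have zx: "{z, z'} = {x, x'}" using z ox by simp
    have star: "y \<in> {u, w}" if "E j x y" for y
      using opp_star_j[OF ox(1) _ z(1) zx r that] qx by blast
    have "x \<in> Y" using ox by (auto simp: opp_def)
    then obtain y where y: "E j x y" using face_E[OF jP opp_face[OF ox(1)]] by auto
    obtain y' where y': "E j x y'" "y' \<noteq> y" using E_wall[OF jP E_sym[OF y]] by metis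
    show ?thesis using star[OF y] star[OF y'(1)] y y' by auto
  qed
  have qall: "quad v v' m u w" if "m \<in> P" for m
  proof (cases "m = j")
    case True
    obtain l where "l \<in> P" "l \<notin> {j, j, j}" by (rule pick_P3)
    then have "u \<noteq> w" using q[of l] by (auto simp: quad_def)
    then show ?thesis using both[OF o] both[OF opp_sym[OF o]] True by (auto simp: quad_def)
  qed (use q that in auto)
  obtain m where m: "m \<in> P" "m \<notin> {i, j}" by (rule pick_P3[of i j j]) auto
  \<comment> \<open>\<open>y\<close> projects into a cone of star \<open>m\<close>. For this choice
    of \<open>m\<close> its edge belongs to the common quadrangle, hence to all stars, and
    \<open>no_ray_in_cone\<close> applies.\<close>
  have "y \<in> {v, v', u, w}" if y: "y \<in> Y" for y
  proof -
    obtain a b p q' \<xi> where ab: "E m a b" "y = real_of_int p *\<^sub>R a + real_of_int q' *\<^sub>R b + \<xi>" "\<xi> \<in> V" "p \<ge> 0" "q' \<ge> 0"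
      using E_cover[OF m(1)] y Y_N by (metis subsetD)
    have "\<exists>a b p q'. E m a b \<and> y = real_of_int p *\<^sub>R a + real_of_int q' *\<^sub>R b + \<xi> \<and> p \<ge> 0 \<and> q' \<ge> 0 \<and> a \<in> {v, v'}"
    proof (cases "a \<in> {v, v'}")
      case False
      then have "b \<in> {v, v'}" using opp_edge[OF o m(1) _ ab(1)] m by auto
      then show ?thesis using ab E_sym[OF ab(1)] by (metis add.commute)
    qed (use ab in blast)
    then obtain a b p q' where ab: "E m a b" "y = real_of_int p *\<^sub>R a + real_of_int q' *\<^sub>R b + \<xi>" "p \<ge> 0" "q' \<ge> 0" "a \<in> {v, v'}"
      by blast
    have "E m v b" using ab(1,5) opp_flip[OF opp_sym[OF o] m(1)] m by auto
    then have "b \<in> {u, w}" using edges[of m b] m by auto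
    then have "\<And>n. n \<in> P \<Longrightarrow> E n a b" using qall ab(5) by (auto simp: quad_def)
    from no_ray_in_cone[OF this y ab(2) \<open>\<xi> \<in> V\<close> ab(3,4)] show ?thesis using ab(5) \<open>b \<in> {u, w}\<close> by auto
  qed
  then have "Y \<subseteq> {v, v', u, w}" by auto
  then have "card Y \<le> card {v, v', u, w}" by (intro card_mono) auto
  also have "\<dots> \<le> 4" by (simp add: card_insert_if)
  finally show ?thesis .
qed

section \<open>No opposite ray generators\<close>

lemma E_coords:
  assumes "m \<in> P" "E m a b" "\<xi> \<in> V" "\<xi>' \<in> V"
    "real_of_int s *\<^sub>R a + real_of_int t *\<^sub>R b + \<xi> = real_of_int s' *\<^sub>R a + real_of_int t' *\<^sub>R b + \<xi>'"
  shows "s = s'" "t = t'"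
  using coord_E[OF assms(1,2,3), of "real_of_int s" "real_of_int t"]
    coord_E[OF assms(1,2,4), of "real_of_int s'" "real_of_int t'"] assms(5) by auto

text \<open>Two bases of N / V: the transition determinants in both directions are integers with
  product 1.\<close>

lemma E_det:
  assumes m: "m \<in> P" and ab: "E m a b" and cd: "E m c f"
    and c: "c = real_of_int c1 *\<^sub>R a + real_of_int c2 *\<^sub>R b + \<xi>1" "\<xi>1 \<in> V"
    and f: "f = real_of_int d1 *\<^sub>R a + real_of_int d2 *\<^sub>R b + \<xi>2" "\<xi>2 \<in> V"
  shows "\<bar>c1 * d2 - c2 * d1\<bar> = 1"
proof -
  have N: "a \<in> N" "b \<in> N" using E_D[OF ab] Y_N by auto
  obtain a1 a2 \<xi>3 where a: "a = real_of_int a1 *\<^sub>R c + real_of_int a2 *\<^sub>R f + \<xi>3" "\<xi>3 \<in> V"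
    using E_decompose[OF m cd N(1)] by metis
  obtain b1 b2 \<xi>4 where b: "b = real_of_int b1 *\<^sub>R c + real_of_int b2 *\<^sub>R f + \<xi>4" "\<xi>4 \<in> V"
    using E_decompose[OF m cd N(2)] by metis
  have subst: "real_of_int x *\<^sub>R c + real_of_int y *\<^sub>R f + \<xi> =
      real_of_int (x * c1 + y * d1) *\<^sub>R a + real_of_int (x * c2 + y * d2) *\<^sub>R b + (\<xi> + real_of_int x *\<^sub>R \<xi>1 + real_of_int y *\<^sub>R \<xi>2)" for x y \<xi>
    by (subst c(1), subst f(1)) (simp add: algebra_simps)
  have VV: "\<xi> + real_of_int x *\<^sub>R \<xi>1 + real_of_int y *\<^sub>R \<xi>2 \<in> V" if "\<xi> \<in> V" for \<xi> x y
    using that c(2) f(2) by (intro V_add V_int)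
  have "a = real_of_int 1 *\<^sub>R a + real_of_int 0 *\<^sub>R b + 0" by simp
  then have 1: "real_of_int 1 *\<^sub>R a + real_of_int 0 *\<^sub>R b + 0 = real_of_int (a1 * c1 + a2 * d1) *\<^sub>R a + real_of_int (a1 * c2 + a2 * d2) *\<^sub>R b + (\<xi>3 + real_of_int a1 *\<^sub>R \<xi>1 + real_of_int a2 *\<^sub>R \<xi>2)"
    using a(1) subst by metis
  have "b = real_of_int 0 *\<^sub>R a + real_of_int 1 *\<^sub>R b + 0" by simp
  then have 2: "real_of_int 0 *\<^sub>R a + real_of_int 1 *\<^sub>R b + 0 = real_of_int (b1 * c1 + b2 * d1) *\<^sub>R a + real_of_int (b1 * c2 + b2 * d2) *\<^sub>R b + (\<xi>4 + real_of_int b1 *\<^sub>R \<xi>1 + real_of_int b2 *\<^sub>R \<xi>2)"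
    using b(1) subst by metis
  note e1 = E_coords[OF m ab V_0 VV[OF a(2)] 1] and e2 = E_coords[OF m ab V_0 VV[OF b(2)] 2]
  have "(c1 * d2 - c2 * d1) * (a1 * b2 - a2 * b1)
      = (a1 * c1 + a2 * d1) * (b1 * c2 + b2 * d2) - (a1 * c2 + a2 * d2) * (b1 * c1 + b2 * d1)"
    by (simp add: algebra_simps)
  also have "\<dots> = 1" unfolding e1[symmetric] e2[symmetric] by simp
  finally show ?thesis by (auto simp: zmult_eq_1_iff)
qed

lemma sum_three: "a \<noteq> b \<Longrightarrow> a \<noteq> c \<Longrightarrow> b \<noteq> c \<Longrightarrow> \<Sum>{a, b, c} = a + b + c" for a b c :: 'a
  by (simp add: add.assoc)

definition tri where
  "tri m T \<longleftrightarrow> T \<subseteq> Y \<and> card T = 3 \<and> (\<forall>a\<in>T. \<forall>b\<in>T. a \<noteq> b \<longrightarrow> E m a b)"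

text \<open>As \<open>\<Sum>L\<close> is in \<open>V\<close>, the three edges cover N / V. They are
  common to all stars, so \<open>no_ray_in_cone\<close> shows that \<open>Y\<close> is contained in
  \<open>L\<close>.\<close>

lemma no_third_ray:
  assumes L: "\<And>m. m \<in> P \<Longrightarrow> tri m L" and s: "\<Sum>L \<in> V"
  shows "card Y \<le> 4"
proof -
  obtain m where m: "m \<in> P" by (rule pick_P3)
  obtain a b c where abc: "L = {a, b, c}" "a \<noteq> b" "a \<noteq> c" "b \<noteq> c"
    using L[OF m] by (auto simp: tri_def card_3_iff)
  have e: "E n a b" "E n b c" "E n a c" if "n \<in> P" for n using L[OF that] abc by (auto simp: tri_def)
  have sum: "a + b + c \<in> V" using s abc sum_three by metis
  have "y \<in> {a, b, c}" if y: "y \<in> Y" for y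
  proof -
    have "y \<in> N" using y Y_N by auto
    then obtain p q \<xi> where pq: "y = real_of_int p *\<^sub>R a + real_of_int q *\<^sub>R b + \<xi>" "\<xi> \<in> V"
      using E_decompose[OF m e(1)[OF m]] by metis
    \<comment> \<open>Subtracting the smallest of \<open>p\<close>, \<open>q\<close>, 0 as a
      multiple of \<open>a + b + c\<close> makes all coefficients nonnegative with one of them
      0.\<close>
    consider "p \<ge> 0" "q \<ge> 0" | "p < 0" "p \<le> q" | "q < 0" "q \<le> p" by linarith
    then show ?thesis
    proof cases
      case 1
      then show ?thesis using no_ray_in_cone[OF e(1) y pq] by auto
    next
      case 2
      have "y = real_of_int (q - p) *\<^sub>R b + real_of_int (- p) *\<^sub>R c + (\<xi> + real_of_int p *\<^sub>R (a + b + c))"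
        unfolding pq(1) by (simp add: algebra_simps)
      from no_ray_in_cone[OF e(2) y this V_add[OF pq(2) V_int[OF sum]]] 2 show ?thesis by auto
    next
      case 3
      have "y = real_of_int (p - q) *\<^sub>R a + real_of_int (- q) *\<^sub>R c + (\<xi> + real_of_int q *\<^sub>R (a + b + c))"
        unfolding pq(1) by (simp add: algebra_simps)
      from no_ray_in_cone[OF e(3) y this V_add[OF pq(2) V_int[OF sum]]] 3 show ?thesis by auto
    qed
  qed
  then have "card Y \<le> card {a, b, c}" by (intro card_mono) auto
  also have "\<dots> \<le> 4" by (simp add: card_insert_if)
  finally show ?thesis .
qed

text \<open>For a further \<open>y\<close> write \<open>y + g a + h b = \<eta>\<close> in
  \<open>V\<close>. Summing heights over cones on \<open>a, b\<close>, on \<open>a, c\<close> and on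
  \<open>b, c\<close>, with \<open>c'\<close> for \<open>c\<close> at \<open>s\<close>, gives three
  inequalities that force \<open>g = h = 0\<close>, so that \<open>y\<close> would lie in
  \<open>V\<close>.\<close>

lemma blow_up_rays:
  assumes s: "s \<in> P"
    and e: "\<And>m. m \<in> P \<Longrightarrow> m \<noteq> s \<Longrightarrow> E m a b \<and> E m b c \<and> E m a c"
    and es: "E s a b" "E s b c'" "E s a c'"
    and c: "c = c' + s" and sum: "a + b + c \<in> V"
  shows "Y \<subseteq> {a, b, c, c'}"
proof (rule ccontr)
  assume "\<not> Y \<subseteq> {a, b, c, c'}"
  then obtain y where y: "y \<in> Y" "y \<notin> {a, b, c, c'}" by auto
  have eab: "E m a b" if "m \<in> P" for m using e[OF that] es by (cases "m = s") auto
  obtain p q \<eta> where pq: "y = real_of_int p *\<^sub>R a + real_of_int q *\<^sub>R b + \<eta>" "\<eta> \<in> V"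
    using E_decompose[OF s es(1)] y Y_N by (metis subsetD)
  define g h where "g = real_of_int (- p)" and "h = real_of_int (- q)"
  have eta: "\<eta> = y + g *\<^sub>R a + h *\<^sub>R b" by (simp add: pq(1) g_def h_def)
  have cardP: "real (card P) = real d - 1" using card_P d_ge by simp
  have 1: "g + h \<ge> 0"
  proof -
    have "hgt (st m a b) \<eta> \<le> g + h" if "m \<in> P" for m
    proof -
      note B = E_D(4)[OF eab[OF that]]
      have "hgt (st m a b) y \<le> 0" using y Y_G Y_P by (intro hgt_nonpos[OF B]) auto
      then show ?thesis unfolding eta by (simp add: hgt_simps[OF B] hgt_base[OF B])
    qed
    then have "(\<Sum>m\<in>P. hgt (st m a b) \<eta>) \<le> (\<Sum>m\<in>P. g + h)" by (intro sum_mono)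
    moreover have "(\<Sum>m\<in>P. hgt (st m a b) \<eta>) = 0"
      using E_D(4)[OF eab] by (intro sum_hgt_V[OF pq(2)]) auto
    ultimately have "0 \<le> real (card P) * (g + h)" by simp
    then show ?thesis using cardP d_ge by (simp add: zero_le_mult_iff)
  qed
  \<comment> \<open>Stated for arbitrary \<open>a\<close>, \<open>b\<close>, \<open>g\<close>,
    \<open>h\<close>, because it is used a second time with the roles exchanged.\<close>
  have key: "0 \<le> (real d - 1) * g - real d * h"
    if e': "\<And>m. m \<in> P \<Longrightarrow> m \<noteq> s \<Longrightarrow> E m a c" and es': "E s a c'" and sum': "a + b + c \<in> V"
      and eta': "\<eta> = y + g *\<^sub>R a + h *\<^sub>R b" and y': "y \<notin> {a, c, c'}" for a b g h
  proof -
    define B where "B m = (if m = s then st s a c' else st m a c)" for m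
    have B: "B m \<in> Mx" "P - {m} \<subseteq> B m" if "m \<in> P" for m
      using e'[OF that] es' by (auto simp: B_def dest: E_D(4))
    define \<kappa> where "\<kappa> = a + b + c"
    have kV: "\<kappa> \<in> V" using sum' by (simp add: \<kappa>_def)
    have hb: "hgt (B m) b = hgt (B m) \<kappa> - (if m = s then 4 - real d else 2)" if m: "m \<in> P" for m
    proof (cases "m = s")
      case True
      have b: "b = \<kappa> - a - c' - s" unfolding \<kappa>_def c by simp
      have "a \<in> B s" "c' \<in> B s" by (auto simp: B_def)
      then have "hgt (B s) a = 1" "hgt (B s) c' = 1" "hgt (B s) s = 2 - real d"
        using hgt_base[OF B(1)[OF s]] hgt_omitted[OF s B[OF s]] by auto
      then show ?thesis unfolding True by (subst b) (simp add: hgt_simps[OF B(1)[OF s]])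
    next
      case False
      have b: "b = \<kappa> - a - c" unfolding \<kappa>_def by simp
      have "a \<in> B m" "c \<in> B m" using False by (auto simp: B_def)
      then have "hgt (B m) a = 1" "hgt (B m) c = 1" using hgt_base[OF B(1)[OF m]] by auto
      then show ?thesis using False by (subst b) (simp add: hgt_simps[OF B(1)[OF m]])
    qed
    have "hgt (B m) \<eta> \<le> g + h * hgt (B m) b" if m: "m \<in> P" for m
    proof -
      have "y \<notin> B m" using y' y(1) Y_P by (auto simp: B_def)
      then have "hgt (B m) y \<le> 0" using y Y_G by (intro hgt_nonpos[OF B(1)[OF m]]) auto
      moreover have "hgt (B m) a = 1" using hgt_base[OF B(1)[OF m], of a] by (auto simp: B_def)
      ultimately show ?thesis unfolding eta' by (simp add: hgt_simps[OF B(1)[OF m]])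
    qed
    then have "(\<Sum>m\<in>P. hgt (B m) \<eta>) \<le> (\<Sum>m\<in>P. g + h * hgt (B m) b)" by (intro sum_mono)
    moreover have "(\<Sum>m\<in>P. hgt (B m) \<eta>) = 0" using B by (intro sum_hgt_V[OF pq(2)]) auto
    \<comment> \<open>The part of \<open>\<kappa>\<close> sums to 0. What is left is -2 for each of
      the d - 2 ordinary stars and d - 4 for \<open>s\<close>, whose omitted element has height 2 -
      d.\<close>
    moreover have "(\<Sum>m\<in>P. hgt (B m) b) = - real d"
    proof -
      have "(\<Sum>m\<in>P. hgt (B m) b) = (\<Sum>m\<in>P. hgt (B m) \<kappa>) - (\<Sum>m\<in>P. 2 + (if m = s then 2 - real d else 0))"
        unfolding sum_subtractf[symmetric] by (intro sum.cong refl) (simp add: hb)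
      also have "(\<Sum>m\<in>P. hgt (B m) \<kappa>) = 0" using B by (intro sum_hgt_V[OF kV]) auto
      also have "(\<Sum>m\<in>P. 2 + (if m = s then 2 - real d else 0)) = 2 * (real d - 1) + (2 - real d)"
        unfolding sum.distrib using s finite_P cardP by simp
      finally show ?thesis by simp
    qed
    ultimately show ?thesis using cardP by (simp add: sum.distrib sum_distrib_left[symmetric] mult.commute)
  qed
  have 2: "0 \<le> (real d - 1) * g - real d * h"
    using e es(3) sum eta y(2) by (intro key) auto
  have 3: "0 \<le> (real d - 1) * h - real d * g"
    using e es(2) sum eta y(2) by (intro key[of b a]) (auto simp: algebra_simps)
  have "g + h = 0" using 1 2 3 by (simp add: algebra_simps)
  then have h: "h = - g" by simp
  have "0 \<le> (2 * real d - 1) * g" "0 \<le> (2 * real d - 1) * - g" using 2 3 unfolding h by (auto simp: algebra_simps)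
  then have "g = 0" using d_ge by (simp add: zero_le_mult_iff mult_le_0_iff)
  then have "y = \<eta>" using h by (simp add: eta)
  then show False using pq(2) y(1) Y_not_V1 by auto
qed

lemma nonface_pair:
  assumes "x \<in> G" "y \<in> G" "\<not> face {x, y}"
  obtains e where "e \<in> G" "x + y = e"
proof -
  have G: "set_mset {#x, y#} \<subseteq> G" "\<not> face (set_mset {#x, y#})" using assms by auto
  then obtain M' where M': "face (set_mset M')" "sum_mset M' = sum_mset {#x, y#}" "size M' < size {#x, y#}"
    using nonface_shorten by blast
  have "M' \<noteq> {#}"
  proof
    assume "M' = {#}"
    then have "zero_sum {#x, y#}" using M' G by (auto simp: zero_sum_def)
    then show False using zero_sum_size_ge_4 by fastforce
  qed
  then have "size M' = 1" using M'(3) by (cases "size M'") auto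
  then obtain e where "M' = {#e#}" using size_1_singleton_mset by blast
  then have "e \<in> G" "x + y = e" using M'(2) face_subset_G[OF M'(1)] by auto
  then show ?thesis by (rule that)
qed

section \<open>Excluding the other ways in which a triangle may deviate\<close>

lemma size_mset_P_diff: "S \<subseteq> P \<Longrightarrow> size (mset_set (P - S)) = d - 1 - card S"
  using finite_P card_P by (simp add: card_Diff_subset finite_subset)

lemma sum_P_diff: "S \<subseteq> P \<Longrightarrow> \<Sum>(P - S) = - \<Sum>S"
  using sum_diff[OF finite_P, of S "\<lambda>x. x"] sum_P by simp

text \<open>Since \<open>\<Sum>P = 0\<close>, equality would express the single generator
  \<open>x'\<close> as \<open>x + p\<close> plus the sum of \<open>P - {s, t}\<close>. That is a sum
  over a face, and such sums are shortest.\<close>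

lemma not_far:
  assumes "s \<in> P" "t \<in> P" "s \<noteq> t" "face (insert x (P - {t}))" "x' \<in> G" "p \<in> P" "p \<noteq> t"
  shows "x' + s + t \<noteq> x + p"
proof
  assume *: "x' + s + t = x + p"
  let ?M = "{#x, p#} + mset_set (P - {s, t})"
  have "sum_mset ?M = x + p - (s + t)" using assms sum_P_diff[of "{s, t}"] by (simp add: sum_mset_set)
  also have "\<dots> = x'" using * by (simp add: algebra_simps)
  finally have "sum_mset {#x'#} = sum_mset ?M" by simp
  moreover have "face (set_mset ?M)" using assms finite_P by (intro face_mono[OF assms(4)]) auto
  moreover have "set_mset {#x'#} \<subseteq> G" using assms by simp
  ultimately have "size ?M < size {#x'#} \<or> {#x'#} = ?M" by (intro face_shortest)
  then have "size ?M \<le> 1" by (auto dest: arg_cong[of _ _ size])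
  then show False by simp
qed

text \<open>Consider \<open>c\<close> together with \<open>P - {s, t}\<close>, with sum
  \<open>c - s - t\<close>. If this is a face, \<open>c' + d'\<close>, which is \<open>c\<close>
  plus that sum, is too short. If not, it shortens, and adding \<open>a\<close> and \<open>b\<close>
  gives a vanishing sum of length at most d - 1 other than \<open>P\<close>.\<close>

lemma two_blow_ups:
  assumes st: "s \<in> P" "t \<in> P" "s \<noteq> t" and Y: "a \<in> Y" "b \<in> Y" "c \<in> Y" "c' \<in> Y" "d' \<in> Y"
    and c: "c = c' + s" "c = d' + t" and sum: "a + b + c = s + t"
  shows False
proof -
  let ?M = "add_mset c (mset_set (P - {s, t}))"
  have sM: "sum_mset ?M = c - s - t" using st sum_P_diff[of "{s, t}"] by (simp add: sum_mset_set)
  have size: "size ?M = d - 2" using st size_mset_P_diff[of "{s, t}"] d_ge by simp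
  show False
  proof (cases "face (set_mset ?M)")
    case True
    have "sum_mset {#c', d'#} = c + (c - s - t)" using c by (simp add: algebra_simps)
    then have "sum_mset {#c', d'#} = sum_mset (add_mset c ?M)" using sM by simp
    moreover have "face (set_mset (add_mset c ?M))" using True by simp
    moreover have "set_mset {#c', d'#} \<subseteq> G" using Y Y_G by auto
    ultimately have "size (add_mset c ?M) < size {#c', d'#} \<or> {#c', d'#} = add_mset c ?M"
      by (intro face_shortest)
    then have "size (add_mset c ?M) \<le> 2" by (metis One_nat_def Suc_1 less_imp_le_nat order_refl size_add_mset size_single)
    then show False using size d_ge by simp
  next
    case False
    have "set_mset ?M \<subseteq> G" using Y Y_G P_G finite_P by auto
    then obtain M' where M': "face (set_mset M')" "sum_mset M' = sum_mset ?M" "size M' < size ?M"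
      using nonface_shorten False by blast
    have "sum_mset M' = c - s - t" using M'(2) sM by simp
    then have "sum_mset ({#a, b#} + M') = a + b + c - s - t" by (simp add: algebra_simps)
    then have "sum_mset ({#a, b#} + M') = 0" unfolding sum by simp
    then have "zero_sum ({#a, b#} + M')" using Y Y_G face_subset_G[OF M'(1)] by (auto simp: zero_sum_def)
    moreover have "size ({#a, b#} + M') \<le> d - 1" using M'(3) size d_ge by simp
    ultimately have "{#a, b#} + M' = mset_set P" by (rule zero_sum_size(2))
    then have "a \<in># mset_set P" by (metis union_iff insert_noteq_member union_single_eq_member)
    then show False using Y Y_P finite_P by simp
  qed
qed

text \<open>Here \<open>c' + s + t = c + p\<close>, the shape of a flip. The height of
  \<open>\<eta>\<close> is at most \<open>g\<close> in ordinary stars and at most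
  \<open>g - h\<close> at \<open>s\<close> and \<open>t\<close>. Their sum 0 forces
  \<open>g \<ge> 1\<close>; the value 1 is excluded through the normal form of
  \<open>\<eta>\<close>.\<close>

lemma no_flip_ray:
  assumes st: "s \<in> P" "t \<in> P" "s \<noteq> t" and p: "p \<in> P" "p \<noteq> s" "p \<noteq> t"
    and e: "\<And>m. m \<in> P \<Longrightarrow> m \<notin> {s, t} \<Longrightarrow> E m a b \<and> E m a c \<and> E m b c"
    and es: "\<And>m. m \<in> {s, t} \<Longrightarrow> E m a b \<and> E m a c' \<and> E m b c'"
    and sum: "a + b + c = s + t" "a + b + c' = p"
    and y: "y \<in> Y" "y \<notin> {a, b, c, c'}" "y + real_of_int g *\<^sub>R a + real_of_int h *\<^sub>R b = \<eta>" "\<eta> \<in> V" "g \<le> h"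
  shows "g \<ge> 2"
proof -
  define B where "B m = (if m \<in> {s, t} then st m a c' else st m a c)" for m
  have B: "B m \<in> Mx" "P - {m} \<subseteq> B m" if "m \<in> P" for m
    using e[OF that] es[of m] E_D(4) by (auto simp: B_def)
  have yB: "hgt (B m) y \<le> 0" and aB: "hgt (B m) a = 1" if "m \<in> P" for m
  proof -
    show "hgt (B m) y \<le> 0" using y Y_G Y_P by (intro hgt_nonpos[OF B(1)[OF that]]) (auto simp: B_def)
    show "hgt (B m) a = 1" by (intro hgt_base[OF B(1)[OF that]]) (auto simp: B_def)
  qed
  have 1: "hgt (B m) \<eta> \<le> g" if m: "m \<in> P" "m \<notin> {s, t}" for m
  proof -
    have "hgt (B m) (a + b + c) = 2"
    proof -
      have "s \<in> B m" "t \<in> B m" using m st B(2)[OF m(1)] by auto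
      then show ?thesis unfolding sum by (simp add: hgt_simps[OF B(1)[OF m(1)]] hgt_base[OF B(1)[OF m(1)]])
    qed
    moreover have "hgt (B m) c = 1" using m by (intro hgt_base[OF B(1)[OF m(1)]]) (auto simp: B_def)
    ultimately have "hgt (B m) b = 0" using aB[OF m(1)] by (simp add: hgt_simps[OF B(1)[OF m(1)]])
    then show ?thesis using yB[OF m(1)] aB[OF m(1)] unfolding y(3)[symmetric] by (simp add: hgt_simps[OF B(1)[OF m(1)]])
  qed
  have 2: "hgt (B m) \<eta> \<le> g - h" if m: "m \<in> {s, t}" for m
  proof -
    have mP: "m \<in> P" using m st by auto
    have "hgt (B m) (a + b + c') = 1"
      using m p B(2)[OF mP] unfolding sum by (intro hgt_base[OF B(1)[OF mP]]) auto
    moreover have "hgt (B m) c' = 1" using m by (intro hgt_base[OF B(1)[OF mP]]) (auto simp: B_def)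
    ultimately have "hgt (B m) b = - 1" using aB[OF mP] by (simp add: hgt_simps[OF B(1)[OF mP]])
    then show ?thesis using yB[OF mP] aB[OF mP] unfolding y(3)[symmetric] by (simp add: hgt_simps[OF B(1)[OF mP]])
  qed
  have g1: "g \<ge> 1"
  proof (rule ccontr)
    assume "\<not> g \<ge> 1"
    have "0 = (\<Sum>m\<in>P. hgt (B m) \<eta>)" using B by (intro sum_hgt_V[OF y(4), symmetric]) auto
    also have "\<dots> \<le> (\<Sum>m\<in>P. if m \<in> {s, t} then real_of_int (g - h) else g)"
      using 1 2 by (intro sum_mono) auto
    also have "\<dots> = (\<Sum>m\<in>P \<inter> {s, t}. real_of_int (g - h)) + (\<Sum>m\<in>P - {s, t}. real_of_int g)"
      using finite_P by (simp add: sum.If_cases Diff_eq Int_def)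
    also have "P \<inter> {s, t} = {s, t}" using st by auto
    finally have *: "0 \<le> 2 * real_of_int (g - h) + real (card (P - {s, t})) * g" using st by simp
    have c3: "card (P - {s, t}) \<ge> 1" using st card_P d_ge finite_P by (simp add: card_Diff_subset)
    have "real (card (P - {s, t})) * g \<le> 1 * real_of_int g"
      using c3 \<open>\<not> g \<ge> 1\<close> by (intro mult_right_mono_neg) auto
    then have "0 \<le> 2 * (g - h) + g" using * by linarith
    then have "g = 0 \<and> h = 0" using \<open>\<not> g \<ge> 1\<close> y(5) by presburger
    then have "y \<in> V" using y(3,4) by simp
    then show False using y(1) Y_not_V1 by auto
  qed
  have "g \<noteq> 1"
  proof
    assume "g = 1"
    obtain K where K: "set_mset K \<subset> P" "face (set_mset K)" "sum_mset K = \<eta>" using V_normal[OF y(4)] by blast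
    have hK: "hgt (B m) \<eta> = real (size K) - (real d - 1) * count K m" if "m \<in> P" for m
      using hgt_mset_P[OF that B[OF that], of K] K by auto
    obtain m where m: "m \<in> P" "m \<notin># K" using K(1) by auto
    \<comment> \<open>In a star whose omitted element is outside \<open>K\<close>, the height of
      \<open>\<eta>\<close> is the length of \<open>K\<close>. Length 0 gives the vanishing sum
      \<open>y + a + b\<close>; length 1 would need both \<open>s\<close> and \<open>t\<close> in
      \<open>K\<close>.\<close>
    have "real (size K) \<le> 1"
    proof (cases "m \<in> {s, t}")
      case True
      then show ?thesis using 2[of m] hK[OF m(1)] m(2) \<open>g = 1\<close> y(5) by (simp add: not_in_iff)
    next
      case False
      then show ?thesis using 1[of m] hK[OF m(1)] m \<open>g = 1\<close> by (simp add: not_in_iff)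
    qed
    then consider "size K = 0" | "size K = 1" by linarith
    then show False
    proof cases
      case 1
      then have "\<eta> = 0" using K by simp
      then have "h = 1" using 2[of s] hK[OF st(1)] 1 \<open>g = 1\<close> y(5) by auto
      then have "zero_sum {#y, a, b#}"
        using y(1,3) \<open>\<eta> = 0\<close> \<open>g = 1\<close> Y_G es[of s] E_D by (auto simp: zero_sum_def add.assoc)
      then show False using zero_sum_size_ge_4 by fastforce
    next
      case 2
      then obtain x where x: "K = {#x#}" using size_1_singleton_mset by blast
      have "m \<in># K" if m: "m \<in> {s, t}" for m
      proof (rule ccontr)
        assume "m \<notin># K"
        moreover have "m \<in> P" using m st by auto
        ultimately have "hgt (B m) \<eta> = 1" using hK[of m] 2 by (simp add: not_in_iff)
        then show False using \<open>\<And>m. m \<in> {s, t} \<Longrightarrow> hgt (B m) \<eta> \<le> g - h\<close>[OF m] \<open>g = 1\<close> y(5) by simp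
      qed
      then show False using x st by auto
    qed
  qed
  then show ?thesis using g1 by linarith
qed

lemma sum_mset_int_nonneg: "(\<forall>x. x \<in># M \<longrightarrow> f x \<ge> 0) \<Longrightarrow> (\<Sum>x\<in>#M. f x) \<ge> (0::int)"
  by (induction M) auto

lemma sum_mset_int_uminus: "(\<Sum>x\<in>#M. - f x) = - (\<Sum>x\<in>#M. f x :: int)"
  by (induction M) auto

lemma sum_mset_int_0:
  "(\<forall>x. x \<in># M \<longrightarrow> f x \<ge> 0) \<Longrightarrow> (\<Sum>x\<in>#M. f x) = (0::int) \<Longrightarrow> \<forall>x. x \<in># M \<longrightarrow> f x = 0"
proof (induction M)
  case (add u M)
  have "(\<Sum>x\<in>#M. f x) \<ge> 0" using add.prems(1) by (intro sum_mset_int_nonneg) auto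
  moreover have "f u \<ge> 0" using add.prems(1) by simp
  ultimately have "f u = 0" "(\<Sum>x\<in>#M. f x) = 0" using add.prems(2) by auto
  moreover have "\<forall>x. x \<in># M \<longrightarrow> f x \<ge> 0" using add.prems(1) by simp
  ultimately have "\<forall>x. x \<in># M \<longrightarrow> f x = 0" using add.IH by blast
  then show ?case using \<open>f u = 0\<close> by simp
qed simp

lemma sum_mset_int_1:
  fixes f :: "'b \<Rightarrow> int"
  assumes "\<forall>x. x \<in># M \<longrightarrow> f x \<ge> 0" "(\<Sum>x\<in>#M. f x) = 1"
  obtains x M1 where "M = add_mset x M1" "f x = 1" "\<And>z. z \<in># M1 \<Longrightarrow> f z = 0"
proof -
  obtain x where x: "x \<in># M" "f x \<noteq> 0"
  proof (rule ccontr)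
    assume "\<not> thesis"
    then have "\<forall>x. x \<in># M \<longrightarrow> f x = 0" using that by blast
    then have "(\<Sum>x\<in>#M. f x) = 0" by (induction M) auto
    then show False using assms by simp
  qed
  then obtain M1 where M1: "M = add_mset x M1" by (metis insert_DiffM)
  have nn: "\<forall>x. x \<in># M1 \<longrightarrow> f x \<ge> 0" "f x \<ge> 1" using assms(1) M1 x(2) by (auto simp: order_less_le)
  then have "(\<Sum>x\<in>#M1. f x) \<ge> 0" by (intro sum_mset_int_nonneg)
  then have "f x = 1" "(\<Sum>x\<in>#M1. f x) = 0" using nn assms(2) M1 by auto
  then show ?thesis using that[of x M1] M1 sum_mset_int_0[OF nn(1)] by auto
qed

text \<open>The contradiction comes from the face expression of \<open>c - s\<close>. Coordinates
  modulo \<open>V\<close> show that it consists of one of \<open>c\<close>, \<open>c'\<close> and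
  elements of \<open>P\<close>, and either choice makes a forbidden set a face.\<close>

lemma no_flip:
  assumes st: "s \<in> P" "t \<in> P" "s \<noteq> t" and p: "p \<in> P" "p \<noteq> s" "p \<noteq> t"
    and e: "\<And>m. m \<in> P \<Longrightarrow> m \<notin> {s, t} \<Longrightarrow> E m a b \<and> E m a c \<and> E m b c"
    and es: "\<And>m. m \<in> {s, t} \<Longrightarrow> E m a b \<and> E m a c' \<and> E m b c'"
    and sum: "a + b + c = s + t" "a + b + c' = p"
  shows False
proof -
  have Y: "a \<in> Y" "b \<in> Y" "c' \<in> Y" using es[of s] E_D by auto
  obtain m where m: "m \<in> P" "m \<notin> {s, t, p}" by (rule pick_P3)
  have em: "E m a b" "E m a c" "E m b c" using e[of m] m by auto
  have cY: "c \<in> Y" using E_D em by auto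
  have ne: "a \<noteq> b" "a \<noteq> c" "b \<noteq> c" "a \<noteq> c'" "b \<noteq> c'" using E_D(3) em es[of s] by blast+
  have "\<forall>x\<in>N. \<exists>g h \<xi>. x = real_of_int (- g) *\<^sub>R a + real_of_int (- h) *\<^sub>R b + \<xi> \<and> \<xi> \<in> V"
    using E_decompose[OF m(1) em(1)] by (metis minus_minus)
  \<comment> \<open>The signs are chosen so that \<open>c\<close> and \<open>c'\<close> have
    coordinates (1, 1); by \<open>no_flip_ray\<close> unknown generators have both at least
    2.\<close>
  then obtain g h \<xi> where gh: "\<And>x. x \<in> N \<Longrightarrow> x = real_of_int (- g x) *\<^sub>R a + real_of_int (- h x) *\<^sub>R b + \<xi> x \<and> \<xi> x \<in> V"
    by metis
  have g_eq: "g x = k" "h x = l" if "x \<in> N" "x = real_of_int (- k) *\<^sub>R a + real_of_int (- l) *\<^sub>R b + \<zeta>" "\<zeta> \<in> V" for x k l \<zeta>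
    using E_coords[OF m(1) em(1), of "\<xi> x" \<zeta> "- g x" "- h x" "- k" "- l"] gh[OF that(1)] that by auto
  have YN: "y \<in> N" if "y \<in> Y" for y using that Y_N by auto
  have PN: "y \<in> N" if "y \<in> P" for y using that P_N by auto
  have ga: "g a = - 1" "h a = 0" using g_eq[OF YN[OF Y(1)] _ V_0, of "- 1" 0] by auto
  have gb: "g b = 0" "h b = - 1" using g_eq[OF YN[OF Y(2)] _ V_0, of 0 "- 1"] by auto
  have gP: "g x = 0" "h x = 0" if "x \<in> P" for x using g_eq[OF PN[OF that] _ P_V[OF that], of 0 0] by auto
  have gc: "g c = 1" "h c = 1"
  proof -
    have "c = real_of_int (- 1) *\<^sub>R a + real_of_int (- 1) *\<^sub>R b + (s + t)" unfolding sum(1)[symmetric] by simp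
    from g_eq[OF YN[OF cY] this] show "g c = 1" "h c = 1" using st P_V V_add by auto
  qed
  have gc': "g c' = 1" "h c' = 1"
  proof -
    have "c' = real_of_int (- 1) *\<^sub>R a + real_of_int (- 1) *\<^sub>R b + p" unfolding sum(2)[symmetric] by simp
    from g_eq[OF YN[OF Y(3)] this] show "g c' = 1" "h c' = 1" using p P_V by auto
  qed
  have other: "g y \<ge> 2 \<and> h y \<ge> 2" if y: "y \<in> Y" "y \<notin> {a, b, c, c'}" for y
  proof -
    have yV: "y + real_of_int (g y) *\<^sub>R a + real_of_int (h y) *\<^sub>R b = \<xi> y" "\<xi> y \<in> V"
    proof -
      have "y = real_of_int (- g y) *\<^sub>R a + real_of_int (- h y) *\<^sub>R b + \<xi> y" using gh[OF YN[OF y(1)]] by blast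
      then have "\<xi> y = y - (real_of_int (- g y) *\<^sub>R a + real_of_int (- h y) *\<^sub>R b)" by (metis add_diff_cancel_left')
      then show "y + real_of_int (g y) *\<^sub>R a + real_of_int (h y) *\<^sub>R b = \<xi> y" by simp
      show "\<xi> y \<in> V" using gh[OF YN[OF y(1)]] by blast
    qed
    have yV': "y + real_of_int (h y) *\<^sub>R b + real_of_int (g y) *\<^sub>R a = \<xi> y" using yV(1) by (simp add: algebra_simps)
    have e': "\<And>m. m \<in> P \<Longrightarrow> m \<notin> {s, t} \<Longrightarrow> E m b a \<and> E m b c \<and> E m a c"
      and es': "\<And>m. m \<in> {s, t} \<Longrightarrow> E m b a \<and> E m b c' \<and> E m a c'" using e es E_sym by blast+
    have sum': "b + a + c = s + t" "b + a + c' = p" using sum by (simp_all add: add.commute)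
    have y': "y \<notin> {b, a, c, c'}" using y by auto
    show ?thesis
    proof (cases "g y \<le> h y")
      case True
      then show ?thesis using no_flip_ray[OF st p e es sum y yV True] by auto
    next
      case False
      then have "h y \<le> g y" by simp
      then show ?thesis using no_flip_ray[OF st p e' es' sum' y(1) y' yV' yV(2)] by auto
    qed
  qed
  have xG: "x \<in> P \<or> x = a \<or> x = b \<or> x \<in> {c, c'} \<or> (x \<in> Y \<and> g x \<ge> 2 \<and> h x \<ge> 2)" if "x \<in> G" for x
    using other[of x] that by (auto simp: Y_def)
  have add: "g (x + y) = g x + g y" "h (x + y) = h x + h y" if xy: "x \<in> N" "y \<in> N" for x y
  proof -
    have x: "x = real_of_int (- g x) *\<^sub>R a + real_of_int (- h x) *\<^sub>R b + \<xi> x" "\<xi> x \<in> V"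
      and y: "y = real_of_int (- g y) *\<^sub>R a + real_of_int (- h y) *\<^sub>R b + \<xi> y" "\<xi> y \<in> V" using gh xy by blast+
    have "x + y = (real_of_int (- g x) *\<^sub>R a + real_of_int (- h x) *\<^sub>R b + \<xi> x) + (real_of_int (- g y) *\<^sub>R a + real_of_int (- h y) *\<^sub>R b + \<xi> y)"
      using x(1) y(1) by metis
    also have "\<dots> = real_of_int (- (g x + g y)) *\<^sub>R a + real_of_int (- (h x + h y)) *\<^sub>R b + (\<xi> x + \<xi> y)"
      by (simp add: algebra_simps)
    finally show "g (x + y) = g x + g y" "h (x + y) = h x + h y"
      using g_eq[OF N_add[OF xy]] V_add[OF x(2) y(2)] by blast+
  qed
  have g0: "g 0 = 0" "h 0 = 0" using g_eq[OF N_0 _ V_0, of 0 0] by auto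
  have gsum: "g (sum_mset M) = (\<Sum>x\<in>#M. g x) \<and> h (sum_mset M) = (\<Sum>x\<in>#M. h x)" if "set_mset M \<subseteq> N" for M
    using that by (induction M) (auto simp: g0 add N_sum_mset)
  have csN: "c - s \<in> N" using YN[OF cY] PN[OF st(1)] N_diff by auto
  obtain M where M: "face (set_mset M)" "sum_mset M = c - s" using lattice_point_mset[OF csN] by blast
  have MG: "set_mset M \<subseteq> G" "set_mset M \<subseteq> N" using face_subset_G[OF M(1)] G_subset_N by auto
  have "g (c - s) = 1" "h (c - s) = 1"
    using add[OF csN PN[OF st(1)]] gP[OF st(1)] gc by auto
  then have sums: "(\<Sum>x\<in>#M. g x) = 1" "(\<Sum>x\<in>#M. h x) = 1" using gsum[OF MG(2)] M(2) by auto
  have sig: "x \<in> P" if "x \<in> G" "g x = 0" "x \<noteq> b" for x using xG[OF that(1)] that gc gc' ga by auto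
  have sih: "x \<in> P" if "x \<in> G" "h x = 0" "x \<noteq> a" for x using xG[OF that(1)] that gc gc' gb by auto
  have one: "x \<in> {c, c'}" if "x \<in> G" "g x = 1 \<or> h x = 1" for x using xG[OF that(1)] that gP ga gb by auto
  have "\<exists>x M1. M = add_mset x M1 \<and> x \<in> {c, c'} \<and> set_mset M1 \<subseteq> P"
  proof -
    consider "a \<notin># M" | "b \<notin># M" | "a \<in># M" "b \<in># M" by blast
    then show ?thesis
    proof cases
      case 1
      \<comment> \<open>Without \<open>a\<close> all first coordinates are nonnegative with sum 1,
        so exactly one summand is \<open>c\<close> or \<open>c'\<close> and the rest are
        \<open>b\<close> or in \<open>P\<close>. The second coordinates then exclude
        \<open>b\<close>.\<close>
      have "g x \<ge> 0" if "x \<in># M" for x using xG[of x] that 1 MG gP gb gc gc' by force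
      then obtain x M1 where x: "M = add_mset x M1" "g x = 1" "\<And>z. z \<in># M1 \<Longrightarrow> g z = 0"
        using sum_mset_int_1[of M g] sums by metis
      have xc: "x \<in> {c, c'}" using one[of x] x MG by auto
      then have "(\<Sum>z\<in>#M1. h z) = 0" using sums(2) gc gc' x by auto
      then have S: "(\<Sum>z\<in>#M1. - h z) = 0" by (simp add: sum_mset_int_uminus)
      have zP: "z \<in> P \<or> z = b" if "z \<in># M1" for z
      proof -
        have "z \<in> G" "g z = 0" using x(1) x(3)[OF that] that MG by auto
        then show ?thesis using sig by blast
      qed
      then have "\<forall>z. z \<in># M1 \<longrightarrow> - h z \<ge> 0" using gP ga gb by force
      from sum_mset_int_0[OF this S] have z0: "\<forall>z. z \<in># M1 \<longrightarrow> - h z = 0" .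
      have "z \<in> P" if "z \<in># M1" for z
      proof (rule ccontr)
        assume "z \<notin> P"
        then have "z = b" using zP[OF that] by auto
        then show False using z0 that ga gb by auto
      qed
      then show ?thesis using x(1) xc by (intro exI[of _ x] exI[of _ M1]) auto
    next
      case 2
      have "h x \<ge> 0" if "x \<in># M" for x using xG[of x] that 2 MG gP ga gc gc' by force
      then obtain x M1 where x: "M = add_mset x M1" "h x = 1" "\<And>z. z \<in># M1 \<Longrightarrow> h z = 0"
        using sum_mset_int_1[of M h] sums by metis
      have xc: "x \<in> {c, c'}" using one[of x] x MG by auto
      then have "(\<Sum>z\<in>#M1. g z) = 0" using sums(1) gc gc' x by auto
      then have S: "(\<Sum>z\<in>#M1. - g z) = 0" by (simp add: sum_mset_int_uminus)
      have zP: "z \<in> P \<or> z = a" if "z \<in># M1" for z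
      proof -
        have "z \<in> G" "h z = 0" using x(1) x(3)[OF that] that MG by auto
        then show ?thesis using sih by blast
      qed
      then have "\<forall>z. z \<in># M1 \<longrightarrow> - g z \<ge> 0" using gP ga gb by force
      from sum_mset_int_0[OF this S] have z0: "\<forall>z. z \<in># M1 \<longrightarrow> - g z = 0" .
      have "z \<in> P" if "z \<in># M1" for z
      proof (rule ccontr)
        assume "z \<notin> P"
        then have "z = a" using zP[OF that] by auto
        then show False using z0 that ga gb by auto
      qed
      then show ?thesis using x(1) xc by (intro exI[of _ x] exI[of _ M1]) auto
    next
      case 3
      \<comment> \<open>Otherwise \<open>x\<close> with enough copies of \<open>a\<close> and
        \<open>b\<close> would be a face sum in \<open>V\<close>. So no first coordinate is
        positive, against the sum 1.\<close>
      have "x \<in> {a, b} \<union> P" if x: "x \<in># M" for x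
      proof (rule ccontr)
        assume *: "x \<notin> {a, b} \<union> P"
        have "g x \<ge> 1" "h x \<ge> 1" using xG[of x] * MG x gc gc' by force+
        let ?K = "add_mset x (replicate_mset (nat (g x)) a + replicate_mset (nat (h x)) b)"
        have rep: "sum_mset (replicate_mset n z) = real n *\<^sub>R z" for n and z :: 'a
          by (induction n) (simp_all add: scaleR_left_distrib)
        have xx: "x = real_of_int (- g x) *\<^sub>R a + real_of_int (- h x) *\<^sub>R b + \<xi> x" "\<xi> x \<in> V" using gh x MG by blast+
        have "sum_mset ?K = x + real_of_int (g x) *\<^sub>R a + real_of_int (h x) *\<^sub>R b"
          using \<open>g x \<ge> 1\<close> \<open>h x \<ge> 1\<close> by (simp add: rep add.assoc)
        also have "\<dots> = \<xi> x" by (subst (1) xx(1)) simp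
        finally have "sum_mset ?K \<in> V" using xx(2) by simp
        moreover have "set_mset ?K \<subseteq> set_mset M" using x 3 by (auto split: if_splits)
        then have "face (set_mset ?K)" using face_mono[OF M(1)] by blast
        ultimately have "set_mset ?K \<subset> P" by (intro face_in_V)
        then show False using * by auto
      qed
      then have le: "g x \<le> 0" if "x \<in># M" for x using that gP ga gb by force
      have "(\<Sum>x\<in>#M. - g x) \<ge> 0" using le by (intro sum_mset_int_nonneg) auto
      then show ?thesis using sums by (simp add: sum_mset_int_uminus)
    qed
  qed
  then obtain x M1 where x: "M = add_mset x M1" "x \<in> {c, c'}" "set_mset M1 \<subseteq> P" by blast
  have fM1: "face (set_mset M1)" using face_mono[OF M(1)] x by auto
  have sumx: "x + sum_mset M1 = c - s" using M(2) x(1) by simp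
  have flip: "c' + s + t = c + p" using sum by (metis add.assoc add.commute add_left_cancel)
  have cp: "face {c, p}" using em(2) m p by (intro E_face[OF em(2)]) auto
  \<comment> \<open>With \<open>c\<close>, the rest sums to \<open>- s\<close> and is
    \<open>P - {s}\<close>, so \<open>not_far\<close> contradicts the flip relation. With
    \<open>c'\<close>, the rest sums to \<open>t - p\<close>, so \<open>c'\<close>,
    \<open>s\<close>, \<open>t\<close> span a face although \<open>c + p\<close> is shorter.\<close>
  show False
  proof (cases "x = c")
    case True
    then have "sum_mset M1 = - s" using sumx by (metis add_left_cancel diff_conv_add_uminus)
    also have "\<dots> = sum_mset (mset_set (P - {s}))" using sum_P_diff[of "{s}"] st by (simp add: sum_mset_set)
    finally have "M1 = mset_set (P - {s})"
      using face_unique[of "mset_set (P - {s})" M1] fM1 face_P_diff[OF st(1)] finite_P by simp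
    then have setM: "set_mset M = insert c (P - {s})" using x True finite_P by simp
    show False using not_far[of t s c c' p] st p M(1) Y(3) Y_G flip unfolding setM by (auto simp: add.commute add.left_commute)
  next
    case False
    then have xc': "x = c'" using x by auto
    have "c + p = c' + t + s" using flip by (simp add: algebra_simps)
    then have "c - s = c' + t - p" by (simp add: algebra_simps)
    then have "c' + sum_mset M1 = c' + (t - p)" using sumx xc' by (simp only: add_diff_eq)
    then have "sum_mset M1 = t - p" by (simp only: add_left_cancel)
    also have "\<dots> = sum_mset (add_mset t (mset_set (P - {p})))" using sum_P_diff[of "{p}"] p by (simp add: sum_mset_set)
    finally have eq: "sum_mset M1 = sum_mset (add_mset t (mset_set (P - {p})))" .
    have "set_mset (add_mset t (mset_set (P - {p}))) = P - {p}" using st p finite_P by auto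
    then have "M1 = add_mset t (mset_set (P - {p}))"
      using face_unique[OF _ fM1 eq] face_P_diff[OF p(1)] by simp
    then have "{c', s, t} \<subseteq> set_mset M" using x xc' st p finite_P by auto
    then have "face (set_mset {#c', s, t#})" using face_mono[OF M(1)] by simp
    then have "size {#c', s, t#} < size {#c, p#} \<or> {#c, p#} = {#c', s, t#}"
      using flip cY p P_G Y_G by (intro face_shortest) (auto simp: add.assoc)
    then show False by (auto dest: arg_cong[of _ _ size])
  qed
qed

section \<open>Without opposite generators every star is a triangle\<close>

text \<open>If \<open>- x\<close> were on the boundary of a cone, it would be a multiple of a
  generator \<open>g\<close> modulo \<open>V\<close>. Integrality makes the multiple 1, so
  \<open>x\<close> and \<open>g\<close> would be opposite.\<close>

lemma E_cover_positive:
  assumes m: "m \<in> P" and no: "\<And>y y'. y \<in> Y \<Longrightarrow> y' \<in> Y \<Longrightarrow> y + y' \<notin> V" and x: "E m x x'"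
  obtains g h p q \<zeta> where "E m g h" "- x = real_of_int p *\<^sub>R g + real_of_int q *\<^sub>R h + \<zeta>" "\<zeta> \<in> V" "p \<ge> 1" "q \<ge> 1"
proof -
  have xN: "x \<in> Y" "x \<in> N" using E_D[OF x] Y_N by auto
  have pos: "q \<noteq> 0" if gh: "E m g h" "- x = real_of_int p *\<^sub>R g + real_of_int q *\<^sub>R h + \<zeta>" "\<zeta> \<in> V" "p \<ge> 0" for g h p q \<zeta>
  proof
    assume "q = 0"
    then have xg: "- x = real_of_int p *\<^sub>R g + \<zeta>" using gh by simp
    have gY: "g \<in> Y" "g \<in> N" using E_D[OF gh(1)] Y_N by auto
    obtain r s \<xi> where g: "g = real_of_int r *\<^sub>R x + real_of_int s *\<^sub>R x' + \<xi>" "\<xi> \<in> V"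
      using E_decompose[OF m x gY(2)] by metis
    have "real_of_int (- 1) *\<^sub>R x + real_of_int 0 *\<^sub>R x' + 0 = - x" by simp
    also have "\<dots> = real_of_int (p * r) *\<^sub>R x + real_of_int (p * s) *\<^sub>R x' + (real_of_int p *\<^sub>R \<xi> + \<zeta>)"
      unfolding xg by (subst g(1)) (simp add: algebra_simps)
    finally have "- 1 = p * r" using E_coords(1)[OF m x V_0 V_add[OF V_int[OF g(2)] gh(3)]] by blast
    then have "p dvd 1" by (metis dvd_minus_iff dvd_triv_left)
    then have "p = 1" using gh(4) by simp
    then have "x + g = - \<zeta>" using xg by (simp add: algebra_simps) (metis add.commute add.inverse_inverse minus_add_distrib add_minus_cancel)
    then show False using no[OF xN(1) gY(1)] V_minus[OF gh(3)] by simp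
  qed
  obtain g h p q \<zeta> where gh: "E m g h" "- x = real_of_int p *\<^sub>R g + real_of_int q *\<^sub>R h + \<zeta>" "\<zeta> \<in> V" "p \<ge> 0" "q \<ge> 0"
    using E_cover[OF m N_minus[OF xN(2)]] by metis
  have "q \<noteq> 0" using pos[OF gh(1-4)] .
  moreover have "- x = real_of_int q *\<^sub>R h + real_of_int p *\<^sub>R g + \<zeta>" using gh(2) by (simp add: add.commute)
  then have "p \<noteq> 0" using pos[OF E_sym[OF gh(1)] _ gh(3) gh(5)] by blast
  ultimately show ?thesis using that[OF gh(1-3)] gh(4,5) by auto
qed

text \<open>A second cone \<open>g, h\<close> contains \<open>- c\<close> in its interior. Writing
  \<open>f\<close> and then \<open>r\<close> in the basis \<open>g, h\<close> shows that this cone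
  is spanned by \<open>f\<close> and \<open>r\<close>, and that both coefficients are 1. The larger
  coefficient must belong to \<open>c\<close> for the signs to work.\<close>

lemma triangle_step:
  assumes m: "m \<in> P" and no: "\<And>y y'. y \<in> Y \<Longrightarrow> y' \<in> Y \<Longrightarrow> y + y' \<notin> V"
    and e: "E m c f" "E m r r'"
    and r: "- r = real_of_int \<alpha> *\<^sub>R c + real_of_int \<beta> *\<^sub>R f + \<xi>" "\<xi> \<in> V" "1 \<le> \<beta>" "\<beta> \<le> \<alpha>"
  shows "\<alpha> = 1 \<and> \<beta> = 1 \<and> E m f r"
proof -
  obtain g h p q \<zeta> where gh: "E m g h" "- c = real_of_int p *\<^sub>R g + real_of_int q *\<^sub>R h + \<zeta>" "\<zeta> \<in> V" "p \<ge> 1" "q \<ge> 1"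
    using E_cover_positive[OF m no e(1)] by metis
  have c_eq: "c = real_of_int (- p) *\<^sub>R g + real_of_int (- q) *\<^sub>R h + (- \<zeta>)"
    using arg_cong[OF gh(2), of uminus] by simp
  have fN: "f \<in> N" using E_D[OF e(1)] Y_N by auto
  obtain f1 f2 \<xi>f where f: "f = real_of_int f1 *\<^sub>R g + real_of_int f2 *\<^sub>R h + \<xi>f" "\<xi>f \<in> V"
    using E_decompose[OF m gh(1) fN] by metis
  define r1 where "r1 = \<alpha> * p - \<beta> * f1"
  define r2 where "r2 = \<alpha> * q - \<beta> * f2"
  define \<rho> where "\<rho> = real_of_int \<alpha> *\<^sub>R \<zeta> - real_of_int \<beta> *\<^sub>R \<xi>f - \<xi>"
  have "r = - (real_of_int \<alpha> *\<^sub>R c + real_of_int \<beta> *\<^sub>R f + \<xi>)" using r(1) by (metis minus_minus)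
  then have r_eq: "r = real_of_int r1 *\<^sub>R g + real_of_int r2 *\<^sub>R h + \<rho>"
    by (subst (asm) c_eq, subst (asm) f(1)) (simp add: r1_def r2_def \<rho>_def algebra_simps)
  have rV: "\<rho> \<in> V" unfolding \<rho>_def using gh(3) f(2) r(2) by (intro V_diff V_int)
  have det: "\<bar>q * f1 - p * f2\<bar> = 1"
    using E_det[OF m gh(1) e(1) c_eq V_minus[OF gh(3)] f] by (simp add: algebra_simps)
  have r_cases: "(r = g \<and> r1 = 1 \<and> r2 = 0) \<or> (r = h \<and> r1 = 0 \<and> r2 = 1)" if "r1 \<ge> 0" "r2 \<ge> 0"
  proof -
    have "r \<in> {g, h}" using E_ray[OF m gh(1) e(2) r_eq rV that] .
    moreover have "r1 = 1 \<and> r2 = 0" if "r = g"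
    proof -
      have "real_of_int r1 *\<^sub>R g + real_of_int r2 *\<^sub>R h + \<rho> = real_of_int 1 *\<^sub>R g + real_of_int 0 *\<^sub>R h + 0"
        using r_eq that by simp
      from E_coords[OF m gh(1) rV V_0 this] show ?thesis by simp
    qed
    moreover have "r1 = 0 \<and> r2 = 1" if "r = h"
    proof -
      have "real_of_int r1 *\<^sub>R g + real_of_int r2 *\<^sub>R h + \<rho> = real_of_int 0 *\<^sub>R g + real_of_int 1 *\<^sub>R h + 0"
        using r_eq that by simp
      from E_coords[OF m gh(1) rV V_0 this] show ?thesis by simp
    qed
    ultimately show ?thesis by blast
  qed
  have ap: "\<beta> \<le> \<alpha> * p" "\<beta> \<le> \<alpha> * q" "1 \<le> \<alpha> * p" "1 \<le> \<alpha> * q"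
    using r(3,4) gh(4,5) by (smt (verit) mult_le_cancel_left1)+
  \<comment> \<open>Strictly opposite signs contradict the determinant. If neither is positive,
    \<open>r\<close> would project into the interior of the cone \<open>g, h\<close>, against
    \<open>E_ray\<close>. Otherwise \<open>f\<close> is one of \<open>g\<close>, \<open>h\<close>,
    and \<open>r\<close> is the other.\<close>
  consider "f1 > 0" "f2 < 0" | "f1 < 0" "f2 > 0" | "f1 \<le> 0" "f2 \<le> 0" | "f1 \<ge> 0" "f2 \<ge> 0" by linarith
  then show ?thesis
  proof cases
    case 1
    have "q * f1 \<ge> 1" "p * f2 \<le> - 1" using 1 gh(4,5) by (smt (verit) mult_le_cancel_left1 mult_le_cancel_left2 mult_minus_right)+
    then show ?thesis using det by linarith
  next
    case 2
    have "p * f2 \<ge> 1" "q * f1 \<le> - 1" using 2 gh(4,5) by (smt (verit) mult_le_cancel_left1 mult_le_cancel_left2 mult_minus_right)+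
    then show ?thesis using det by linarith
  next
    case 3
    have "\<beta> * f1 \<le> 0" "\<beta> * f2 \<le> 0" using 3 r(3) by (simp_all add: mult_le_0_iff)
    then have "r1 \<ge> 1" "r2 \<ge> 1" using ap by (auto simp: r1_def r2_def)
    then show ?thesis using r_cases by auto
  next
    case 4
    have "f \<in> {g, h}" using E_ray[OF m gh(1) E_sym[OF e(1)] f 4] .
    then show ?thesis
    proof
      assume "f = g"
      then have "real_of_int f1 *\<^sub>R g + real_of_int f2 *\<^sub>R h + \<xi>f = real_of_int 1 *\<^sub>R g + real_of_int 0 *\<^sub>R h + 0"
        using f(1) by simp
      from E_coords[OF m gh(1) f(2) V_0 this] have f12: "f1 = 1" "f2 = 0" by auto
      then have "r1 \<ge> 0" "r2 \<ge> 1" using ap by (auto simp: r1_def r2_def)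
      then have r: "r = h" "r1 = 0" "r2 = 1" using r_cases by auto
      have "\<alpha> * q = 1" using r(3) f12 by (simp add: r2_def)
      then have "\<alpha> = 1" using \<open>1 \<le> \<beta>\<close> \<open>\<beta> \<le> \<alpha>\<close> by (auto simp: zmult_eq_1_iff)
      then show ?thesis using gh(1) r(1) \<open>f = g\<close> \<open>1 \<le> \<beta>\<close> \<open>\<beta> \<le> \<alpha>\<close> by auto
    next
      assume "f \<in> {h}"
      then have fh: "f = h" by simp
      then have "real_of_int f1 *\<^sub>R g + real_of_int f2 *\<^sub>R h + \<xi>f = real_of_int 0 *\<^sub>R g + real_of_int 1 *\<^sub>R h + 0"
        using f(1) by simp
      from E_coords[OF m gh(1) f(2) V_0 this] have f12: "f1 = 0" "f2 = 1" by auto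
      then have "r1 \<ge> 1" "r2 \<ge> 0" using ap by (auto simp: r1_def r2_def)
      then have r: "r = g" "r1 = 1" "r2 = 0" using r_cases by auto
      have "\<alpha> * p = 1" using r(2) f12 by (simp add: r1_def)
      then have "\<alpha> = 1" using \<open>1 \<le> \<beta>\<close> \<open>\<beta> \<le> \<alpha>\<close> by (auto simp: zmult_eq_1_iff)
      then show ?thesis using E_sym[OF gh(1)] r(1) fh \<open>1 \<le> \<beta>\<close> \<open>\<beta> \<le> \<alpha>\<close> by auto
    qed
  qed
qed

lemma exists_tri:
  assumes m: "m \<in> P" and no: "\<And>y y'. y \<in> Y \<Longrightarrow> y' \<in> Y \<Longrightarrow> y + y' \<notin> V"
  obtains T K where "tri m T" "set_mset K \<subset> P" "K \<noteq> {#}" "size K \<le> 2" "sum_mset K = \<Sum>T"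
proof -
  obtain r r' where r: "E m r r'" using E_exists[OF m] by auto
  obtain c f \<alpha> \<beta> \<xi> where cf: "E m c f" "- r = real_of_int \<alpha> *\<^sub>R c + real_of_int \<beta> *\<^sub>R f + \<xi>" "\<xi> \<in> V" "\<alpha> \<ge> 1" "\<beta> \<ge> 1"
    using E_cover_positive[OF m no r] by metis
  have cf': "- r = real_of_int \<beta> *\<^sub>R f + real_of_int \<alpha> *\<^sub>R c + \<xi>" using cf(2) by (simp add: add.commute)
  \<comment> \<open>Two versions, so that one applies whichever of the coefficients is larger; once
    both are 1, both apply and give the two missing edges.\<close>
  note s1 = triangle_step[OF m no cf(1) r cf(2,3,5)] and s2 = triangle_step[OF m no E_sym[OF cf(1)] r cf' cf(3,4)]
  have ab: "\<alpha> = 1" "\<beta> = 1" using s1 s2 by linarith+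
  then have e: "E m f r" "E m c r" "E m c f" using s1 s2 cf(1) by auto
  have d: "c \<noteq> f" "c \<noteq> r" "f \<noteq> r" using e E_D(3) by blast+
  have Y: "c \<in> Y" "f \<in> Y" "r \<in> Y" using e E_D by blast+
  have "c + f + r = - \<xi>"
  proof -
    have "r = - (c + f + \<xi>)" using cf(2) ab by (metis minus_minus of_int_1 scaleR_one)
    then show ?thesis by simp
  qed
  then have V: "sum_mset {#c, f#} + real 1 *\<^sub>R r \<in> V" using V_minus[OF cf(3)] by (simp add: add.assoc)
  obtain K where K: "set_mset K \<subset> P" "K \<noteq> {#}" "size K \<le> 2" "sum_mset K = sum_mset {#c, f#} + real 1 *\<^sub>R r"
    using short_in_V[OF _ _ _ Y(3) V] Y Y_G by auto
  have "tri m {c, f, r}" using e d Y E_sym by (auto simp: tri_def)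
  moreover have "sum_mset K = \<Sum>{c, f, r}" using K(4) sum_three[of c f r] d by (simp add: add.assoc)
  ultimately show ?thesis using that K by blast
qed

section \<open>Comparing the triangles of different stars\<close>

text \<open>Measure \<open>\<Sum>T\<close> in the cone over the edge: as \<open>m\<close> is outside
  \<open>K\<close> the height is \<open>size K\<close>, while a vertex of \<open>T\<close>
  contributes at most 1, and nothing positive unless it is on the edge.\<close>

lemma tri_meets_edge:
  assumes l: "T \<subseteq> Y" "card T = 3" and K: "set_mset K \<subseteq> P" "sum_mset K = \<Sum>T"
    and m: "m \<in> P" "m \<notin># K" and e: "E m a b"
  shows "size K \<le> card (T \<inter> {a, b})"
proof -
  note B = E_D(4)[OF e]
  have fin: "finite T" using l(2) by (simp add: card_eq_0_iff[symmetric] card_ge_0_finite)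
  have "real (size K) = hgt (st m a b) (sum_mset K)"
  proof -
    have "P - {m} \<subseteq> st m a b" by auto
    from hgt_mset_P[OF m(1) B this K(1)] show ?thesis using m(2) by (simp add: not_in_iff)
  qed
  also have "\<dots> = (\<Sum>t\<in>T. hgt (st m a b) t)" unfolding K(2) by (simp add: hgt_simps[OF B])
  also have "\<dots> \<le> (\<Sum>t\<in>T. if t \<in> {a, b} then 1 else 0)"
  proof (intro sum_mono)
    fix t assume "t \<in> T"
    then have t: "t \<in> G" "t \<notin> P" using l(1) Y_G Y_P by auto
    show "hgt (st m a b) t \<le> (if t \<in> {a, b} then 1 else 0)"
      using t hgt_le_1[OF B t(1)] hgt_nonpos[OF B t(1)] by auto
  qed
  also have "\<dots> = card (T \<inter> {a, b})" using fin by (simp add: sum.If_cases Int_def)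
  finally show ?thesis by simp
qed

lemma card_3_exchange:
  assumes "card T = 3" "card L = 3" "card (T \<inter> L) \<ge> 2" "T \<noteq> L"
  obtains c c' where "c \<in> L" "c' \<notin> L" "T = insert c' (L - {c})"
proof -
  have fin: "finite T" "finite L" using assms by (auto intro: card_ge_0_finite)
  have "card (T \<inter> L) \<noteq> 3"
  proof
    assume "card (T \<inter> L) = 3"
    then have "T \<inter> L = T" "T \<inter> L = L"
      using card_subset_eq[of T "T \<inter> L"] card_subset_eq[of L "T \<inter> L"] assms fin by auto
    then show False using assms by auto
  qed
  moreover have "card (T \<inter> L) \<le> 3" using card_mono[OF fin(1), of "T \<inter> L"] assms by auto
  ultimately have i: "card (T \<inter> L) = 2" using assms by linarith
  have "card (L - T) = 1" "card (T - L) = 1"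
    using card_Diff_subset_Int[of L T] card_Diff_subset_Int[of T L] fin i assms by (simp_all add: Int_commute)
  then obtain c c' where "L - T = {c}" "T - L = {c'}" by (auto simp: card_1_singleton_iff)
  then have "c \<in> L" "c' \<notin> L" "T = insert c' (L - {c})" by blast+
  then show ?thesis by (rule that)
qed

text \<open>All stars outside \<open>s\<close>, \<open>t\<close> have triangle \<open>L\<close>, and
  the one at \<open>s\<close> exchanges a vertex \<open>c\<close> for \<open>c'\<close>. Only
  \<open>c = c' + s\<close> with no other star changed survives, the blow-up of
  \<open>blow_up_rays\<close>; all other cases contradict unique shortest expressions.\<close>

lemma defect_case:
  assumes st: "s \<in> P" "t \<in> P"
    and tri: "\<And>m. m \<in> P \<Longrightarrow> tri m (T m)"
    and L: "\<And>m. m \<in> P \<Longrightarrow> m \<notin> {s, t} \<Longrightarrow> T m = L"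
    and sumL: "\<Sum>L = s + t"
    and defect: "\<And>m. m \<in> {s, t} \<Longrightarrow> T m \<noteq> L \<Longrightarrow>
      \<exists>c c' p. c \<in> L \<and> c' \<in> Y \<and> c' \<notin> L \<and> p \<in> P \<and> T m = insert c' (L - {c}) \<and> c' + s + t = c + p"
    and s: "T s \<noteq> L"
  shows "card Y \<le> 4"
proof -
  obtain n where n: "n \<in> P" "n \<notin> {s, t, t}" by (rule pick_P3)
  then have Ln: "T n = L" "tri n L" using L[of n] tri[of n] by auto
  have LY: "L \<subseteq> Y" "card L = 3" "finite L" using Ln by (auto simp: tri_def intro: card_ge_0_finite)
  have fT: "face (insert x (P - {m}))" if mx: "m \<in> P" "x \<in> T m" for x m
  proof -
    have "card (T m) = 3" "\<forall>a\<in>T m. \<forall>b\<in>T m. a \<noteq> b \<longrightarrow> E m a b" using tri[OF mx(1)] by (auto simp: tri_def)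
    moreover obtain x' where "x' \<in> T m" "x' \<noteq> x"
      using \<open>card (T m) = 3\<close> by (metis card_3_iff insertI1 insert_commute)
    ultimately have "E m x x'" using mx(2) by auto
    then show ?thesis by (intro E_face[of m x x']) auto
  qed
  have pair: "x + q \<noteq> z" if "m \<in> P" "x \<in> T m" "q \<in> P" "q \<noteq> m" "z \<in> G" for x q z m
  proof
    assume *: "x + q = z"
    have "face (set_mset {#x, q#})" using that by (auto intro: face_mono[OF fT[OF that(1,2)]])
    then have "size {#x, q#} < size {#z#} \<or> {#z#} = {#x, q#}" using * that by (intro face_shortest) auto
    then show False by (auto dest: arg_cong[of _ _ size])
  qed
  have swap: "x = z \<and> q = r" if "m \<in> P" "x \<in> T m" "q \<in> P" "q \<noteq> m" "z \<in> Y" "r \<in> P" "x + q = z + r" for x q z r m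
  proof -
    have "face (set_mset {#x, q#})" using that by (auto intro: face_mono[OF fT[OF that(1,2)]])
    then have "size {#x, q#} < size {#z, r#} \<or> {#z, r#} = {#x, q#}"
      using that P_G Y_G by (intro face_shortest) auto
    then have "{#z, r#} = {#x, q#}" by auto
    moreover have "x \<in> Y" using that tri[OF that(1)] by (auto simp: tri_def)
    ultimately show ?thesis using that(3,5,6) Y_P by (auto simp: add_eq_conv_ex)
  qed
  obtain c c' p where c: "c \<in> L" "c' \<in> Y" "c' \<notin> L" "p \<in> P" "T s = insert c' (L - {c})" "c' + s + t = c + p"
    using defect[of s] s by auto
  have cY: "c \<in> Y" "c \<in> G" "c' \<in> G" using c LY Y_G by auto
  have c'T: "c' \<in> T s" using c by auto
  have "card (L - {c}) = 2" using c LY by simp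
  then obtain a b where ab: "L - {c} = {a, b}" "a \<noteq> b" by (auto simp: card_2_iff)
  have abc: "a \<noteq> c" "b \<noteq> c" "L = {a, b, c}" using ab c by auto
  have abY: "a \<in> Y" "b \<in> Y" using LY abc by auto
  have abc': "a \<noteq> c'" "b \<noteq> c'" using c abc by auto
  have sum: "a + b + c = s + t" using sumL sum_three[of a b c] ab abc by simp
  have edgesL: "E m a b \<and> E m b c \<and> E m a c" if "m \<in> P" "T m = L" for m
    using tri[OF that(1)] that ab abc by (auto simp: tri_def)
  have Ts: "T s = {a, b, c'}" using c ab by auto
  have edges': "E m a b \<and> E m b c' \<and> E m a c'" if "m \<in> P" "T m = {a, b, c'}" for m
    using tri[OF that(1)] that ab abc' by (auto simp: tri_def)
  have blow: ?thesis if cs: "c = c' + s" and LL: "\<And>m. m \<in> P \<Longrightarrow> m \<noteq> s \<Longrightarrow> T m = L"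
  proof -
    have "a + b + c \<in> V" unfolding sum using st P_V V_add by auto
    then have "Y \<subseteq> {a, b, c, c'}"
      using edgesL LL edges'[OF st(1) Ts] by (intro blow_up_rays[OF st(1) _ _ _ _ cs]) auto
    then have "card Y \<le> card {a, b, c, c'}" by (intro card_mono) auto
    also have "\<dots> \<le> 4" by (simp add: card_insert_if)
    finally show ?thesis .
  qed
  show ?thesis
  proof (cases "s = t")
    case True
    show ?thesis
    proof (cases "p = s")
      case p: True
      have "c = c' + s" using c(6) True p by simp
      then show ?thesis using L True by (intro blow) auto
    next
      case False
      \<comment> \<open>In an ordinary star \<open>c\<close> and \<open>p\<close> span a face, while
        \<open>c' + s + s\<close> would be equal to \<open>c + p\<close>. Either
        \<open>c', s\<close> is a face and the longer sum is shortest, or \<open>c' + s\<close> is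
        one generator and \<open>s\<close> must be \<open>c\<close> or \<open>p\<close>.\<close>
      obtain k where k: "k \<in> P" "k \<notin> {s, t, p}" by (rule pick_P3)
      have fc: "face (set_mset {#c, p#})"
        using k c L[of k] by (auto intro!: face_mono[OF fT[OF k(1), of c]])
      have "\<not> face {c', s}"
      proof
        assume "face {c', s}"
        then have "face (set_mset {#c', s, s#})" by simp
        then have "size {#c', s, s#} < size {#c, p#} \<or> {#c, p#} = {#c', s, s#}"
          using c(6) True cY c P_G by (intro face_shortest) (auto simp: add.assoc)
        then show False by (auto dest: arg_cong[of _ _ size])
      qed
      then obtain e where e: "e \<in> G" "c' + s = e" using nonface_pair[of c' s] cY st P_G by auto
      then have "sum_mset {#e, s#} = sum_mset {#c, p#}" using c(6) True by simp
      then have "size {#c, p#} < size {#e, s#} \<or> {#e, s#} = {#c, p#}"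
        using fc e st P_G by (intro face_shortest) auto
      then have "s \<in># {#c, p#}" by (metis nat_neq_iff size_add_mset size_single union_single_eq_member add_mset_commute)
      then show ?thesis using False cY st Y_P by auto
    qed
  next
    case st': False
    have p_s: "p \<noteq> s"
    proof
      assume "p = s"
      then have "c' + t = c" using c(6) by (simp add: algebra_simps)
      then show False using pair[OF st(1) c'T st(2)] st' cY by auto
    qed
    show ?thesis
    proof (cases "T t = L")
      case True
      show ?thesis
      proof (cases "p = t")
        case pt: True
        then have "c = c' + s" using c(6) by simp
        moreover have "T m = L" if "m \<in> P" "m \<noteq> s" for m using L[of m] True that by (cases "m = t") auto
        ultimately show ?thesis by (intro blow)
      next
        case False
        have "face (insert c (P - {t}))" using True c by (intro fT[OF st(2)]) auto
        then show ?thesis using not_far[OF st st' _ cY(3) c(4) False] c(6) by auto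
      qed
    next
      case False
      obtain f f' q where f: "f \<in> L" "f' \<in> Y" "f' \<notin> L" "q \<in> P" "T t = insert f' (L - {f})" "f' + s + t = f + q"
        using defect[of t] False by auto
      have fY: "f \<in> Y" "f \<in> G" "f' \<in> G" using f LY Y_G by auto
      have f'T: "f' \<in> T t" using f by auto
      have q_t: "q \<noteq> t"
      proof
        assume "q = t"
        then have "f' + s = f" using f(6) by simp
        then show False using pair[OF st(2) f'T st(1)] st' fY by auto
      qed
      \<comment> \<open>If star \<open>t\<close> does not exchange \<open>c\<close>, then
        \<open>c\<close> is a vertex there, and \<open>not_far\<close> leaves only
        \<open>p = t\<close>; symmetrically for \<open>f\<close>.\<close>
      have c_or: "p = t \<or> f = c"
      proof (rule ccontr)
        assume *: "\<not> ?thesis"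
        then have "c \<in> T t" using f c by auto
        then show False using not_far[OF st st' fT[OF st(2)] cY(3) c(4)] c(6) * by auto
      qed
      have f_or: "q = s \<or> f = c"
      proof (rule ccontr)
        assume *: "\<not> ?thesis"
        then have "f \<in> T s" using f c by auto
        moreover have "f' + t + s = f + q" using f(6) by (simp add: algebra_simps)
        ultimately show False using not_far[OF st(2,1) _ fT[OF st(1)] fY(3) f(4)] st' * by auto
      qed
      show ?thesis
      proof (cases "f = c")
        case fc: True
        show ?thesis
        proof (cases "q = s \<and> p = t")
          case True
          then have "c = c' + s" "c = f' + t" using c(6) f(6) fc by (simp_all add: algebra_simps)
          then have False using two_blow_ups[OF st st' abY cY(1) c(2) f(2) _ _ sum] by blast
          then show ?thesis ..
        next
          case False
          \<comment> \<open>Both stars exchange the same vertex. At least one side is supported on a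
            face, so the sides agree term by term: the exchanges are identical, which is the flip
            excluded by \<open>no_flip\<close>.\<close>
          have eq: "c' + q = f' + p"
          proof -
            have "(c' + q) + (s + t) = (c' + s + t) + q" by (simp add: algebra_simps)
            also have "\<dots> = (f' + s + t) + p" unfolding c(6) f(6) fc by (simp add: algebra_simps)
            also have "\<dots> = (f' + p) + (s + t)" by (simp add: algebra_simps)
            finally have "(c' + q) + (s + t) = (f' + p) + (s + t)" .
            then show ?thesis by simp
          qed
          have pq: "c' = f' \<and> q = p"
          proof (cases "q = s")
            case True
            then have "p \<noteq> t" using False by auto
            have "f' + p = c' + q" using eq by simp
            from swap[OF st(2) f'T c(4) \<open>p \<noteq> t\<close> c(2) f(4) this] show ?thesis by auto
          next
            case False
            from swap[OF st(1) c'T f(4) False f(2) c(4) eq] show ?thesis by auto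
          qed
          then have pt: "p \<noteq> t" using q_t by auto
          have Tt: "T t = {a, b, c'}" using f ab fc pq by auto
          have "a + b + c' = p"
          proof -
            have "(a + b + c) + c' = s + t + c'" using sum by simp
            also have "\<dots> = c + p" using c(6) by (simp add: algebra_simps)
            finally show ?thesis by (simp add: algebra_simps)
          qed
          then have False
            using edgesL L edges'[OF st(1) Ts] edges'[OF st(2) Tt]
            by (intro no_flip[OF st st' c(4) p_s pt, of a b c c']) (auto simp: sum)
          then show ?thesis ..
        qed
      next
        case fc: False
        then have "p = t" "q = s" using c_or f_or by auto
        then have cc: "c = c' + s" "f = f' + t" using c(6) f(6) by (simp_all add: algebra_simps)
        \<comment> \<open>Different vertices are exchanged. With the third vertex \<open>e\<close>,
          both relations turn \<open>\<Sum>L = s + t\<close> into a vanishing sum of three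
          generators.\<close>
        have "f \<in> {a, b}" using f fc abc by auto
        then obtain e where e: "L = {e, f, c}" "e \<noteq> f" "e \<noteq> c" using abc ab by auto
        have "e + f + c = s + t" using sumL sum_three[of e f c] e fc by simp
        then have "e + f' + c' = 0" unfolding cc by (simp add: algebra_simps)
        then have "zero_sum {#e, f', c'#}" using e LY Y_G f(2) c(2) by (auto simp: zero_sum_def add.assoc)
        then show ?thesis using zero_sum_size_ge_4 by fastforce
      qed
    qed
  qed
qed

lemma card_Y_no_opposite:
  assumes no: "\<And>y y'. y \<in> Y \<Longrightarrow> y' \<in> Y \<Longrightarrow> y + y' \<notin> V"
  shows "card Y \<le> 4"
proof -
  have "\<forall>m\<in>P. \<exists>T K. tri m T \<and> set_mset K \<subset> P \<and> K \<noteq> {#} \<and> size K \<le> 2 \<and> sum_mset K = \<Sum>T"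
    using exists_tri[OF _ no] by metis
  then obtain T K where TK: "\<And>m. m \<in> P \<Longrightarrow> tri m (T m)" "\<And>m. m \<in> P \<Longrightarrow> set_mset (K m) \<subset> P"
     "\<And>m. m \<in> P \<Longrightarrow> K m \<noteq> {#}" "\<And>m. m \<in> P \<Longrightarrow> size (K m) \<le> 2" "\<And>m. m \<in> P \<Longrightarrow> sum_mset (K m) = \<Sum>(T m)"
    by metis
  have TD: "T m \<subseteq> Y" "card (T m) = 3" "finite (T m)" "\<And>a b. a \<in> T m \<Longrightarrow> b \<in> T m \<Longrightarrow> a \<noteq> b \<Longrightarrow> E m a b" if "m \<in> P" for m
    using TK(1)[OF that] by (auto simp: tri_def intro: card_ge_0_finite)
  have size12: "size (K m) = 1 \<or> size (K m) = 2" if "m \<in> P" for m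
    using TK(3,4)[OF that] by (cases "K m") (auto simp: le_Suc_eq numeral_2_eq_2)
  have meets: "size (K l) \<le> card (T l \<inter> {a, b})" if "l \<in> P" "m \<in> P" "m \<notin># K l" "a \<in> T m" "b \<in> T m" "a \<noteq> b" for l m a b
    using TK(2)[OF that(1)] TK(5)[OF that(1)] TD[OF that(1)] TD(4)[OF that(2,4-6)] that
    by (intro tri_meets_edge) auto
  \<comment> \<open>If \<open>K l\<close> has two elements, every edge of \<open>T m\<close> lies
    within \<open>T l\<close>.\<close>
  have same: "T m = T l" if lm: "l \<in> P" "m \<in> P" "m \<notin># K l" "size (K l) = 2" for l m
  proof -
    have "T m \<subseteq> T l"
    proof
      fix a assume a: "a \<in> T m"
      obtain b where b: "b \<in> T m" "b \<noteq> a"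
        using TD(2)[OF lm(2)] a by (metis card_3_iff insertI1 insert_commute)
      have "2 \<le> card (T l \<inter> {a, b})" using meets[OF lm(1-3) a b(1)] b lm(4) by auto
      then have "T l \<inter> {a, b} = {a, b}" using b by (intro card_seteq) auto
      then show "a \<in> T l" by auto
    qed
    then show ?thesis using TD lm by (intro card_subset_eq) auto
  qed
  \<comment> \<open>In any case every edge of \<open>T m\<close> meets \<open>T l\<close>, so at
    most one vertex is outside.\<close>
  have two: "card (T m \<inter> T l) \<ge> 2" if lm: "l \<in> P" "m \<in> P" "m \<notin># K l" for l m
  proof (rule ccontr)
    assume "\<not> ?thesis"
    then have "card (T m - T l) \<ge> 2"
      using card_Diff_subset_Int[of "T m" "T l"] TD[OF lm(2)] by simp
    then obtain S where "S \<subseteq> T m - T l" "card S = 2" by (metis obtain_subset_with_card_n)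
    then obtain a b where ab: "a \<in> T m - T l" "b \<in> T m - T l" "a \<noteq> b" by (auto simp: card_2_iff)
    then have "size (K l) \<le> card (T l \<inter> {a, b})" using meets[OF lm, of a b] by blast
    also have "T l \<inter> {a, b} = {}" using ab by auto
    finally show False using TK(3)[OF lm(1)] by simp
  qed
  have const: "card Y \<le> 4" if lP: "l \<in> P" and all: "\<forall>m\<in>P. T m = T l" for l
  proof (rule no_third_ray[of "T l"])
    fix m assume m: "m \<in> P"
    show "tri m (T l)" using TK(1)[OF m] all m by simp
  next
    show "\<Sum>(T l) \<in> V" using TK(2,5)[OF lP] V_sum_mset by (metis psubset_imp_subset)
  qed
  have exch: "\<exists>c c'. c \<in> T l \<and> c' \<notin> T l \<and> T m = insert c' (T l - {c}) \<and> c' - c = \<Sum>(T m) - \<Sum>(T l)"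
    if lm: "l \<in> P" "m \<in> P" "T m \<noteq> T l" "card (T m \<inter> T l) \<ge> 2" for l m
  proof -
    obtain c c' where c: "c \<in> T l" "c' \<notin> T l" "T m = insert c' (T l - {c})"
      using card_3_exchange[OF TD(2)[OF lm(2)] TD(2)[OF lm(1)] lm(4,3)] by metis
    have "\<Sum>(T m) = c' + \<Sum>(T l - {c})" using c TD(3)[OF lm(1)] by simp
    also have "\<Sum>(T l - {c}) = \<Sum>(T l) - c" using c TD(3)[OF lm(1)] by (simp add: sum_diff1)
    finally show ?thesis using c by (intro exI[of _ c] exI[of _ c']) (simp add: algebra_simps)
  qed
  have faceT: "face (insert x (P - {m}))" if mx: "m \<in> P" "x \<in> T m" for x m
  proof -
    obtain x' where "x' \<in> T m" "x' \<noteq> x"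
      using TD(2)[OF mx(1)] by (metis card_3_iff insertI1 insert_commute)
    then have "E m x x'" using mx TD(4) by auto
    then show ?thesis by (intro E_face[of m x x']) auto
  qed
  show ?thesis
  proof (cases "\<forall>m\<in>P. size (K m) = 1")
    case True
    then have "\<forall>m\<in>P. \<exists>p. K m = {#p#}" using size_1_singleton_mset by blast
    then obtain k where k: "\<And>m. m \<in> P \<Longrightarrow> K m = {#k m#}" by metis
    have kP: "k m \<in> P" "\<Sum>(T m) = k m" if "m \<in> P" for m using k[OF that] TK(2,5)[OF that] by auto
    \<comment> \<open>An exchange of \<open>c\<close> for \<open>c'\<close> means
      \<open>c + k m = c' + k l\<close> with the right side on a face, so both sides would have the
      same summands.\<close>
    have eq: "T m = T l" if lm: "l \<in> P" "m \<in> P" "m \<noteq> k l" for l m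
    proof (rule ccontr)
      assume ne: "T m \<noteq> T l"
      have "card (T m \<inter> T l) \<ge> 2" using two[OF lm(1,2)] k[OF lm(1)] lm(3) by auto
      then obtain c c' where c: "c \<in> T l" "c' \<notin> T l" "T m = insert c' (T l - {c})" "c' - c = k m - k l"
        using exch[OF lm(1,2) ne] kP lm by auto
      have "sum_mset {#c, k m#} = sum_mset {#c', k l#}" using c(4) by (simp add: algebra_simps)
      moreover have "face (set_mset {#c', k l#})"
        using c lm kP[OF lm(1)] by (auto intro!: face_mono[OF faceT[OF lm(2), of c']])
      moreover have "set_mset {#c, k m#} \<subseteq> G" using c TD(1)[OF lm(1)] kP[OF lm(2)] P_G Y_G by auto
      ultimately have "size {#c', k l#} < size {#c, k m#} \<or> {#c, k m#} = {#c', k l#}"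
        by (intro face_shortest)
      then have "c' \<in># {#c, k m#}" by auto
      then have "c' = k m" using c by auto
      then show False using c TD(1)[OF lm(2)] kP[OF lm(2)] Y_P by auto
    qed
    obtain l where l: "l \<in> P" by (rule pick_P3)
    have "T m = T l" if m: "m \<in> P" for m
    proof (cases "m = k l")
      case False then show ?thesis using eq[OF l m] by simp
    next
      case True
      obtain n where n: "n \<in> P" "n \<notin> {k l, k m, k m}" by (rule pick_P3)
      then show ?thesis using eq[OF l n(1)] eq[OF m n(1)] by auto
    qed
    then show ?thesis using const[OF l] by blast
  next
    case False
    then obtain l where l: "l \<in> P" "size (K l) = 2" using size12 by auto
    obtain s t where st: "K l = {#s, t#}" using card_two_mset[OF l(2)] by blast
    have stP: "s \<in> P" "t \<in> P" using TK(2)[OF l(1)] st by auto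
    define L where "L = T l"
    have L: "T m = L" if "m \<in> P" "m \<notin> {s, t}" for m using same[OF l(1) that(1) _ l(2)] st that by (auto simp: L_def)
    have sumL: "\<Sum>L = s + t" using TK(5)[OF l(1)] st by (simp add: L_def)
    have defect: "\<exists>c c' p. c \<in> L \<and> c' \<in> Y \<and> c' \<notin> L \<and> p \<in> P \<and> T m = insert c' (L - {c}) \<and> c' + s + t = c + p"
      if m: "m \<in> {s, t}" "T m \<noteq> L" for m
    proof -
      have mP: "m \<in> P" using m stP by auto
      have "size (K m) \<noteq> 2"
      proof
        assume s2: "size (K m) = 2"
        then obtain s' t' where st': "K m = {#s', t'#}" using card_two_mset by blast
        \<comment> \<open>Here five elements of \<open>P\<close> are needed: a star outside all four
          would have both triangles.\<close>
        have "card {s, t, s', t'} \<le> 4" by (simp add: card_insert_if)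
        then have "card {s, t, s', t'} < d - 1" using d_ge by linarith
        then obtain n where n: "n \<in> P" "n \<notin> {s, t, s', t'}" using pick_P[of "{s, t, s', t'}"] by blast
        then have "T n = T m" using same[OF mP n(1) _ s2] st' by auto
        then show False using L[of n] n m by auto
      qed
      then obtain p where p: "K m = {#p#}" using size12[OF mP] size_1_singleton_mset by blast
      have pP: "p \<in> P" "\<Sum>(T m) = p" using TK(2,5)[OF mP] p by auto
      obtain n where n: "n \<in> P" "n \<notin> {s, t, p}" by (rule pick_P3)
      have "card (T n \<inter> T m) \<ge> 2" using two[OF mP n(1)] p n by auto
      then have "card (T m \<inter> T l) \<ge> 2" using L[of n] n by (simp add: L_def Int_commute)
      then obtain c c' where c: "c \<in> L" "c' \<notin> L" "T m = insert c' (L - {c})" "c' - c = p - (s + t)"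
        using exch[OF l(1) mP] m sumL pP by (auto simp: L_def)
      have "c' \<in> Y" using TD(1)[OF mP] c by auto
      moreover have "c' + s + t = c + p" using c(4) by (simp add: algebra_simps)
      ultimately show ?thesis using c pP by blast
    qed
    show ?thesis
    proof (cases "T s = L")
      case False
      then show ?thesis using defect_case[OF stP TK(1) L sumL defect] by blast
    next
      case Ts: True
      show ?thesis
      proof (cases "T t = L")
        case False
        have "T m = L" if "m \<in> P" "m \<notin> {t, s}" for m using L that by auto
        moreover have "\<Sum>L = t + s" using sumL by (simp add: add.commute)
        moreover have "\<exists>c c' p. c \<in> L \<and> c' \<in> Y \<and> c' \<notin> L \<and> p \<in> P \<and> T m = insert c' (L - {c}) \<and> c' + t + s = c + p"
          if "m \<in> {t, s}" "T m \<noteq> L" for m using defect[of m] that by (auto simp: add.commute add.left_commute)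
        ultimately show ?thesis using defect_case[OF stP(2,1) TK(1) _ _ _ False] by blast
      next
        case True
        then have "T m = T l" if "m \<in> P" for m using L[of m] Ts that by (auto simp: L_def)
        then show ?thesis using const[OF l(1)] by blast
      qed
    qed
  qed
qed

lemma card_Y: "card Y \<le> 4"
proof (cases "\<exists>y\<in>Y. \<exists>y'\<in>Y. y + y' \<in> V")
  case True
  then obtain y y' where y: "y \<in> Y" "y' \<in> Y" "y + y' \<in> V" by auto
  then have "opp y y' (y + y')" using opposite_sum by (auto simp: opp_def)
  then show ?thesis by (rule card_Y_opposite)
qed (use card_Y_no_opposite in blast)

end

section \<open>From fans to complexes of ray generators\<close>

lemma int_lattice_0: "0 \<in> int_lattice" by (simp add: int_lattice_def)

lemma int_lattice_diff: "x \<in> int_lattice \<Longrightarrow> y \<in> int_lattice \<Longrightarrow> x - y \<in> int_lattice"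
  by (simp add: int_lattice_def)

lemma int_lattice_inner: "x \<in> int_lattice \<Longrightarrow> y \<in> int_lattice \<Longrightarrow> x \<bullet> y \<in> \<int>"
  by (auto simp: int_lattice_def inner_vec_def intro!: Ints_sum Ints_mult)

lemma axis_int_lattice: "axis i 1 \<in> int_lattice"
  by (simp add: int_lattice_def axis_def)

section \<open>Cones over lattice bases in coordinates\<close>

lemma convex_cone_hull_finite:
  fixes S :: "'a::real_vector set"
  assumes "finite S"
  shows "convex_cone hull S = {\<Sum>b\<in>S. c b *\<^sub>R b | c. \<forall>b\<in>S. c b \<ge> (0::real)}" (is "_ = ?R")
proof
  show "convex_cone hull S \<subseteq> ?R"
  proof (rule hull_minimal)
    show "S \<subseteq> ?R"
    proof
      fix x assume "x \<in> S"
      then have "x = (\<Sum>b\<in>S. (if b = x then 1 else 0) *\<^sub>R b)"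
        using assms by (simp add: if_distrib[of "\<lambda>a. a *\<^sub>R _"] cong: if_cong)
      then show "x \<in> ?R" by (intro CollectI exI[of _ "\<lambda>b. if b = x then 1 else 0"]) auto
    qed
    have "0 \<in> ?R" by (intro CollectI exI[of _ "\<lambda>_. 0"]) auto
    moreover have "x + y \<in> ?R" if xy: "x \<in> ?R" "y \<in> ?R" for x y
    proof -
      obtain c where "x = (\<Sum>b\<in>S. c b *\<^sub>R b)" "\<forall>b\<in>S. c b \<ge> (0::real)" using xy(1) by blast
      moreover obtain d where "y = (\<Sum>b\<in>S. d b *\<^sub>R b)" "\<forall>b\<in>S. d b \<ge> (0::real)" using xy(2) by blast
      ultimately show ?thesis by (intro CollectI exI[of _ "\<lambda>b. c b + d b"]) (auto simp: scaleR_left_distrib sum.distrib)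
    qed
    moreover have "t *\<^sub>R x \<in> ?R" if tx: "x \<in> ?R" "t \<ge> 0" for x t
    proof -
      obtain c where "x = (\<Sum>b\<in>S. c b *\<^sub>R b)" "\<forall>b\<in>S. c b \<ge> 0" using tx(1) by auto
      then show ?thesis using tx(2) by (intro CollectI exI[of _ "\<lambda>b. t * c b"]) (auto simp: scaleR_sum_right)
    qed
    ultimately show "convex_cone ?R" unfolding convex_cone_iff by blast
  qed
  show "?R \<subseteq> convex_cone hull S"
  proof clarify
    fix c assume c: "\<forall>b\<in>S. c b \<ge> (0::real)"
    have "(\<Sum>b\<in>A. c b *\<^sub>R b) \<in> convex_cone hull S" if "A \<subseteq> S" for A
      using finite_subset[OF that assms] that
    proof (induction A rule: finite_induct)
      case (insert b A)
      then have "c b *\<^sub>R b \<in> convex_cone hull S" using c by (intro convex_cone_hull_mul hull_inc) auto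
      then show ?case using insert by (simp add: convex_cone_hull_add)
    qed (simp add: convex_cone_hull_contains_0)
    then show "(\<Sum>b\<in>S. c b *\<^sub>R b) \<in> convex_cone hull S" by blast
  qed
qed

lemma lattice_basis_props:
  fixes B :: "(real ^ 'n) set"
  assumes "lattice_basis B"
  shows "finite B" "independent B" "span B = UNIV" "card B = CARD('n)" "B \<subseteq> int_lattice"
    "x \<in> int_lattice \<Longrightarrow> representation B x b \<in> \<int>"
proof -
  show fin: "finite B" and ind: "independent B" using assms by (auto simp: lattice_basis_def)
  have L: "int_lattice = {\<Sum>b\<in>B. of_int (c b) *\<^sub>R b | c :: real ^ 'n \<Rightarrow> int. True}"
    using assms unfolding lattice_basis_def by blast
  have "int_lattice \<subseteq> span B"
  proof
    fix x :: "real ^ 'n" assume "x \<in> int_lattice"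
    then obtain c :: "real ^ 'n \<Rightarrow> int" where c: "x = (\<Sum>b\<in>B. of_int (c b) *\<^sub>R b)" unfolding L by blast
    show "x \<in> span B" unfolding c by (intro span_sum span_scale span_base)
  qed
  moreover have "(Basis :: (real ^ 'n) set) \<subseteq> int_lattice"
    by (auto simp: Basis_vec_def axis_int_lattice)
  ultimately have "span (Basis :: (real ^ 'n) set) \<subseteq> span B" by (meson order_trans span_minimal subspace_span)
  then show sp: "span B = UNIV" by auto
  then show "card B = CARD('n)" using dim_span_eq_card_independent[OF ind] by simp
  show "B \<subseteq> int_lattice"
  proof
    fix b assume "b \<in> B"
    then have "b = (\<Sum>a\<in>B. of_int (if a = b then 1 else 0) *\<^sub>R a)"
      using fin by (simp add: if_distrib[of "\<lambda>a. of_int a *\<^sub>R _"] if_distrib[of "\<lambda>a. a *\<^sub>R _"] cong: if_cong)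
    then show "b \<in> int_lattice" unfolding L by (intro CollectI exI[of _ "\<lambda>a. if a = b then 1 else 0"]) auto
  qed
  show "representation B x b \<in> \<int>" if x: "x \<in> int_lattice" for x b
  proof -
    obtain c :: "real ^ 'n \<Rightarrow> int" where c: "x = (\<Sum>b\<in>B. of_int (c b) *\<^sub>R b)" using x unfolding L by auto
    have "representation B x b = (\<Sum>a\<in>B. representation B (of_int (c a) *\<^sub>R a) b)"
      unfolding c using ind sp by (subst representation_sum) auto
    also have "\<dots> = (\<Sum>a\<in>B. of_int (c a) * representation B a b)"
      using ind sp by (intro sum.cong refl) (simp add: representation_scale)
    also have "\<dots> \<in> \<int>" using ind by (intro Ints_sum Ints_mult) (auto simp: representation_basis)
    finally show ?thesis .
  qed
qed

context
  fixes B :: "(real ^ 'n) set"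
  assumes B: "lattice_basis B"
begin

lemma basis_linear: "linear (\<lambda>x. representation B x b)"
  using lattice_basis_props[OF B]
  by (intro linearI) (simp_all add: representation_add representation_scale)

lemma basis_sum: "(\<Sum>b\<in>B. representation B x b *\<^sub>R b) = x"
  using lattice_basis_props[OF B] by (intro sum_representation_eq) auto

lemma basis_coord: "b \<in> B \<Longrightarrow> representation B b c = (if c = b then 1 else 0)"
  using lattice_basis_props[OF B] by (simp add: representation_basis)

lemma basis_cone:
  assumes "C \<subseteq> B"
  shows "x \<in> convex_cone hull C \<longleftrightarrow> (\<forall>b. representation B x b \<ge> 0) \<and> (\<forall>b. b \<notin> C \<longrightarrow> representation B x b = 0)"
proof
  have fin: "finite C" "finite B" using assms lattice_basis_props[OF B] finite_subset by auto
  {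
    assume "x \<in> convex_cone hull C"
    then obtain c where c: "x = (\<Sum>b\<in>C. c b *\<^sub>R b)" "\<forall>b\<in>C. c b \<ge> 0"
      using convex_cone_hull_finite[OF fin(1)] by auto
    have "representation B x b = (if b \<in> C then c b else 0)" for b
    proof -
      have "representation B x b = (\<Sum>a\<in>C. c a * representation B a b)"
        unfolding c by (simp add: linear_sum[OF basis_linear] linear_scale[OF basis_linear])
      also have "\<dots> = (\<Sum>a\<in>C. if a = b then c a else 0)"
        using assms by (intro sum.cong refl) (auto simp: basis_coord)
      finally show ?thesis using fin by simp
    qed
    then show "(\<forall>b. representation B x b \<ge> 0) \<and> (\<forall>b. b \<notin> C \<longrightarrow> representation B x b = 0)" using c by auto
  next
    assume *: "(\<forall>b. representation B x b \<ge> 0) \<and> (\<forall>b. b \<notin> C \<longrightarrow> representation B x b = 0)"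
    have "x = (\<Sum>b\<in>B. representation B x b *\<^sub>R b)" using basis_sum by simp
    also have "\<dots> = (\<Sum>b\<in>C. representation B x b *\<^sub>R b)"
      using fin assms * by (intro sum.mono_neutral_right) auto
    finally show "x \<in> convex_cone hull C" unfolding convex_cone_hull_finite[OF fin(1)] using * by blast
  }
qed

lemma basis_cone_full: "x \<in> convex_cone hull B \<longleftrightarrow> (\<forall>b\<in>B. representation B x b \<ge> 0)"
  using basis_cone[of B x] representation_ne_zero by (metis order_refl subset_refl)

lemma basis_face:
  assumes "C \<subseteq> B"
  shows "(convex_cone hull C) face_of (convex_cone hull B)"
  unfolding face_of_def
proof (intro conjI ballI impI)
  show "convex_cone hull C \<subseteq> convex_cone hull B" using assms by (rule hull_mono)
  show "convex (convex_cone hull C)" by (rule convex_convex_cone_hull)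
  fix a b x assume ab: "a \<in> convex_cone hull B" "b \<in> convex_cone hull B" and x: "x \<in> convex_cone hull C"
    and seg: "x \<in> open_segment a b"
  obtain t where t: "0 < t" "t < 1" "x = (1 - t) *\<^sub>R a + t *\<^sub>R b" using seg by (auto simp: in_segment)
  have *: "representation B a c = 0 \<and> representation B b c = 0" if "c \<notin> C" for c
  proof -
    have "0 = (1 - t) * representation B a c + t * representation B b c"
    proof -
      have "representation B x c = 0" using x basis_cone[OF assms] that by blast
      then show ?thesis unfolding t(3) by (simp add: linear_add[OF basis_linear] linear_scale[OF basis_linear])
    qed
    moreover have "representation B a c \<ge> 0" "representation B b c \<ge> 0"
      using ab basis_cone[of B] by auto
    ultimately show ?thesis using t
      by (metis add_nonneg_eq_0_iff diff_gt_0_iff_gt less_eq_real_def mult_eq_0_iff mult_nonneg_nonneg order_less_irrefl)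
  qed
  show "a \<in> convex_cone hull C" "b \<in> convex_cone hull C"
    using * ab basis_cone[of B] basis_cone[OF assms] by auto
qed

lemma basis_dim: assumes "C \<subseteq> B" shows "dim (convex_cone hull C) = card C"
proof -
  have ind: "independent C" using assms lattice_basis_props(2)[OF B] independent_mono by blast
  have "finite C" using assms lattice_basis_props(1)[OF B] finite_subset by blast
  then have "convex_cone hull C \<subseteq> span C"
    unfolding convex_cone_hull_finite[OF \<open>finite C\<close>] by clarify (intro span_sum span_scale span_base)
  then have "span (convex_cone hull C) = span C"
    by (intro antisym span_minimal subspace_span span_mono hull_subset)
  then show ?thesis using ind by (metis dim_span dim_span_eq_card_independent)
qed

lemma basis_closed: "closed (convex_cone hull B)"
proof -
  have "convex_cone hull B = (\<Inter>b\<in>B. {x. 0 \<le> representation B x b})" using basis_cone_full by auto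
  also have "closed \<dots>"
    using linear_continuous_on[OF linear_conv_bounded_linear[THEN iffD1, OF basis_linear]]
    by (intro closed_INT ballI closed_Collect_le continuous_on_const)
  finally show ?thesis .
qed

end

text \<open>\<open>x + y\<close> is the midpoint of \<open>2 x\<close> and \<open>2 y\<close>, which
  lie in the cone. Equal summands are treated apart because the open segment is then empty.\<close>

lemma face_of_cone_summand:
  assumes F: "F face_of S" and S: "conic S" and xy: "x \<in> S" "y \<in> S" "x + y \<in> F"
  shows "2 *\<^sub>R x \<in> F"
proof (cases "x = y")
  case True
  then show ?thesis using xy by (simp add: scaleR_2)
next
  case False
  have "x + y = (1 - 1/2) *\<^sub>R (2 *\<^sub>R x) + (1/2) *\<^sub>R (2 *\<^sub>R y)" by simp
  moreover have "2 *\<^sub>R x \<noteq> 2 *\<^sub>R y" using False by simp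
  ultimately have "x + y \<in> open_segment (2 *\<^sub>R x) (2 *\<^sub>R y)" unfolding in_segment by (intro conjI exI[of _ "1/2"]) auto
  moreover have "2 *\<^sub>R x \<in> S" "2 *\<^sub>R y \<in> S" using S xy by (auto simp: conic_def)
  ultimately show ?thesis using F xy(3) unfolding face_of_def by blast
qed

section \<open>Maximal cones, the Fano condition and the Picard rank\<close>

definition max_gens :: "(real ^ 'n) set set \<Rightarrow> (real ^ 'n) set set" where
  "max_gens \<Sigma> = {B. lattice_basis B \<and> convex_cone hull B \<in> \<Sigma>}"

context
  fixes \<Sigma> :: "(real ^ 'n) set set"
  assumes fan: "is_fan \<Sigma>" and reg: "regular_fan \<Sigma>" and comp: "complete_fan \<Sigma>"
begin

lemma sub_cone: "B \<in> max_gens \<Sigma> \<Longrightarrow> C \<subseteq> B \<Longrightarrow> convex_cone hull C \<in> \<Sigma>"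
  using fan basis_face[of B C] convex_cone_hull_nonempty[of C] unfolding is_fan_def max_gens_def by blast

lemma max_gens_ray:
  assumes "B \<in> max_gens \<Sigma>" "b \<in> B" shows "b \<in> ray_generators \<Sigma>"
proof -
  have B: "lattice_basis B" using assms by (simp add: max_gens_def)
  note props = lattice_basis_props[OF B]
  have 1: "representation B b b = 1" using basis_coord[OF B assms(2)] by simp
  have "b \<noteq> 0" using props(2) assms(2) dependent_zero by blast
  moreover have "k = 1" if w: "w \<in> int_lattice" and k: "b = of_nat k *\<^sub>R w" for w and k :: nat
  proof -
    obtain z where z: "representation B w b = of_int z" using props(6)[OF w] by (metis Ints_cases)
    have "representation B (real k *\<^sub>R w) b = real k * of_int z" by (simp add: linear_scale[OF basis_linear[OF B]] z)
    then have "1 = real k * of_int z" using 1 k by simp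
    then have "int k * z = 1" by (metis of_int_1 of_int_eq_iff of_int_mult of_int_of_nat_eq)
    then show ?thesis by (auto simp: zmult_eq_1_iff)
  qed
  ultimately show ?thesis using sub_cone[OF assms(1), of "{b}"] assms(2) props(5)
    by (auto simp: ray_generators_def primitive_vector_def)
qed

text \<open>The ray of \<open>v\<close> meets the cone over \<open>B\<close> in a face of it.
  Splitting off one basis summand of \<open>v\<close> puts this summand on the ray, so
  \<open>v\<close> is a positive multiple of a basis vector, and primitivity makes them
  equal.\<close>

lemma ray_in_max_cone:
  assumes B: "B \<in> max_gens \<Sigma>" and v: "v \<in> ray_generators \<Sigma>" "v \<in> convex_cone hull B"
  shows "v \<in> B"
proof -
  have lb: "lattice_basis B" "convex_cone hull B \<in> \<Sigma>" using B by (auto simp: max_gens_def)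
  have v': "v \<noteq> 0" "v \<in> int_lattice" "convex_cone hull {v} \<in> \<Sigma>"
    using v by (auto simp: ray_generators_def primitive_vector_def)
  have "convex_cone hull {v} \<subseteq> convex_cone hull B" using v(2) by (simp add: hull_minimal convex_cone_convex_cone_hull)
  then have "convex_cone hull {v} = convex_cone hull {v} \<inter> convex_cone hull B" by blast
  then have face: "(convex_cone hull {v}) face_of (convex_cone hull B)"
    using fan lb v' unfolding is_fan_def by metis
  have nn: "\<forall>b\<in>B. representation B v b \<ge> 0" using v(2) basis_cone_full[OF lb(1)] by blast
  obtain b where b: "b \<in> B" "representation B v b \<noteq> 0"
  proof (rule ccontr)
    assume "\<not> thesis"
    then have "\<forall>b\<in>B. representation B v b = 0" using that by blast
    then have "v = 0" using basis_sum[OF lb(1), of v] by simp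
    then show False using v' by simp
  qed
  define c where "c = representation B v b"
  have c: "c > 0" using b nn by (auto simp: c_def order_less_le)
  have fin: "finite B" using lattice_basis_props[OF lb(1)] by auto
  define w where "w = (\<Sum>a\<in>B - {b}. representation B v a *\<^sub>R a)"
  have v_w: "c *\<^sub>R b + w = v"
    using basis_sum[OF lb(1), of v] b fin by (simp add: c_def w_def sum.remove)
  have cb: "c *\<^sub>R b \<in> convex_cone hull B" using b c by (intro convex_cone_hull_mul hull_inc) auto
  have "w \<in> convex_cone hull (B - {b})"
    using nn fin unfolding w_def by (subst convex_cone_hull_finite) auto
  then have wB: "w \<in> convex_cone hull B" using hull_mono[of "B - {b}" B] by blast
  have "c *\<^sub>R b + w \<in> convex_cone hull {v}" unfolding v_w by (simp add: hull_inc)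
  then have c2: "2 *\<^sub>R c *\<^sub>R b \<in> convex_cone hull {v}"
    by (rule face_of_cone_summand[OF face conic_convex_cone_hull cb wB])
  from c2 obtain t where t: "2 *\<^sub>R c *\<^sub>R b = t *\<^sub>R v" "t \<ge> 0"
    by (auto simp: convex_cone_hull_finite)
  have "b \<noteq> 0" using lattice_basis_props(2)[OF lb(1)] b dependent_zero by blast
  then have "t \<noteq> 0" using t c by auto
  then have "v = (1 / t) *\<^sub>R t *\<^sub>R v" by simp
  then have v_eq: "v = (2 * c / t) *\<^sub>R b" unfolding t(1)[symmetric] by simp
  have "representation B v b = 2 * c / t"
    using basis_coord[OF lb(1) b(1)] by (subst v_eq) (simp add: linear_scale[OF basis_linear[OF lb(1)]])
  then have "2 * c / t = c" by (simp only: c_def)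
  then have vc: "v = c *\<^sub>R b" using v_eq by (simp only:)
  obtain z where z: "c = of_int z" using lattice_basis_props(6)[OF lb(1) v'(2)] unfolding c_def by (metis Ints_cases)
  then have "v = of_nat (nat z) *\<^sub>R b" using vc c by simp
  then have "nat z = 1" using v(1) b lattice_basis_props(5)[OF lb(1)]
    by (auto simp: ray_generators_def primitive_vector_def)
  then have "z = 1" by simp
  then show ?thesis using vc z b(1) by simp
qed

text \<open>A generator set is recovered from its cone as the ray generators inside it, so there are
  at most as many as cones.\<close>

lemma finite_max_gens: "finite (max_gens \<Sigma>)"
proof (rule finite_subset)
  show "max_gens \<Sigma> \<subseteq> (\<lambda>\<sigma>. ray_generators \<Sigma> \<inter> \<sigma>) ` \<Sigma>"
  proof
    fix B assume B: "B \<in> max_gens \<Sigma>"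
    then have "B = ray_generators \<Sigma> \<inter> convex_cone hull B"
      using max_gens_ray[OF B] ray_in_max_cone[OF B] hull_subset[of B convex_cone] by blast
    then show "B \<in> (\<lambda>\<sigma>. ray_generators \<Sigma> \<inter> \<sigma>) ` \<Sigma>" using B by (auto simp: max_gens_def)
  qed
  show "finite ((\<lambda>\<sigma>. ray_generators \<Sigma> \<inter> \<sigma>) ` \<Sigma>)" using fan by (simp add: is_fan_def)
qed

text \<open>The cones of smaller dimension have measure zero, so they cannot fill the open complement of
  the maximal cones.\<close>

lemma max_cones_cover:
  obtains B where "B \<in> max_gens \<Sigma>" "x \<in> convex_cone hull B"
proof -
  define U where "U = (\<Union>B\<in>max_gens \<Sigma>. convex_cone hull B)"
  have "closed U" unfolding U_def
    using finite_max_gens basis_closed by (intro closed_UN) (auto simp: max_gens_def)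
  have "- U \<subseteq> \<Union>{\<sigma>\<in>\<Sigma>. dim \<sigma> < CARD('n)}"
  proof
    fix y assume y: "y \<in> - U"
    obtain \<sigma> where s: "\<sigma> \<in> \<Sigma>" "y \<in> \<sigma>" using comp by (auto simp: complete_fan_def)
    obtain B S where B: "lattice_basis B" "S \<subseteq> B" "\<sigma> = convex_cone hull S"
      using reg s(1) unfolding regular_fan_def by blast
    have "S \<noteq> B" using y s B by (auto simp: U_def max_gens_def)
    then have "card S < card B" using B lattice_basis_props(1)[OF B(1)] by (intro psubset_card_mono) auto
    then show "y \<in> \<Union>{\<sigma>\<in>\<Sigma>. dim \<sigma> < CARD('n)}"
      using s basis_dim[OF B(1,2)] B(3) lattice_basis_props(4)[OF B(1)] by auto
  qed
  moreover have "negligible (\<Union>{\<sigma>\<in>\<Sigma>. dim \<sigma> < CARD('n)})"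
    using fan by (intro negligible_Union) (auto simp: is_fan_def intro!: negligible_lowdim)
  ultimately have "negligible (- U)" by (rule negligible_subset[rotated])
  moreover have "open (- U)" using \<open>closed U\<close> by auto
  ultimately have "- U = {}" using open_not_negligible by blast
  then show ?thesis using that by (auto simp: U_def)
qed

lemma cone_iff_max_gens:
  assumes C: "C \<subseteq> ray_generators \<Sigma>"
  shows "convex_cone hull C \<in> \<Sigma> \<longleftrightarrow> (\<exists>B\<in>max_gens \<Sigma>. C \<subseteq> B)"
proof
  assume "convex_cone hull C \<in> \<Sigma>"
  moreover obtain B' S where S: "lattice_basis B'" "S \<subseteq> B'" "convex_cone hull C = convex_cone hull S"
    using calculation reg unfolding regular_fan_def by blast
  ultimately have SS: "convex_cone hull S \<in> \<Sigma>" by simp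
  have fin: "finite S" using S(1,2) lattice_basis_props(1) finite_subset by blast
  \<comment> \<open>\<open>\<Sum>S\<close> is a relative interior point of the cone over
    \<open>S\<close>. A maximal cone containing it meets the cone in a face through that point,
    hence contains all of \<open>S\<close>.\<close>
  obtain B where B: "B \<in> max_gens \<Sigma>" "\<Sum>S \<in> convex_cone hull B" using max_cones_cover by blast
  have sumS: "\<Sum>A \<in> convex_cone hull S" if "A \<subseteq> S" for A
    using finite_subset[OF that fin] that
    by (induction A rule: finite_induct) (auto intro: convex_cone_hull_add hull_inc simp: convex_cone_hull_contains_0)
  have face: "(convex_cone hull S \<inter> convex_cone hull B) face_of (convex_cone hull S)"
    using fan SS B unfolding is_fan_def max_gens_def by blast
  have "S \<subseteq> convex_cone hull B"
  proof
    fix s assume s: "s \<in> S"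
    have "s + \<Sum>(S - {s}) = \<Sum>S" using s fin by (simp add: sum.remove)
    then have "s + \<Sum>(S - {s}) \<in> convex_cone hull S \<inter> convex_cone hull B"
      using B(2) sumS[of S] by simp
    then have "2 *\<^sub>R s \<in> convex_cone hull S \<inter> convex_cone hull B"
      using s sumS[of "S - {s}"] by (intro face_of_cone_summand[OF face conic_convex_cone_hull]) (auto intro: hull_inc)
    then show "s \<in> convex_cone hull B"
      using convex_cone_hull_mul[of "2 *\<^sub>R s" B "1 / 2"] by simp
  qed
  then have "convex_cone hull S \<subseteq> convex_cone hull B" by (simp add: hull_minimal convex_cone_convex_cone_hull)
  then have "C \<subseteq> convex_cone hull B" using S(3) hull_subset[of C convex_cone] by blast
  then show "\<exists>B\<in>max_gens \<Sigma>. C \<subseteq> B" using B(1) C ray_in_max_cone by blast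
qed (use sub_cone in blast)

lemma ray_generators_eq: "ray_generators \<Sigma> = \<Union>(max_gens \<Sigma>)"
proof
  show "ray_generators \<Sigma> \<subseteq> \<Union>(max_gens \<Sigma>)"
  proof
    fix v assume "v \<in> ray_generators \<Sigma>"
    then show "v \<in> \<Union>(max_gens \<Sigma>)" using cone_iff_max_gens[of "{v}"] by (auto simp: ray_generators_def)
  qed
qed (use max_gens_ray in blast)

text \<open>Concavity from an interior point of the cone towards \<open>v\<close> gives
  \<open>\<phi> v \<le> m \<bullet> v\<close>. Ampleness makes this strict outside the cone, and
  integrality improves \<open>m \<bullet> v > - 1\<close> to \<open>m \<bullet> v \<ge> 0\<close>,
  where \<open>m\<close> is minus the height.\<close>

lemma anticanonical_height:
  assumes ample: "ample_divisor \<Sigma> anticanonical_divisor"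
    and B: "B \<in> max_gens \<Sigma>" and v: "v \<in> ray_generators \<Sigma>" "v \<notin> B"
  shows "(\<Sum>b\<in>B. representation B v b) \<le> 0"
proof -
  have lb: "lattice_basis B" "convex_cone hull B \<in> \<Sigma>" using B by (auto simp: max_gens_def)
  note props = lattice_basis_props[OF lb(1)]
  obtain \<phi> where phi: "support_function \<Sigma> anticanonical_divisor \<phi>" "concave_on UNIV \<phi>"
    "\<And>\<sigma>. \<sigma> \<in> \<Sigma> \<Longrightarrow> dim \<sigma> = CARD('n) \<Longrightarrow> (\<exists>m\<in>int_lattice. \<forall>x. \<phi> x = m \<bullet> x \<longleftrightarrow> x \<in> \<sigma>)"
    using ample unfolding ample_divisor_def by blast
  obtain m where m: "m \<in> int_lattice" "\<And>x. \<phi> x = m \<bullet> x \<longleftrightarrow> x \<in> convex_cone hull B"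
    using phi(3)[OF lb(2)] basis_dim[OF lb(1) subset_refl] props(4) by auto
  have phi1: "\<phi> w = - 1" if "w \<in> ray_generators \<Sigma>" for w
    using phi(1) that by (simp add: support_function_def anticanonical_divisor_def)
  have mb: "m \<bullet> b = - 1" if "b \<in> B" for b
    using m(2)[of b] hull_inc[OF that] phi1[OF max_gens_ray[OF B that]] by simp
  define M where "M = (\<Sum>b\<in>B. \<bar>representation B v b\<bar>)"
  have M: "M \<ge> 0" "\<bar>representation B v b\<bar> \<le> M" if "b \<in> B" for b
    using that props(1) by (auto simp: M_def intro: sum_nonneg member_le_sum)
  have M0: "M \<ge> 0" by (auto simp: M_def intro: sum_nonneg)
  \<comment> \<open>Small enough that the point at parameter \<open>e\<close> on the segment from
    \<open>\<Sum>B\<close> to \<open>v\<close> still has nonnegative coordinates.\<close>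
  define e where "e = 1 / (1 + M)"
  have e: "0 < e" "e \<le> 1" "e * (1 + M) = 1" using M0 by (auto simp: e_def)
  define x0 where "x0 = \<Sum>B"
  have x0: "representation B x0 b = 1" if "b \<in> B" for b
  proof -
    have "representation B x0 b = (\<Sum>a\<in>B. if a = b then 1 else 0)"
      unfolding x0_def linear_sum[OF basis_linear[OF lb(1)]] by (intro sum.cong refl) (auto simp: basis_coord[OF lb(1)])
    then show ?thesis using that props(1) by simp
  qed
  have in0: "x0 \<in> convex_cone hull B" unfolding basis_cone_full[OF lb(1)] using x0 by simp
  have in1: "(1 - e) *\<^sub>R x0 + e *\<^sub>R v \<in> convex_cone hull B"
    unfolding basis_cone_full[OF lb(1)]
  proof
    fix b assume b: "b \<in> B"
    have "e * (- representation B v b) \<le> e * M" using M(2)[OF b] e(1) by (intro mult_left_mono) auto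
    then have "0 \<le> 1 - e + e * representation B v b" using e(3) by (simp add: algebra_simps)
    then show "0 \<le> representation B ((1 - e) *\<^sub>R x0 + e *\<^sub>R v) b"
      by (simp add: linear_add[OF basis_linear[OF lb(1)]] linear_scale[OF basis_linear[OF lb(1)]] x0[OF b])
  qed
  have "\<phi> ((1 - e) *\<^sub>R x0 + e *\<^sub>R v) \<ge> (1 - e) * \<phi> x0 + e * \<phi> v"
    using phi(2) e by (intro concave_onD) auto
  then have "m \<bullet> ((1 - e) *\<^sub>R x0 + e *\<^sub>R v) \<ge> (1 - e) * (m \<bullet> x0) + e * \<phi> v"
    using in0 in1 m(2) by metis
  then have "e * \<phi> v \<le> e * (m \<bullet> v)" by (simp add: inner_add_right)
  then have "\<phi> v \<le> m \<bullet> v" using e(1) by simp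
  moreover have "\<phi> v \<noteq> m \<bullet> v" using m(2)[of v] ray_in_max_cone[OF B v(1)] v(2) by blast
  ultimately have "- 1 < m \<bullet> v" using phi1[OF v(1)] by simp
  moreover obtain z where z: "m \<bullet> v = of_int z"
    using int_lattice_inner[OF m(1)] v(1) by (metis (mono_tags, lifting) Ints_cases mem_Collect_eq primitive_vector_def ray_generators_def)
  ultimately have "m \<bullet> v \<ge> 0" by simp
  moreover have "m \<bullet> v = - (\<Sum>b\<in>B. representation B v b)"
  proof -
    have "m \<bullet> v = (\<Sum>b\<in>B. representation B v b * (m \<bullet> b))"
      by (subst basis_sum[OF lb(1), symmetric]) (simp add: inner_sum_right)
    also have "\<dots> = (\<Sum>b\<in>B. - representation B v b)" by (intro sum.cong refl) (simp add: mb)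
    finally show ?thesis by (simp add: sum_negf)
  qed
  ultimately show ?thesis by simp
qed

lemma smooth_fano_fan_max_gens:
  assumes "ample_divisor \<Sigma> anticanonical_divisor"
  shows "smooth_fano_fan int_lattice (max_gens \<Sigma>) CARD('n)"
proof
  fix B assume B: "B \<in> max_gens \<Sigma>"
  then have lb: "lattice_basis B" by (simp add: max_gens_def)
  note props = lattice_basis_props[OF lb]
  show "finite B" "card B = CARD('n)" "B \<subseteq> int_lattice" "independent B" "span B = UNIV" using props by auto
  show "representation B x b \<in> \<int>" if "x \<in> int_lattice" for x b using props(6) that by blast
  show "(\<Sum>b\<in>B. representation B v b) \<le> 0" if "v \<in> \<Union>(max_gens \<Sigma>)" "v \<notin> B" for v
    using anticanonical_height[OF assms B] that ray_generators_eq by auto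
next
  fix x :: "real ^ 'n" assume "x \<in> int_lattice"
  obtain B where B: "B \<in> max_gens \<Sigma>" "x \<in> convex_cone hull B" using max_cones_cover by blast
  then have "lattice_basis B" by (simp add: max_gens_def)
  then show "\<exists>B\<in>max_gens \<Sigma>. \<forall>b. 0 \<le> representation B x b" using B basis_cone[of B B x] by blast
qed (use int_lattice_0 int_lattice_diff finite_max_gens in auto)

text \<open>On the generators in a basis \<open>B\<close> any divisor agrees with a principal one.
  Only the values on the other generators matter, and more divisors than such generators are
  dependent modulo principal ones.\<close>

lemma picard_rank_le: "picard_rank \<Sigma> \<le> card (ray_generators \<Sigma>) - CARD('n)"
proof -
  obtain B where B: "B \<in> max_gens \<Sigma>" using max_cones_cover by blast
  then have lb: "lattice_basis B" by (simp add: max_gens_def)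
  note props = lattice_basis_props[OF lb]
  let ?G = "ray_generators \<Sigma>"
  have finG: "finite ?G"
    using finite_max_gens lattice_basis_props(1) by (auto simp: ray_generators_eq max_gens_def)
  have BG: "B \<subseteq> ?G" using max_gens_ray[OF B] by auto
  have GL: "?G \<subseteq> int_lattice" by (auto simp: ray_generators_def primitive_vector_def)
  let ?K = "{k. \<exists>D :: nat \<Rightarrow> real ^ 'n \<Rightarrow> int. (\<forall>i<k. cartier_divisor \<Sigma> (D i)) \<and>
            (\<forall>c :: nat \<Rightarrow> int. principal_divisor \<Sigma> (\<lambda>v. \<Sum>i<k. c i * D i v) \<longrightarrow> (\<forall>i<k. c i = 0))}"
  have bound: "k \<le> card ?G - CARD('n)" if "k \<in> ?K" for k
  proof (rule ccontr)
    assume "\<not> ?thesis"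
    moreover have "card (?G - B) = card ?G - CARD('n)" using props BG by (simp add: card_Diff_subset)
    ultimately have less: "card (?G - B) < card {..<k}" by simp
    obtain D :: "nat \<Rightarrow> real ^ 'n \<Rightarrow> int" where
      D: "\<And>c :: nat \<Rightarrow> int. principal_divisor \<Sigma> (\<lambda>v. \<Sum>i<k. c i * D i v) \<Longrightarrow> (\<forall>i<k. c i = 0)"
      using \<open>k \<in> ?K\<close> by blast
    have "\<forall>v b. \<exists>z. v \<in> int_lattice \<longrightarrow> representation B v b = of_int z" using props(6) by (metis Ints_cases)
    then obtain r where r: "\<And>v b. v \<in> int_lattice \<Longrightarrow> representation B v b = of_int (r v b)" by metis
    \<comment> \<open>The inner difference is \<open>D i\<close> corrected by the principal divisor
      with the same values on \<open>B\<close>.\<close>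
    obtain c where c: "\<exists>i<k. c i \<noteq> 0"
      "\<And>v. v \<in> ?G - B \<Longrightarrow> (\<Sum>i<k. c i * (D i v - (\<Sum>b\<in>B. r v b * D i b))) = 0"
      using int_dependent[of "?G - B" "{..<k}" "\<lambda>i v. D i v - (\<Sum>b\<in>B. r v b * D i b)"] finG less by auto
    define f where "f x = (\<Sum>b\<in>B. representation B x b * of_int (\<Sum>i<k. c i * D i b))" for x
    have lin: "linear f" unfolding f_def
      by (intro linearI) (simp_all add: linear_add[OF basis_linear[OF lb]] linear_scale[OF basis_linear[OF lb]]
          sum.distrib sum_distrib_left algebra_simps)
    define m :: "real ^ 'n" where "m = (\<chi> i. f (axis i 1))"
    have m: "m \<bullet> x = f x" for x
    proof -
      have "f x = f (\<Sum>i\<in>UNIV. x $ i *\<^sub>R axis i 1)" using basis_expansion[of x] by (simp add: scalar_mult_eq_scaleR)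
      also have "\<dots> = (\<Sum>i\<in>UNIV. x $ i * f (axis i 1))" by (simp add: linear_sum[OF lin] linear_scale[OF lin])
      finally show ?thesis by (simp add: m_def inner_vec_def mult.commute)
    qed
    have "m \<in> int_lattice"
      using props(6)[OF axis_int_lattice] by (auto simp: int_lattice_def m_def f_def intro!: Ints_sum Ints_mult)
    moreover have "of_int (\<Sum>i<k. c i * D i v) = m \<bullet> v" if v: "v \<in> ?G" for v
    proof (cases "v \<in> B")
      case True
      have "f v = (\<Sum>b\<in>B. if b = v then of_int (\<Sum>i<k. c i * D i b) else 0)"
        unfolding f_def by (intro sum.cong refl) (auto simp: basis_coord[OF lb True])
      then show ?thesis using True props(1) by (simp add: m)
    next
      case False
      have "(\<Sum>i<k. c i * D i v) = (\<Sum>i<k. c i * (\<Sum>b\<in>B. r v b * D i b))"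
        using c(2)[of v] v False by (simp add: algebra_simps sum_subtractf)
      also have "\<dots> = (\<Sum>b\<in>B. \<Sum>i<k. c i * (r v b * D i b))"
        unfolding sum_distrib_left by (rule sum.swap)
      also have "\<dots> = (\<Sum>b\<in>B. r v b * (\<Sum>i<k. c i * D i b))"
        by (simp add: sum_distrib_left algebra_simps)
      finally have "of_int (\<Sum>i<k. c i * D i v) = (\<Sum>b\<in>B. of_int (r v b) * of_int (\<Sum>i<k. c i * D i b) :: real)"
        by simp
      also have "\<dots> = f v" unfolding f_def using r v GL by (intro sum.cong refl) auto
      finally show ?thesis by (simp add: m)
    qed
    ultimately have "principal_divisor \<Sigma> (\<lambda>v. \<Sum>i<k. c i * D i v)" unfolding principal_divisor_def by blast
    then show False using D c(1) by blast
  qed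
  \<comment> \<open>\<open>Max\<close> is meaningful only for a finite nonempty set, so both
    properties are checked before the bound is used for it.\<close>
  have "0 \<in> ?K" by auto
  moreover have "finite ?K" using bound by (intro finite_subset[of ?K "{..card ?G - CARD('n)}"]) auto
  ultimately have "Max ?K \<in> ?K" by (intro Max_in) blast+
  then show ?thesis unfolding picard_rank_def by (rule bound)
qed

end

theorem theorem1p3:
  fixes \<Sigma> :: "(real ^ 'n) set set" and P :: "(real ^ 'n) set"
  assumes "smooth_toric_fano \<Sigma>"
    and "CARD('n) \<ge> 6"
    and "minimal_P_dimension \<Sigma> \<ge> 3"
    and "centrally_symmetric_primitive_collection \<Sigma> P"
    and "card P = CARD('n) - 1"
  shows "picard_rank \<Sigma> \<le> 3
    \<and> minimal_P_dimension \<Sigma> = CARD('n) - 2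
    \<and> (\<forall>P'. centrally_symmetric_primitive_collection \<Sigma> P' \<longrightarrow> P' = P)"
proof -
  have fan: "is_fan \<Sigma>" "regular_fan \<Sigma>" "complete_fan \<Sigma>" "ample_divisor \<Sigma> anticanonical_divisor"
    using assms(1) by (auto simp: smooth_toric_fano_def)
  interpret smooth_fano_fan int_lattice "max_gens \<Sigma>" "CARD('n)"
    using smooth_fano_fan_max_gens[OF fan] .
  have G: "ray_generators \<Sigma> = G" using ray_generators_eq[OF fan(1-3)] by (simp add: G_def)
  have face: "convex_cone hull C \<in> \<Sigma> \<longleftrightarrow> face C" if "C \<subseteq> G" for C
    using cone_iff_max_gens[OF fan(1-3)] that by (simp add: G face_def)
  have "face {}" using cover[OF N_0] by (auto simp: face_def)
  then have cs: "centrally_symmetric_primitive_collection \<Sigma> Q \<longleftrightarrow> prim Q \<and> \<Sum>Q = 0" for Q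
  proof (cases "Q \<subseteq> G")
    case True
    have "(\<forall>R. R \<subset> Q \<longrightarrow> convex_cone hull R \<in> \<Sigma>) \<longleftrightarrow> (\<forall>R. R \<subset> Q \<longrightarrow> face R)"
      using face True by (meson order_trans psubset_imp_subset)
    then show ?thesis using face[OF True] \<open>face {}\<close> True
      by (auto simp: centrally_symmetric_primitive_collection_def primitive_collection_def prim_def G)
  qed (auto simp: centrally_symmetric_primitive_collection_def primitive_collection_def prim_def G)
  define mP where "mP m \<longleftrightarrow> m > 0 \<and> (\<exists>P. centrally_symmetric_primitive_collection \<Sigma> P \<and> card P = m + 1)" for m
  have min: "minimal_P_dimension \<Sigma> = (LEAST m. mP m)" by (simp add: minimal_P_dimension_def mP_def)
  \<comment> \<open>The minimum ranges over positive m, so sizes 0 and 1 are excluded by hand: the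
    empty set is a face, and a ray generator is not zero.\<close>
  have card4: "card Q \<ge> 4" if Q: "prim Q" "\<Sum>Q = 0" for Q
  proof -
    have fin: "finite Q" "Q \<subseteq> G" using Q(1) finite_G finite_subset by (auto simp: prim_def)
    have "card Q \<noteq> 0" using Q(1) \<open>face {}\<close> fin by (auto simp: prim_def)
    moreover have "card Q \<noteq> 1"
    proof
      assume "card Q = 1"
      then obtain v where "Q = {v}" by (auto simp: card_1_singleton_iff)
      then show False using Q(2) fin(2) by (auto simp: ray_generators_def primitive_vector_def simp flip: G)
    qed
    ultimately have "mP (card Q - 1)" using Q cs by (auto simp: mP_def intro!: exI[of _ Q])
    then have "minimal_P_dimension \<Sigma> \<le> card Q - 1" unfolding min by (rule Least_le)
    then show ?thesis using assms(3) by simp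
  qed
  interpret fano_central int_lattice "max_gens \<Sigma>" "CARD('n)" P
    using assms(2,4,5) cs card4 by unfold_locales auto
  have unique: "P' = P" if "centrally_symmetric_primitive_collection \<Sigma> P'" for P'
    using that cs central_unique by blast
  have "mP m \<longleftrightarrow> m = CARD('n) - 2" for m
  proof
    assume "mP m"
    then obtain P' where "centrally_symmetric_primitive_collection \<Sigma> P'" "card P' = m + 1"
      unfolding mP_def by blast
    then show "m = CARD('n) - 2" using unique[of P'] assms(5) by simp
  next
    assume "m = CARD('n) - 2"
    then have "m > 0" "card P = m + 1" using assms(2,5) by auto
    then show "mP m" using assms(4) unfolding mP_def by blast
  qed
  then have "minimal_P_dimension \<Sigma> = CARD('n) - 2" unfolding min by (intro Least_equality) auto
  moreover have "picard_rank \<Sigma> \<le> 3"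
  proof -
    \<comment> \<open>At most n - 1 + 4 = n + 3 ray generators, hence Picard rank at most 3.\<close>
    have "card G = card P + card Y"
      using card_Un_disjoint[of P Y] finite_P finite_G P_G by (simp add: Y_def Un_absorb1 Diff_disjoint)
    then have "card G \<le> CARD('n) + 3" using card_Y assms(2,5) by simp
    then show ?thesis using picard_rank_le[OF fan(1-3)] by (simp add: G)
  qed
  ultimately show ?thesis using unique by blast
qed

end
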